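(* The metaplectic semigroup $\mathrm{Mp}_+(d,\mathbb{C})$ is generated by $$\mathcal{F}f(\xi)=i^{-d/2}\int_{\mathbb{R}^d}f(x)e^{-2\pi i\xi\cdot x}dx,\qquad f\in\mathcal{S}(\mathbb{R}^d),\ \xi\in\mathbb{R}^d$$ (extended to $L^2(\mathbb{R}^d)$) and by the families of $L^2$-contractions $$\mathfrak{p}_Qf(x)=e^{i\pi Qx\cdot x}f(x),\qquad Q\in\Sigma_{\ge0}(d),\ f\in L^2(\mathbb{R}^d),$$ $$\mathfrak{T}_Ef(x)=i^m|\det(E)|^{1/2}f(Ex),\qquad E\in\mathrm{GL}(d,\mathbb{R}),\ f\in L^2(\mathbb{R}^d),$$ where $m\in\mathbb{Z}$ and $m\pi$ is an argument of $\det(E)$. Moreover, $\pi^{Mp}_+(\mathcal{F})=J$, $\pi^{Mp}_+(\mathfrak{p}_Q)=V_Q$ and $\pi^{Mp}_+(\mathfrak{T}_E)=\mathcal{D}_E$.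
   Context: $\Sigma_{\ge0}(d)$ is the set of complex symmetric $d\times d$ matrices with positive semi-definite imaginary part. $J=\begin{pmatrix}O_d&I_d\\-I_d&O_d\end{pmatrix}$, $V_Q=\begin{pmatrix}I_d&O_d\\Q&I_d\end{pmatrix}$, $\mathcal{D}_E=\begin{pmatrix}E^{-1}&O_d\\O_d&E^\top\end{pmatrix}$. $\mathrm{Sp}(d,\mathbb{C})=\{S:S^\top JS=J\}$, and $\mathrm{Sp}_+(d,\mathbb{C})$ is the semigroup of those $S$ with $i^{-1}(\sigma(Sz,\overline{Sz})-\sigma(z,\overline z))\ge0$ for all $z\in\mathbb{C}^{2d}$, $\sigma(z,w)=Jz\cdot w$ (bilinear dot product). $\mathrm{Mp}(d,\mathbb{R})$ is the real metaplectic group: the group of unitary operators on $L^2(\mathbb{R}^d)$ generated by $\mathcal{F}$, $\mathfrak{p}_Q$ with $Q$ real symmetric, and $\mathfrak{T}_E$ with $E\in\mathrm{GL}(d,\mathbb{R})$; the two-fold covering homomorphism $\pi^{Mp}$ onto $\mathrm{Sp}(d,\mathbb{R})$ sends these to $J$, $V_Q$, $\mathcal{D}_E$. With $\widehat f(\eta)=\int f(x)e^{-2\pi i\eta x}dx$, for $\vartheta\ge0$, $\alpha>0$ set on $L^2(\mathbb{R})$: $\mathfrak{R}_\vartheta f(x)=(\cosh\vartheta)^{-1/2}\int_{\mathbb{R}}e^{i\pi(2x\eta+i(x^2+\eta^2)\sinh\vartheta)/\cosh\vartheta}\widehat f(\eta)d\eta$, $\mathfrak{p}_{i\alpha}f(x)=e^{-\pi\alpha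 x^2}f(x)$. An atomic metaplectic contraction is $\widehat\Xi=\widehat\Xi_1\otimes\cdots\otimes\widehat\Xi_d$ with each $\widehat\Xi_j$ equal to some $\mathfrak{R}_{\vartheta_j}$ or $\mathfrak{p}_{i\alpha_j}$. By definition, $\mathrm{Mp}_+(d,\mathbb{C})$ is the semigroup generated by $\mathrm{Mp}(d,\mathbb{R})$ and atomic metaplectic contractions. The projection is the homomorphism $\pi^{Mp}_+:\mathrm{Mp}_+(d,\mathbb{C})\to\mathrm{Sp}_+(d,\mathbb{C})$ (a two-fold cover) equal to $\pi^{Mp}$ on $\mathrm{Mp}(d,\mathbb{R})$ and sending $\widehat\Xi$ to $\Xi=\begin{pmatrix}\mathrm{diag}(a_j)&\mathrm{diag}(b_j)\\ \mathrm{diag}(c_j)&\mathrm{diag}(d_j)\end{pmatrix}$, where $\begin{pmatrix}a_j&b_j\\c_j&d_j\end{pmatrix}$ is $\begin{pmatrix}\cosh\vartheta_j&-i\sinh\vartheta_j\\ i\sinh\vartheta_j&\cosh\vartheta_j\end{pmatrix}$ if $\widehat\Xi_j=\mathfrak{R}_{\vartheta_j}$ and $\begin{pmatrix}1&0\\ i\alpha_j&1\end{pmatrix}$ if $\widehat\Xi_j=\mathfrak{p}_{i\alpha_j}$. *)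

theory Defs
  imports "HOL-Analysis.Analysis"
begin

section \<open>The Hilbert space of square integrable functions modulo null sets\<close>

definition sq_integrable :: "('a::euclidean_space \<Rightarrow> complex) \<Rightarrow> bool" where
  "sq_integrable f \<longleftrightarrow>
     f \<in> borel_measurable lborel \<and> integrable lborel (\<lambda>x. (norm (f x))\<^sup>2)"

definition l2rel :: "('a::euclidean_space \<Rightarrow> complex) \<Rightarrow> ('a \<Rightarrow> complex) \<Rightarrow> bool" where
  "l2rel f g \<longleftrightarrow> sq_integrable f \<and> sq_integrable g \<and> (AE x in lborel. f x = g x)"

lemma sq_integrable_measurable [measurable_dest]:
  "sq_integrable f \<Longrightarrow> f \<in> borel_measurable lborel"
  by (simp add: sq_integrable_def)

lemma sq_integrable_zero: "sq_integrable (\<lambda>x. 0)"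
  by (simp add: sq_integrable_def)

lemma sq_integrable_scaleR: "sq_integrable f \<Longrightarrow> sq_integrable (\<lambda>x. c *\<^sub>R f x)"
  unfolding sq_integrable_def
  by (auto simp: power_mult_distrib simp del: scaleR_conv_of_real
      intro!: borel_measurable_scaleR)

lemma sq_integrable_add:
  assumes f: "sq_integrable f" and g: "sq_integrable g"
  shows "sq_integrable (\<lambda>x. f x + g x)"
proof -
  have [measurable]: "f \<in> borel_measurable lborel" "g \<in> borel_measurable lborel"
    using f g by (auto simp: sq_integrable_def)
  have "integrable lborel (\<lambda>x. (norm (f x + g x))\<^sup>2)"
  proof (rule Bochner_Integration.integrable_bound)
    show "integrable lborel (\<lambda>x. 2 * (norm (f x))\<^sup>2 + 2 * (norm (g x))\<^sup>2)"
      using f g by (simp add: sq_integrable_def)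
    have "(norm (f x + g x))\<^sup>2 \<le> 2 * (norm (f x))\<^sup>2 + 2 * (norm (g x))\<^sup>2" for x
    proof -
      have "(norm (f x + g x))\<^sup>2 \<le> (norm (f x) + norm (g x))\<^sup>2"
        by (intro power_mono norm_triangle_ineq) simp
      also have "\<dots> \<le> 2 * (norm (f x))\<^sup>2 + 2 * (norm (g x))\<^sup>2"
        using sum_squares_bound[of "norm (f x)" "norm (g x)"]
        by (simp add: power2_sum)
      finally show ?thesis .
    qed
    then show "AE x in lborel. norm ((norm (f x + g x))\<^sup>2)
        \<le> norm (2 * (norm (f x))\<^sup>2 + 2 * (norm (g x))\<^sup>2)"
      by auto
  qed simp
  then show ?thesis by (simp add: sq_integrable_def)
qed

lemma sq_integrable_inner:
  assumes f: "sq_integrable f" and g: "sq_integrable g"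
  shows "integrable lborel (\<lambda>x. f x \<bullet> g x)"
proof (rule Bochner_Integration.integrable_bound)
  have [measurable]: "f \<in> borel_measurable lborel" "g \<in> borel_measurable lborel"
    using f g by (auto simp: sq_integrable_def)
  show "(\<lambda>x. f x \<bullet> g x) \<in> borel_measurable lborel" by measurable
  show "integrable lborel (\<lambda>x. (norm (f x))\<^sup>2 + (norm (g x))\<^sup>2)"
    using f g by (simp add: sq_integrable_def)
  have "\<bar>f x \<bullet> g x\<bar> \<le> (norm (f x))\<^sup>2 + (norm (g x))\<^sup>2" for x
  proof -
    have "\<bar>f x \<bullet> g x\<bar> \<le> norm (f x) * norm (g x)" by (rule Cauchy_Schwarz_ineq2)
    also have "\<dots> \<le> 2 * norm (f x) * norm (g x)" by simp
    also have "\<dots> \<le> (norm (f x))\<^sup>2 + (norm (g x))\<^sup>2" by (rule sum_squares_bound)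
    finally show ?thesis .
  qed
  then show "AE x in lborel. norm (f x \<bullet> g x) \<le> norm ((norm (f x))\<^sup>2 + (norm (g x))\<^sup>2)"
    by auto
qed

quotient_type (overloaded) 'a l2 = "'a::euclidean_space \<Rightarrow> complex" / partial: l2rel
proof (rule part_equivpI)
  show "\<exists>f :: 'a \<Rightarrow> complex. l2rel f f"
    by (intro exI[of _ "\<lambda>x. 0"]) (simp add: l2rel_def sq_integrable_zero)
  show "symp (l2rel :: ('a \<Rightarrow> complex) \<Rightarrow> _)"
    by (auto simp: l2rel_def intro!: sympI)
  show "transp (l2rel :: ('a \<Rightarrow> complex) \<Rightarrow> _)"
    by (rule transpI) (auto simp: l2rel_def)
qed

text \<open>
  \<^const>\<open>abs_l2\<close> is the class of a square integrable function, \<^const>\<open>rep_l2\<close> a chosen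
  representative of a class.  The space carries the real part of the usual inner product,
  which induces the usual norm.
\<close>

instantiation l2 :: (euclidean_space) real_inner
begin

lift_definition zero_l2 :: "'a l2" is "\<lambda>x. 0"
  by (simp add: l2rel_def sq_integrable_zero)

lift_definition plus_l2 :: "'a l2 \<Rightarrow> 'a l2 \<Rightarrow> 'a l2" is "\<lambda>f g x. f x + g x"
  by (auto simp: l2rel_def intro: sq_integrable_add)

lift_definition scaleR_l2 :: "real \<Rightarrow> 'a l2 \<Rightarrow> 'a l2" is "\<lambda>c f x. c *\<^sub>R f x"
  by (auto simp: l2rel_def intro: sq_integrable_scaleR)

definition uminus_l2 :: "'a l2 \<Rightarrow> 'a l2" where "uminus_l2 f = (-1) *\<^sub>R f"

definition minus_l2 :: "'a l2 \<Rightarrow> 'a l2 \<Rightarrow> 'a l2" where "minus_l2 f g = f + (- g)"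

lift_definition inner_l2 :: "'a l2 \<Rightarrow> 'a l2 \<Rightarrow> real" is "\<lambda>f g. LINT x|lborel. f x \<bullet> g x"
  by (rule integral_cong_AE) (auto simp: l2rel_def sq_integrable_def)

definition norm_l2 :: "'a l2 \<Rightarrow> real" where "norm_l2 f = sqrt (f \<bullet> f)"

definition sgn_l2 :: "'a l2 \<Rightarrow> 'a l2" where "sgn_l2 f = inverse (norm f) *\<^sub>R f"

definition dist_l2 :: "'a l2 \<Rightarrow> 'a l2 \<Rightarrow> real" where "dist_l2 f g = norm (f - g)"

definition uniformity_l2 :: "('a l2 \<times> 'a l2) filter" where
  "uniformity_l2 = (INF e\<in>{0<..}. principal {(x, y). dist x y < e})"

definition open_l2 :: "'a l2 set \<Rightarrow> bool" where
  "open_l2 U \<longleftrightarrow> (\<forall>x\<in>U. eventually (\<lambda>(x', y). x' = x \<longrightarrow> y \<in> U) uniformity)"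

instance
proof
  fix f g h :: "'a l2" and a b :: real
  show "f + g + h = f + (g + h)"
    by transfer (auto simp: l2rel_def add.assoc intro!: sq_integrable_add)
  show "f + g = g + f"
    by transfer (auto simp: l2rel_def add.commute intro!: sq_integrable_add)
  show "0 + f = f"
    by transfer (auto simp: l2rel_def)
  show "- f + f = 0"
    unfolding uminus_l2_def
    by transfer (auto simp: l2rel_def sq_integrable_zero)
  show "f - g = f + - g"
    by (simp add: minus_l2_def)
  show "a *\<^sub>R (f + g) = a *\<^sub>R f + a *\<^sub>R g"
    by transfer
      (auto simp: l2rel_def scaleR_add_right intro!: sq_integrable_add sq_integrable_scaleR)
  show "(a + b) *\<^sub>R f = a *\<^sub>R f + b *\<^sub>R f"
    by transfer
      (auto simp: l2rel_def scaleR_add_left intro!: sq_integrable_add sq_integrable_scaleR)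
  show "a *\<^sub>R b *\<^sub>R f = (a * b) *\<^sub>R f"
    by transfer (auto simp: l2rel_def intro!: sq_integrable_scaleR)
  show "1 *\<^sub>R f = f"
    by transfer (auto simp: l2rel_def)
  show "sgn f = inverse (norm f) *\<^sub>R f"
    by (simp add: sgn_l2_def)
  show "dist f g = norm (f - g)"
    by (simp add: dist_l2_def)
  show "(uniformity :: ('a l2 \<times> 'a l2) filter)
      = (INF e\<in>{0<..}. principal {(x, y). dist x y < e})"
    by (rule uniformity_l2_def)
  show "open U \<longleftrightarrow> (\<forall>x\<in>U. eventually (\<lambda>(x', y). x' = x \<longrightarrow> y \<in> U) uniformity)"
    for U :: "'a l2 set"
    by (rule open_l2_def)
  show "f \<bullet> g = g \<bullet> f"
    by transfer (simp add: inner_commute)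
  show "(f + g) \<bullet> h = f \<bullet> h + g \<bullet> h"
    by transfer (simp add: l2rel_def inner_add_left sq_integrable_inner)
  show "(a *\<^sub>R f) \<bullet> g = a * (f \<bullet> g)"
    by transfer simp
  show "0 \<le> f \<bullet> f"
    by transfer simp
  show "f \<bullet> f = 0 \<longleftrightarrow> f = 0"
  proof (transfer, goal_cases)
    case (1 f)
    then have sq: "sq_integrable f" by (simp add: l2rel_def)
    have "(LINT x|lborel. f x \<bullet> f x) = 0 \<longleftrightarrow> (AE x in lborel. f x \<bullet> f x = 0)"
      by (rule integral_nonneg_eq_0_iff_AE) (auto intro: sq_integrable_inner sq)
    then show ?case
      by (simp add: l2rel_def sq sq_integrable_zero)
  qed
  show "norm f = sqrt (f \<bullet> f)"
    by (rule norm_l2_def)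
qed

end


section \<open>Extension of operators from the Schwartz class\<close>

primrec iter_deriv :: "'a::euclidean_space list \<Rightarrow> ('a \<Rightarrow> complex) \<Rightarrow> 'a \<Rightarrow> complex" where
  "iter_deriv [] f = f"
| "iter_deriv (v # vs) f = (\<lambda>x. frechet_derivative (iter_deriv vs f) (at x) v)"

definition schwartz :: "('a::euclidean_space \<Rightarrow> complex) \<Rightarrow> bool" where
  "schwartz f \<longleftrightarrow> (\<forall>vs. set vs \<subseteq> Basis \<longrightarrow>
     (\<forall>x. iter_deriv vs f differentiable (at x)) \<and>
     (\<forall>k::nat. \<exists>C. \<forall>x. norm x ^ k * norm (iter_deriv vs f x) \<le> C))"

text \<open>
  The bounded operator that agrees with a given operator on Schwartz functions.  Boundedness
  is only required over the reals; if the given operator is complex linear, then so is its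
  extension, since the Schwartz functions form a dense complex subspace.
\<close>

definition l2_extension ::
    "(('a::euclidean_space \<Rightarrow> complex) \<Rightarrow> 'a \<Rightarrow> complex) \<Rightarrow> 'a l2 \<Rightarrow> 'a l2" where
  "l2_extension K =
     (THE U. bounded_linear U \<and> (\<forall>f. schwartz f \<longrightarrow> U (abs_l2 f) = abs_l2 (K f)))"

definition fourier_integral :: "('a::euclidean_space \<Rightarrow> complex) \<Rightarrow> 'a \<Rightarrow> complex" where
  "fourier_integral f \<eta> = (LINT x|lborel. f x * exp (- (2 * of_real pi * \<i> * of_real (\<eta> \<bullet> x))))"


section \<open>Generators of the metaplectic semigroup\<close>

definition cvec :: "real ^ 'n \<Rightarrow> complex ^ 'n" where
  "cvec x = (\<chi> i. of_real (x $ i))"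

definition cmat :: "real ^ 'n ^ 'm \<Rightarrow> complex ^ 'n ^ 'm" where
  "cmat A = (\<chi> i j. of_real (A $ i $ j))"

definition cdot :: "complex ^ 'n \<Rightarrow> complex ^ 'n \<Rightarrow> complex" where
  "cdot z w = (\<Sum>i\<in>UNIV. z $ i * w $ i)"

definition Sigma_ge0 :: "(complex ^ 'n ^ 'n) set" where
  "Sigma_ge0 = {Q. transpose Q = Q \<and> (\<forall>x :: real ^ 'n. 0 \<le> x \<bullet> ((\<chi> i j. Im (Q $ i $ j)) *v x))}"

definition F_op :: "(real ^ 'n) l2 \<Rightarrow> (real ^ 'n) l2" where
  "F_op = l2_extension (\<lambda>f \<xi>. \<i> powr (- of_nat CARD('n) / 2) * fourier_integral f \<xi>)"

definition p_op :: "complex ^ 'n ^ 'n \<Rightarrow> (real ^ 'n) l2 \<Rightarrow> (real ^ 'n) l2" where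
  "p_op Q f = abs_l2 (\<lambda>x. exp (\<i> * of_real pi * cdot (Q *v cvec x) (cvec x)) * rep_l2 f x)"

text \<open>
  The operator is determined by the matrix only up to sign; the integer \<open>m\<close> has to be such
  that \<open>m * pi\<close> is an argument of the determinant, which is \<open>T_admissible\<close>.
\<close>

definition T_op :: "int \<Rightarrow> real ^ 'n ^ 'n \<Rightarrow> (real ^ 'n) l2 \<Rightarrow> (real ^ 'n) l2" where
  "T_op m E f = abs_l2 (\<lambda>x. \<i> powi m * of_real (sqrt \<bar>det E\<bar>) * rep_l2 f (E *v x))"

definition T_admissible :: "int \<Rightarrow> real ^ 'n ^ 'n \<Rightarrow> bool" where
  "T_admissible m E \<longleftrightarrow> invertible E \<and> is_Arg (of_real (det E)) (of_int m * pi)"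


section \<open>Symplectic matrices\<close>

definition block :: "'a ^ 'n ^ 'n \<Rightarrow> 'a ^ 'n ^ 'n \<Rightarrow> 'a ^ 'n ^ 'n \<Rightarrow> 'a ^ 'n ^ 'n
    \<Rightarrow> 'a ^ ('n::finite + 'n) ^ ('n + 'n)" where
  "block A B C D = (\<chi> i j. case i of
     Inl i' \<Rightarrow> (case j of Inl j' \<Rightarrow> A $ i' $ j' | Inr j' \<Rightarrow> B $ i' $ j')
   | Inr i' \<Rightarrow> (case j of Inl j' \<Rightarrow> C $ i' $ j' | Inr j' \<Rightarrow> D $ i' $ j'))"

definition diag_mat :: "('n \<Rightarrow> 'a::zero) \<Rightarrow> 'a ^ 'n ^ 'n" where
  "diag_mat g = (\<chi> i j. if i = j then g i else 0)"

definition J_mat :: "'a::ring_1 ^ ('n::finite + 'n) ^ ('n + 'n)" where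
  "J_mat = block 0 (mat 1) (- mat 1) 0"

definition V_mat :: "'a::ring_1 ^ 'n ^ 'n \<Rightarrow> 'a ^ ('n::finite + 'n) ^ ('n + 'n)" where
  "V_mat Q = block (mat 1) 0 Q (mat 1)"

definition D_mat :: "'a::field ^ 'n ^ 'n \<Rightarrow> 'a ^ ('n::finite + 'n) ^ ('n + 'n)" where
  "D_mat E = block (matrix_inv E) 0 0 (transpose E)"

definition Sp :: "('a::comm_ring_1 ^ ('n::finite + 'n) ^ ('n + 'n)) set" where
  "Sp = {S. transpose S ** J_mat ** S = J_mat}"

definition symp_form :: "complex ^ ('n::finite + 'n) \<Rightarrow> complex ^ ('n + 'n) \<Rightarrow> complex" where
  "symp_form z w = cdot (J_mat *v z) w"

definition vcnj :: "complex ^ 'n \<Rightarrow> complex ^ 'n" where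
  "vcnj z = (\<chi> i. cnj (z $ i))"

definition Sp_plus :: "(complex ^ ('n::finite + 'n) ^ ('n + 'n)) set" where
  "Sp_plus = {S \<in> Sp. \<forall>z.
     inverse \<i> * (symp_form (S *v z) (vcnj (S *v z)) - symp_form z (vcnj z)) \<in> \<real>\<^sub>\<ge>\<^sub>0}"


section \<open>The real metaplectic group and its projection\<close>

inductive_set generated_group :: "('a \<Rightarrow> 'a) set \<Rightarrow> ('a \<Rightarrow> 'a) set"
  for G :: "('a \<Rightarrow> 'a) set" where
  one: "id \<in> generated_group G"
| base: "T \<in> G \<Longrightarrow> T \<in> generated_group G"
| inverse: "T \<in> generated_group G \<Longrightarrow> inv T \<in> generated_group G"
| comp: "T \<in> generated_group G \<Longrightarrow> U \<in> generated_group G \<Longrightarrow> T \<circ> U \<in> generated_group G"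

inductive_set generated_semigroup :: "('a \<Rightarrow> 'a) set \<Rightarrow> ('a \<Rightarrow> 'a) set"
  for G :: "('a \<Rightarrow> 'a) set" where
  base: "T \<in> G \<Longrightarrow> T \<in> generated_semigroup G"
| comp: "T \<in> generated_semigroup G \<Longrightarrow> U \<in> generated_semigroup G
    \<Longrightarrow> T \<circ> U \<in> generated_semigroup G"

definition Mp :: "((real ^ 'n) l2 \<Rightarrow> (real ^ 'n) l2) set" where
  "Mp = generated_group
     ({F_op} \<union> {p_op (cmat Q) |Q. transpose Q = Q} \<union> {T_op m E |m E. T_admissible m E})"

definition pi_Mp :: "((real ^ 'n) l2 \<Rightarrow> (real ^ 'n) l2) \<Rightarrow> real ^ ('n::finite + 'n) ^ ('n + 'n)" where
  "pi_Mp = (THE p. p \<in> Mp \<rightarrow>\<^sub>E Sp \<and>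
     (\<forall>T\<in>Mp. \<forall>U\<in>Mp. p (T \<circ> U) = p T ** p U) \<and>
     p F_op = J_mat \<and>
     (\<forall>Q. transpose Q = Q \<longrightarrow> p (p_op (cmat Q)) = V_mat Q) \<and>
     (\<forall>m E. T_admissible m E \<longrightarrow> p (T_op m E) = D_mat E))"


section \<open>Atomic contractions and the metaplectic semigroup\<close>

text \<open>
  For \<open>\<theta> = 0\<close> the defining integral converges absolutely only if the Fourier transform of
  the argument is integrable, hence the extension from the Schwartz class.
\<close>

definition R_op :: "real \<Rightarrow> real l2 \<Rightarrow> real l2" where
  "R_op \<theta> = l2_extension (\<lambda>f x. of_real (cosh \<theta> powr (-1/2)) *
     (LINT \<eta>|lborel. exp (\<i> * of_real pi *
         (of_real (2 * x * \<eta>) + \<i> * of_real ((x\<^sup>2 + \<eta>\<^sup>2) * sinh \<theta>)) / of_real (cosh \<theta>))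
       * fourier_integral f \<eta>))"

definition gauss_op :: "real \<Rightarrow> real l2 \<Rightarrow> real l2" where
  "gauss_op \<alpha> f = abs_l2 (\<lambda>x. of_real (exp (- pi * \<alpha> * x\<^sup>2)) * rep_l2 f x)"

definition tensor_fun :: "('n \<Rightarrow> real l2) \<Rightarrow> (real ^ 'n) l2" where
  "tensor_fun f = abs_l2 (\<lambda>x. \<Prod>j\<in>UNIV. rep_l2 (f j) (x $ j))"

definition tensor_op :: "('n \<Rightarrow> real l2 \<Rightarrow> real l2) \<Rightarrow> (real ^ 'n) l2 \<Rightarrow> (real ^ 'n) l2" where
  "tensor_op A =
     (THE U. bounded_linear U \<and> (\<forall>f. U (tensor_fun f) = tensor_fun (\<lambda>j. A j (f j))))"

datatype atom = Rot real | Gauss real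

fun atom_ok :: "atom \<Rightarrow> bool" where
  "atom_ok (Rot \<theta>) \<longleftrightarrow> 0 \<le> \<theta>"
| "atom_ok (Gauss \<alpha>) \<longleftrightarrow> 0 < \<alpha>"

fun atom_op :: "atom \<Rightarrow> real l2 \<Rightarrow> real l2" where
  "atom_op (Rot \<theta>) = R_op \<theta>"
| "atom_op (Gauss \<alpha>) = gauss_op \<alpha>"

fun atom_mat :: "atom \<Rightarrow> complex ^ 2 ^ 2" where
  "atom_mat (Rot \<theta>) =
     vector [vector [of_real (cosh \<theta>), - \<i> * of_real (sinh \<theta>)],
             vector [\<i> * of_real (sinh \<theta>), of_real (cosh \<theta>)]]"
| "atom_mat (Gauss \<alpha>) = vector [vector [1, 0], vector [\<i> * of_real \<alpha>, 1]]"

definition Xi_op :: "('n \<Rightarrow> atom) \<Rightarrow> (real ^ 'n) l2 \<Rightarrow> (real ^ 'n) l2" where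
  "Xi_op a = tensor_op (\<lambda>j. atom_op (a j))"

definition Xi_mat :: "('n \<Rightarrow> atom) \<Rightarrow> complex ^ ('n::finite + 'n) ^ ('n + 'n)" where
  "Xi_mat a = block
     (diag_mat (\<lambda>j. atom_mat (a j) $ 1 $ 1)) (diag_mat (\<lambda>j. atom_mat (a j) $ 1 $ 2))
     (diag_mat (\<lambda>j. atom_mat (a j) $ 2 $ 1)) (diag_mat (\<lambda>j. atom_mat (a j) $ 2 $ 2))"

definition Mp_plus :: "((real ^ 'n) l2 \<Rightarrow> (real ^ 'n) l2) set" where
  "Mp_plus = generated_semigroup (Mp \<union> {Xi_op a |a. \<forall>j. atom_ok (a j)})"

definition pi_Mp_plus ::
    "((real ^ 'n) l2 \<Rightarrow> (real ^ 'n) l2) \<Rightarrow> complex ^ ('n::finite + 'n) ^ ('n + 'n)" where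
  "pi_Mp_plus = (THE p. p \<in> Mp_plus \<rightarrow>\<^sub>E Sp_plus \<and>
     (\<forall>T\<in>Mp_plus. \<forall>U\<in>Mp_plus. p (T \<circ> U) = p T ** p U) \<and>
     (\<forall>T\<in>Mp. p T = cmat (pi_Mp T)) \<and>
     (\<forall>a. (\<forall>j. atom_ok (a j)) \<longrightarrow> p (Xi_op a) = Xi_mat a))"

end

theory Submission
  imports Defs "HOL-Complex_Analysis.Conformal_Mappings" "HOL-Probability.Sinc_Integral"
begin

text \<open>
  The equality of semigroups has two halves.  In one variable, the matrix of \<open>R_op \<theta>\<close> is a product of shears,
  a lower, an upper and again a lower triangular one, with the parameters \<open>tanh (\<theta> / 2)\<close>, \<open>sinh \<theta>\<close> and
  \<open>tanh (\<theta> / 2)\<close>; accordingly the operator is a Gaussian multiplier, followed by a Gaussian Fourier multiplier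
  and again a Gaussian multiplier, which is verified by comparing Gaussian kernels (\<open>R_op_eq\<close>).  Taking tensor
  products, every atomic contraction is a product of operators \<open>p_op Q\<close> with diagonal \<open>Q\<close>, of \<open>F_op\<close> and of its
  inverse (\<open>Xi_op_eq\<close>), and the inverse of \<open>F_op\<close> is \<open>F_op \<circ> T_op n (- 1)\<close>.  Conversely, \<open>p_op\<close> turns sums into
  products.  The real part of \<open>Q \<in> Sigma_ge0\<close> gives a real metaplectic operator, and the imaginary part is a
  sum of rank one forms, obtained by completing squares.  The multiplier of a rank one form \<open>(v \<bullet> x)\<^sup>2\<close> is an
  atomic contraction in one coordinate conjugated by a change of variables that makes \<open>v \<bullet> x\<close> this coordinate
  (\<open>p_op_outer_Mp_plus\<close>, \<open>p_op_psd_Mp_plus\<close>).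

  The projections are defined by unique existence, so they have to be constructed.  Consider the generalised
  Gaussians \<open>exp (\<i> \<pi> Z x \<bullet> x + 2 \<pi> \<i> w \<bullet> x)\<close> with \<open>Z\<close> in the Siegel half-space and \<open>w\<close> a complex vector.  Every
  generator sends such a function to a nonzero multiple of another one, and the new parameters \<open>Z'\<close> and \<open>w'\<close>
  are given by the matrix \<open>S\<close> with the blocks \<open>A\<close>, \<open>B\<close>, \<open>C\<close>, \<open>D\<close>:

    \<open>C + D Z = Z' (A + B Z)\<close>,  \<open>transpose (A + B Z) w' = w\<close>.

  This relation between operators and matrices, \<open>acts_by\<close>, is multiplicative (\<open>acts_by_comp\<close>).  It also determines
  the matrix (\<open>acts_by_unique\<close>): the action on \<open>Z\<close> alone would leave a scalar factor undetermined, and the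
  action on \<open>w\<close> fixes it.  So it is the graph of a homomorphism, which has the prescribed values on
  the generators, and by induction over products every homomorphism with these values is contained in it.
  Its values at \<open>F_op\<close>, \<open>p_op Q\<close> and \<open>T_op m E\<close> are read off from the action of these operators on Gaussians.

  The analysis behind both parts rests on the density of the span of the Gaussians in the space of square
  integrable classes (\<open>closure_span_gauss_classes\<close>).  It makes extensions from Schwartz functions unique and yields
  the Fourier transform as the isometric extension of its explicit action on Gaussians
  (\<open>fourier_isometry_exists\<close>).  The Gaussian integrals themselves follow by analytic continuation from real
  translations (\<open>gauss_int_shift_complex\<close>).
\<close>

(* The dollar sign is the component of a vector throughout. *)
no_notation fps_nth (infixl "$" 75)

section \<open>Square integrable functions and their classes\<close>

lemma l2rel_rep_abs:
  assumes "sq_integrable f"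
  shows "l2rel (rep_l2 (abs_l2 f)) f"
  using Quotient_rep_abs[OF Quotient_l2, of f] assms by (simp add: l2rel_def)

lemma sq_integrable_rep [simp]: "sq_integrable (rep_l2 F)"
  using Quotient_rep_reflp[OF Quotient_l2, of F] by (simp add: l2rel_def)

lemma abs_rep_l2 [simp]: "abs_l2 (rep_l2 F) = F"
  by (rule Quotient_abs_rep[OF Quotient_l2])

lemma AE_rep_abs:
  assumes "sq_integrable f"
  shows "AE x in lborel. rep_l2 (abs_l2 f) x = f x"
  using l2rel_rep_abs[OF assms] by (simp add: l2rel_def)

lemma abs_l2_eqI:
  assumes "sq_integrable f" "sq_integrable g" "AE x in lborel. f x = g x"
  shows "abs_l2 f = abs_l2 g"
  using assms Quotient_rel_abs[OF Quotient_l2] by (auto simp: l2rel_def)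

lemma abs_l2_eqD:
  assumes "sq_integrable f" "sq_integrable g" "abs_l2 f = abs_l2 g"
  shows "AE x in lborel. f x = g x"
  using AE_rep_abs[OF assms(1)] AE_rep_abs[OF assms(2)] assms(3) by auto

lemma measurable_rep_l2 [measurable]: "rep_l2 F \<in> borel_measurable borel"
  using sq_integrable_measurable[OF sq_integrable_rep[of F]] by simp

lemma sq_integrable_borel: "sq_integrable f \<Longrightarrow> f \<in> borel_measurable borel"
  using sq_integrable_measurable[of f] by simp

lemma abs_l2_add:
  assumes "sq_integrable f" "sq_integrable g"
  shows "abs_l2 (\<lambda>x. f x + g x) = abs_l2 f + abs_l2 g"
  using assms by (simp add: plus_l2.abs_eq l2rel_def)

lemma abs_l2_scaleR:
  assumes "sq_integrable f"
  shows "abs_l2 (\<lambda>x. c *\<^sub>R f x) = c *\<^sub>R abs_l2 f"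
  using assms by (simp add: scaleR_l2.abs_eq l2rel_def)

lemma abs_l2_zero: "abs_l2 (\<lambda>x. 0) = 0"
  by (simp add: zero_l2_def)

lemma sq_integrable_diff:
  assumes "sq_integrable f" "sq_integrable g"
  shows "sq_integrable (\<lambda>x. f x - g x)"
  using sq_integrable_add[OF assms(1) sq_integrable_scaleR[OF assms(2), of "-1"]] by simp

lemma abs_l2_diff:
  assumes "sq_integrable f" "sq_integrable g"
  shows "abs_l2 (\<lambda>x. f x - g x) = abs_l2 f - abs_l2 g"
  using abs_l2_add[OF assms(1) sq_integrable_scaleR[OF assms(2), of "-1"]]
    abs_l2_scaleR[OF assms(2), of "-1"]
  by simp

lemma inner_abs_l2:
  assumes "sq_integrable f" "sq_integrable g"
  shows "abs_l2 f \<bullet> abs_l2 g = (LINT x|lborel. f x \<bullet> g x)"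
  using assms by (simp add: inner_l2.abs_eq l2rel_def)

lemma norm_abs_l2_sq:
  assumes "sq_integrable f"
  shows "(norm (abs_l2 f))\<^sup>2 = (LINT x|lborel. (norm (f x))\<^sup>2)"
  using inner_abs_l2[OF assms assms] by (simp add: power2_norm_eq_inner)

lemma norm_l2_sq: "(norm F)\<^sup>2 = (LINT x|lborel. (norm (rep_l2 F x))\<^sup>2)"
  using norm_abs_l2_sq[OF sq_integrable_rep[of F]] by simp

lemma nn_integral_norm_abs_l2:
  assumes "sq_integrable f"
  shows "(\<integral>\<^sup>+x. ennreal ((norm (f x))\<^sup>2) \<partial>lborel) = ennreal ((norm (abs_l2 f))\<^sup>2)"
  using assms unfolding norm_abs_l2_sq[OF assms]
  by (intro nn_integral_eq_integral) (auto simp: sq_integrable_def)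

lemma sq_integrable_bound:
  assumes "sq_integrable g" "f \<in> borel_measurable borel" "AE x in lborel. norm (f x) \<le> C * norm (g x)"
  shows "sq_integrable f"
proof -
  have "integrable lborel (\<lambda>x. (norm (f x))\<^sup>2)"
  proof (rule Bochner_Integration.integrable_bound)
    show "integrable lborel (\<lambda>x. C\<^sup>2 * (norm (g x))\<^sup>2)"
      using assms(1) by (simp add: sq_integrable_def)
    show "AE x in lborel. norm ((norm (f x))\<^sup>2) \<le> norm (C\<^sup>2 * (norm (g x))\<^sup>2)"
      using assms(3)
    proof eventually_elim
      case (elim x)
      have "(norm (f x))\<^sup>2 \<le> (C * norm (g x))\<^sup>2"
        by (rule power_mono[OF elim]) simp
      then show ?case by (simp add: power_mult_distrib)
    qed
    show "(\<lambda>x. (norm (f x))\<^sup>2) \<in> borel_measurable lborel" using assms(2) by simp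
  qed
  then show ?thesis using assms(2) by (simp add: sq_integrable_def)
qed

lemma norm_abs_l2_bound:
  assumes "sq_integrable g" "sq_integrable f" "AE x in lborel. norm (f x) \<le> C * norm (g x)" "0 \<le> C"
  shows "norm (abs_l2 f) \<le> C * norm (abs_l2 g)"
proof (rule power2_le_imp_le)
  have "(norm (abs_l2 f))\<^sup>2 = (LINT x|lborel. (norm (f x))\<^sup>2)"
    using assms by (simp add: norm_abs_l2_sq)
  also have "\<dots> \<le> (LINT x|lborel. C\<^sup>2 * (norm (g x))\<^sup>2)"
  proof (rule integral_mono_AE)
    show "AE x in lborel. (norm (f x))\<^sup>2 \<le> C\<^sup>2 * (norm (g x))\<^sup>2"
      using assms(3)
    proof eventually_elim
      case (elim x)
      have "(norm (f x))\<^sup>2 \<le> (C * norm (g x))\<^sup>2"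
        by (rule power_mono[OF elim]) simp
      then show ?case by (simp add: power_mult_distrib)
    qed
  qed (use assms in \<open>auto simp: sq_integrable_def\<close>)
  also have "\<dots> = (C * norm (abs_l2 g))\<^sup>2"
    using assms by (simp add: norm_abs_l2_sq power_mult_distrib)
  finally show "(norm (abs_l2 f))\<^sup>2 \<le> (C * norm (abs_l2 g))\<^sup>2" .
qed (use assms in simp)

text \<open>
  Dominated convergence in the mean: the dominating function is only required to be square
  integrable, since the squared differences are bounded by four times its square.
\<close>

lemma abs_l2_dominated_convergence:
  fixes f :: "nat \<Rightarrow> 'a::euclidean_space \<Rightarrow> complex"
  assumes g: "sq_integrable g" and fm: "\<And>n. f n \<in> borel_measurable borel"
    and hm: "h \<in> borel_measurable borel"
    and lim: "AE x in lborel. (\<lambda>n. f n x) \<longlonglongrightarrow> h x"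
    and bd: "\<And>n. AE x in lborel. norm (f n x) \<le> norm (g x)"
  shows "sq_integrable h" "(\<lambda>n. abs_l2 (f n)) \<longlonglongrightarrow> abs_l2 h"
proof -
  have fi: "sq_integrable (f n)" for n
    by (rule sq_integrable_bound[OF g fm, of n 1]) (use bd in simp)
  have hb: "AE x in lborel. norm (h x) \<le> norm (g x)"
  proof -
    have "AE x in lborel. \<forall>n. norm (f n x) \<le> norm (g x)"
      using bd by (simp add: AE_all_countable)
    with lim show ?thesis
    proof eventually_elim
      case (elim x)
      show ?case
        by (rule tendsto_upperbound[OF tendsto_norm[OF elim(1)]]) (use elim(2) in auto)
    qed
  qed
  show hi: "sq_integrable h"
    by (rule sq_integrable_bound[OF g hm, of 1]) (use hb in simp)
  have "(\<lambda>n. LINT x|lborel. (norm (f n x - h x))\<^sup>2) \<longlonglongrightarrow> 0"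
  proof -
    have "(\<lambda>n. LINT x|lborel. (norm (f n x - h x))\<^sup>2) \<longlonglongrightarrow> (LINT x|(lborel::'a measure). 0)"
    proof (rule integral_dominated_convergence)
      show "integrable lborel (\<lambda>x. 4 * (norm (g x))\<^sup>2)"
        using g by (simp add: sq_integrable_def)
      show "AE x in lborel. (\<lambda>n. (norm (f n x - h x))\<^sup>2) \<longlonglongrightarrow> 0"
        using lim
      proof eventually_elim
        case (elim x)
        then have "(\<lambda>n. (norm (f n x - h x))\<^sup>2) \<longlonglongrightarrow> (norm (h x - h x))\<^sup>2"
          by (intro tendsto_intros)
        then show ?case by simp
      qed
      show "AE x in lborel. norm ((norm (f n x - h x))\<^sup>2) \<le> 4 * (norm (g x))\<^sup>2" for n
        using bd[of n] hb
      proof eventually_elim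
        case (elim x)
        have "norm (f n x - h x) \<le> 2 * norm (g x)"
          using norm_triangle_ineq4[of "f n x" "h x"] elim by linarith
        then have "(norm (f n x - h x))\<^sup>2 \<le> (2 * norm (g x))\<^sup>2" by (rule power_mono) simp
        then show ?case by (simp add: power_mult_distrib)
      qed
    qed (use fm hm in simp_all)
    then show "(\<lambda>n. LINT x|lborel. (norm (f n x - h x))\<^sup>2) \<longlonglongrightarrow> 0" by simp
  qed
  then have "(\<lambda>n. (norm (abs_l2 (f n) - abs_l2 h))\<^sup>2) \<longlonglongrightarrow> 0"
    by (simp add: norm_abs_l2_sq[OF sq_integrable_diff[OF fi hi]] flip: abs_l2_diff[OF fi hi])
  then have "(\<lambda>n. sqrt ((norm (abs_l2 (f n) - abs_l2 h))\<^sup>2)) \<longlonglongrightarrow> sqrt 0"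
    by (rule tendsto_real_sqrt)
  then have "(\<lambda>n. norm (abs_l2 (f n) - abs_l2 h)) \<longlonglongrightarrow> 0" by simp
  then show "(\<lambda>n. abs_l2 (f n)) \<longlonglongrightarrow> abs_l2 h"
    using LIM_zero_cancel tendsto_norm_zero_iff by blast
qed

section \<open>Riesz--Fischer\<close>

text \<open>
  A sequence with increments below \<open>2^-k\<close> converges almost everywhere, because
  \<open>\<Sum>k. 2^k |f (Suc k) - f k|\<^sup>2\<close> has a finite integral and hence finite values; Fatou's lemma
  turns the pointwise limit into the limit in the mean.
\<close>

lemma l2_fast_Cauchy_convergent:
  fixes F :: "nat \<Rightarrow> 'a::euclidean_space l2"
  assumes step: "\<And>k. norm (F (Suc k) - F k) \<le> (1/2)^k"
    and cau: "Cauchy F"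
  shows "convergent F"
proof -
  define f where "f k = rep_l2 (F k)" for k
  have [simp]: "sq_integrable (f k)" for k by (simp add: f_def)
  have [measurable]: "f k \<in> borel_measurable borel" for k by (simp add: f_def)
  have absf [simp]: "abs_l2 (f k) = F k" for k by (simp add: f_def)
  let ?d = "\<lambda>k x. ennreal (2^k * (norm (f (Suc k) x - f k x))\<^sup>2)"
  have int_d: "(\<integral>\<^sup>+x. ?d k x \<partial>lborel) \<le> ennreal ((1/2)^k)" for k
  proof -
    have "(\<integral>\<^sup>+x. ?d k x \<partial>lborel) = ennreal (2^k) * (\<integral>\<^sup>+x. ennreal ((norm (f (Suc k) x - f k x))\<^sup>2) \<partial>lborel)"
      by (subst nn_integral_cmult[symmetric]) (auto simp: ennreal_mult)
    also have "\<dots> = ennreal (2^k * (norm (F (Suc k) - F k))\<^sup>2)"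
      by (subst nn_integral_norm_abs_l2) (auto intro: sq_integrable_diff simp: abs_l2_diff ennreal_mult)
    also have "\<dots> \<le> ennreal (2^k * ((1/2)^k)\<^sup>2)"
      by (intro ennreal_leI mult_left_mono power_mono step) auto
    also have "2^k * ((1/2)^k)\<^sup>2 = (1/2::real)^k"
      by (simp add: power2_eq_square power_divide)
    finally show ?thesis .
  qed
  have "(\<integral>\<^sup>+x. (\<Sum>k. ?d k x) \<partial>lborel) = (\<Sum>k. \<integral>\<^sup>+x. ?d k x \<partial>lborel)"
    by (rule nn_integral_suminf) simp
  also have "\<dots> \<le> (\<Sum>k. ennreal ((1/2)^k))"
    by (intro suminf_le int_d) auto
  also have "\<dots> < \<infinity>"
    by (subst suminf_ennreal2) (auto intro: summable_geometric)
  finally have "AE x in lborel. (\<Sum>k. ?d k x) \<noteq> \<infinity>"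
    by (intro nn_integral_PInf_AE) (auto simp: less_top)
  then have conv: "AE x in lborel. convergent (\<lambda>k. f k x)"
  proof eventually_elim
    case (elim x)
    have bd: "2^k * (norm (f (Suc k) x - f k x))\<^sup>2 \<le> enn2real (\<Sum>k. ?d k x)" for k
    proof -
      have "sum (\<lambda>k. ?d k x) {k} \<le> (\<Sum>k. ?d k x)"
        by (rule sum_le_suminf) auto
      then have "?d k x \<le> (\<Sum>k. ?d k x)" by simp
      then have "enn2real (?d k x) \<le> enn2real (\<Sum>k. ?d k x)"
        using elim by (intro enn2real_mono) (auto simp: less_top)
      then show ?thesis by simp
    qed
    define C where "C = enn2real (\<Sum>k. ?d k x)"
    have "norm (f (Suc k) x - f k x) \<le> sqrt C * (sqrt (1/2))^k" for k
    proof -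
      have "(norm (f (Suc k) x - f k x))\<^sup>2 \<le> C * (1/2)^k"
        using bd[of k] by (simp add: C_def power_one_over pos_le_divide_eq mult.commute)
      then have "sqrt ((norm (f (Suc k) x - f k x))\<^sup>2) \<le> sqrt (C * (1/2)^k)"
        by (rule real_sqrt_le_mono)
      then show ?thesis by (simp add: real_sqrt_mult real_sqrt_power)
    qed
    moreover have "summable (\<lambda>k. sqrt C * (sqrt (1/2))^k)"
      by (intro summable_mult summable_geometric) (simp add: real_sqrt_lt_1_iff)
    ultimately have "summable (\<lambda>k. f (Suc k) x - f k x)"
      by (rule summable_comparison_test'[where N=0 and g="\<lambda>k. sqrt C * (sqrt (1/2))^k", rotated])
    then have "convergent (\<lambda>n. \<Sum>k<n. f (Suc k) x - f k x)"
      by (simp add: summable_iff_convergent)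
    then have "convergent (\<lambda>n. f n x - f 0 x)"
      using sum_lessThan_telescope[of "\<lambda>k. f k x"] by simp
    then have "convergent (\<lambda>n. (f n x - f 0 x) + f 0 x)"
      by (intro convergent_add convergent_const)
    then show ?case by simp
  qed
  define h where "h x = lim (\<lambda>k. f k x)" for x
  have hm [measurable]: "h \<in> borel_measurable borel"
    unfolding h_def by (rule borel_measurable_lim_metric) simp
  have lim: "AE x in lborel. (\<lambda>k. f k x) \<longlonglongrightarrow> h x"
    using conv by eventually_elim (simp add: h_def convergent_LIMSEQ_iff)
  have key: "(\<integral>\<^sup>+x. ennreal ((norm (h x - f k x))\<^sup>2) \<partial>lborel) \<le> ennreal (e\<^sup>2)"
    if e: "\<And>m. m \<ge> k \<Longrightarrow> norm (F m - F k) \<le> e" for k e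
  proof -
    have "(\<integral>\<^sup>+x. ennreal ((norm (h x - f k x))\<^sup>2) \<partial>lborel)
        = (\<integral>\<^sup>+x. liminf (\<lambda>m. ennreal ((norm (f m x - f k x))\<^sup>2)) \<partial>lborel)"
    proof (rule nn_integral_cong_AE, use lim in eventually_elim)
      case (elim x)
      have "(\<lambda>m. ennreal ((norm (f m x - f k x))\<^sup>2)) \<longlonglongrightarrow> ennreal ((norm (h x - f k x))\<^sup>2)"
        by (intro tendsto_ennrealI tendsto_intros elim)
      from lim_imp_Liminf[OF _ this] show ?case by simp
    qed
    also have "\<dots> \<le> liminf (\<lambda>m. \<integral>\<^sup>+x. ennreal ((norm (f m x - f k x))\<^sup>2) \<partial>lborel)"
      by (rule nn_integral_liminf) simp
    also have "\<dots> = liminf (\<lambda>m. ennreal ((norm (F m - F k))\<^sup>2))"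
      by (subst nn_integral_norm_abs_l2) (auto intro: sq_integrable_diff simp: abs_l2_diff)
    also have "\<dots> \<le> ennreal (e\<^sup>2)"
    proof (rule Liminf_le)
      show "\<forall>\<^sub>F m in sequentially. ennreal ((norm (F m - F k))\<^sup>2) \<le> ennreal (e\<^sup>2)"
        using eventually_ge_at_top[of k]
        by eventually_elim (auto intro!: ennreal_leI power_mono e)
    qed simp
    finally show ?thesis .
  qed
  have small: "\<exists>N. \<forall>k\<ge>N. \<forall>m\<ge>k. norm (F m - F k) \<le> e" if "0 < e" for e
    using CauchyD[OF cau that] by (meson dual_order.trans less_imp_le)
  have hk: "sq_integrable (\<lambda>x. h x - f k x)" if "\<And>m. m \<ge> k \<Longrightarrow> norm (F m - F k) \<le> e" for k e
    using le_less_trans[OF key[OF that] ennreal_less_top]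
    by (auto simp: sq_integrable_def integrable_iff_bounded)
  obtain N where "\<And>m. m \<ge> N \<Longrightarrow> norm (F m - F N) \<le> 1"
    using small[of 1] by auto
  from hk[OF this] have "sq_integrable (\<lambda>x. (h x - f N x) + f N x)"
    by (rule sq_integrable_add) simp_all
  then have hi: "sq_integrable h" by simp
  have "F \<longlonglongrightarrow> abs_l2 h"
  proof (rule LIMSEQ_I)
    fix r :: real assume r: "0 < r"
    obtain N where N: "\<And>k m. k \<ge> N \<Longrightarrow> m \<ge> k \<Longrightarrow> norm (F m - F k) \<le> r/2"
      using small[of "r/2"] r by auto
    have "norm (F k - abs_l2 h) < r" if "k \<ge> N" for k
    proof -
      have "ennreal ((norm (abs_l2 h - F k))\<^sup>2) \<le> ennreal ((r/2)\<^sup>2)"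
        using key[OF N[OF that]] nn_integral_norm_abs_l2[OF sq_integrable_diff[OF hi, of "f k"]]
        by (simp add: abs_l2_diff hi)
      then have "norm (abs_l2 h - F k) \<le> r/2"
        using r by (simp add: power2_le_iff_abs_le)
      then show ?thesis using r by (simp add: norm_minus_commute)
    qed
    then show "\<exists>no. \<forall>n\<ge>no. norm (F n - abs_l2 h) < r" by blast
  qed
  then show ?thesis by (rule convergentI)
qed

instance l2 :: (euclidean_space) complete_space
proof
  fix X :: "nat \<Rightarrow> 'a l2" assume X: "Cauchy X"
  have "\<forall>k. \<exists>N. \<forall>m\<ge>N. \<forall>n\<ge>N. norm (X m - X n) < (1/2)^k"
    using CauchyD[OF X] by simp
  then obtain N where N: "\<And>k m n. m \<ge> N k \<Longrightarrow> n \<ge> N k \<Longrightarrow> norm (X m - X n) < (1/2)^k"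
    by metis
  define r where "r = rec_nat (N 0) (\<lambda>k a. max (Suc a) (N (Suc k)))"
  have r: "r 0 = N 0" "r (Suc k) = max (Suc (r k)) (N (Suc k))" for k
    by (simp_all add: r_def)
  have mono: "strict_mono r" by (rule strict_monoI_Suc) (simp add: r)
  have rN: "r k \<ge> N k" for k by (cases k) (simp_all add: r)
  have "convergent (X \<circ> r)"
  proof (rule l2_fast_Cauchy_convergent)
    show "norm ((X \<circ> r) (Suc k) - (X \<circ> r) k) \<le> (1/2)^k" for k
      using N[of k "r (Suc k)" "r k"] rN[of k] strict_monoD[OF mono, of k "Suc k"] by simp
    show "Cauchy (X \<circ> r)" using X mono by (rule Cauchy_subseq_Cauchy)
  qed
  then obtain l where "(X \<circ> r) \<longlonglongrightarrow> l" by (auto simp: convergent_def)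
  then show "convergent X"
    using Cauchy_converges_subseq[OF X mono] by (auto simp: convergent_def)
qed

section \<open>Multiplication operators\<close>

definition mult_op :: "('a::euclidean_space \<Rightarrow> complex) \<Rightarrow> 'a l2 \<Rightarrow> 'a l2" where
  "mult_op m F = abs_l2 (\<lambda>x. m x * rep_l2 F x)"

definition multiplier :: "('a::euclidean_space \<Rightarrow> complex) \<Rightarrow> bool" where
  "multiplier m \<longleftrightarrow> m \<in> borel_measurable borel \<and> (\<exists>C. \<forall>x. norm (m x) \<le> C)"

lemma multiplier_measurable [measurable_dest]: "multiplier m \<Longrightarrow> m \<in> borel_measurable borel"
  by (simp add: multiplier_def)

lemma multiplierI:
  "m \<in> borel_measurable borel \<Longrightarrow> (\<And>x. norm (m x) \<le> C) \<Longrightarrow> multiplier m"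
  by (auto simp: multiplier_def)

lemma multiplier_const [simp]: "multiplier (\<lambda>x. c)"
  by (rule multiplierI) auto

lemma multiplier_mult:
  assumes "multiplier m" "multiplier k" shows "multiplier (\<lambda>x. m x * k x)"
proof -
  obtain C D where CD: "\<And>x. norm (m x) \<le> C" "\<And>x. norm (k x) \<le> D"
    using assms by (auto simp: multiplier_def)
  have "norm (m x * k x) \<le> C * D" for x
    using CD[of x] norm_ge_zero[of "k x"] order_trans[OF norm_ge_zero CD(1)] 
    by (auto simp: norm_mult intro!: mult_mono)
  then show ?thesis using assms by (intro multiplierI[of _ "C * D"]) (auto simp: multiplier_def)
qed

lemma sq_integrable_mult:
  assumes "multiplier m" "sq_integrable f"
  shows "sq_integrable (\<lambda>x. m x * f x)"
proof -
  obtain C where C: "\<And>x. norm (m x) \<le> C" using assms by (auto simp: multiplier_def)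
  show ?thesis
  proof (rule sq_integrable_bound[OF assms(2)])
    show "(\<lambda>x. m x * f x) \<in> borel_measurable borel"
      using sq_integrable_borel[OF assms(2)] assms(1) by measurable
    show "AE x in lborel. norm (m x * f x) \<le> C * norm (f x)"
      by (auto simp: norm_mult intro!: AE_I2 mult_right_mono C)
  qed
qed

lemma mult_op_abs:
  assumes "multiplier m" "sq_integrable f"
  shows "mult_op m (abs_l2 f) = abs_l2 (\<lambda>x. m x * f x)"
  unfolding mult_op_def
  by (rule abs_l2_eqI) (use AE_rep_abs[OF assms(2)] in \<open>auto intro!: sq_integrable_mult assms\<close>)

lemma norm_mult_op_le:
  assumes "m \<in> borel_measurable borel" "\<And>x. norm (m x) \<le> C"
  shows "norm (mult_op m F) \<le> C * norm F"
proof -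
  have "0 \<le> C" using order_trans[OF norm_ge_zero assms(2)] .
  then show ?thesis
    using norm_abs_l2_bound[OF sq_integrable_rep[of F] sq_integrable_mult[OF multiplierI[OF assms] sq_integrable_rep[of F]], where C=C]
    by (simp add: mult_op_def norm_mult mult_right_mono assms)
qed

lemma bounded_linear_mult_op:
  assumes m: "multiplier m"
  shows "bounded_linear (mult_op m)"
proof -
  obtain C where C: "\<And>x. norm (m x) \<le> C" using assms by (auto simp: multiplier_def)
  have "mult_op m (F + G) = mult_op m F + mult_op m G" for F G
  proof -
    have "mult_op m (abs_l2 (rep_l2 F) + abs_l2 (rep_l2 G))
        = mult_op m (abs_l2 (rep_l2 F)) + mult_op m (abs_l2 (rep_l2 G))"
      by (simp add: mult_op_abs m sq_integrable_add sq_integrable_mult distrib_left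
          flip: abs_l2_add del: abs_rep_l2)
    then show ?thesis by simp
  qed
  moreover have "mult_op m (c *\<^sub>R F) = c *\<^sub>R mult_op m F" for c F
  proof -
    have "mult_op m (c *\<^sub>R abs_l2 (rep_l2 F)) = c *\<^sub>R mult_op m (abs_l2 (rep_l2 F))"
      by (simp add: mult_op_abs m sq_integrable_scaleR sq_integrable_mult
          flip: abs_l2_scaleR del: abs_rep_l2)
    then show ?thesis by simp
  qed
  ultimately show ?thesis
    using norm_mult_op_le[of m C] C m
    by (intro bounded_linear_intro[of _ C]) (auto simp: multiplier_def mult.commute)
qed

lemma mult_op_mult_op:
  assumes "multiplier m" "multiplier k"
  shows "mult_op m (mult_op k F) = mult_op (\<lambda>x. m x * k x) F"
proof -
  have "mult_op m (mult_op k (abs_l2 (rep_l2 F))) = mult_op (\<lambda>x. m x * k x) (abs_l2 (rep_l2 F))"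
    by (simp add: mult_op_abs assms sq_integrable_mult multiplier_mult mult.assoc del: abs_rep_l2)
  then show ?thesis by simp
qed

lemma mult_op_one [simp]: "mult_op (\<lambda>x. 1) F = F"
  by (simp add: mult_op_def)

section \<open>Operators determined on a dense span\<close>

lemma subspace_closure:
  fixes S :: "'a::real_normed_vector set"
  assumes S: "subspace S"
  shows "subspace (closure S)"
proof (rule subspaceI)
  show "0 \<in> closure S" using subspace_0[OF S] closure_subset by blast
next
  fix x y assume "x \<in> closure S" "y \<in> closure S"
  then obtain f g where f: "\<And>n. f n \<in> S" "f \<longlonglongrightarrow> x" and g: "\<And>n. g n \<in> S" "g \<longlonglongrightarrow> y"
    unfolding closure_sequential by metis
  have "(\<lambda>n. f n + g n) \<longlonglongrightarrow> x + y" by (intro tendsto_add f g)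
  then show "x + y \<in> closure S"
    using subspace_add[OF S f(1) g(1)] unfolding closure_sequential by (intro exI[of _ "\<lambda>n. f n + g n"]) auto
next
  fix c and x assume "x \<in> closure S"
  then obtain f where f: "\<And>n. f n \<in> S" "f \<longlonglongrightarrow> x" unfolding closure_sequential by metis
  have "(\<lambda>n. c *\<^sub>R f n) \<longlonglongrightarrow> c *\<^sub>R x" by (intro tendsto_scaleR tendsto_const f)
  then show "c *\<^sub>R x \<in> closure S"
    using subspace_scale[OF S f(1)] unfolding closure_sequential by (intro exI[of _ "\<lambda>n. c *\<^sub>R f n"]) auto
qed

lemma bounded_linear_eq_on_dense_span:
  assumes U: "bounded_linear U" and V: "bounded_linear V"
    and eq: "\<And>x. x \<in> B \<Longrightarrow> U x = V x" and dense: "closure (span B) = UNIV"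
  shows "U = V"
proof
  fix x
  have sp: "U y = V y" if "y \<in> span B" for y
    by (rule linear_eq_on_span[OF bounded_linear.linear[OF U] bounded_linear.linear[OF V] eq that])
  have "closed {y. U y = V y}"
    using linear_continuous_on[OF U, of UNIV] linear_continuous_on[OF V, of UNIV]
    by (intro closed_Collect_eq) auto
  then have "closure (span B) \<subseteq> {y. U y = V y}"
    using sp by (intro closure_minimal) auto
  then show "U x = V x" using dense by auto
qed

text \<open>
  Maps that preserve inner products on a set are consistent on linear combinations: the norm of a
  combination of images equals the norm of the combination, so relations are preserved.  Hence
  they extend linearly to the span and then, by completeness, to its closure.
\<close>

lemma isometry_extension:
  fixes T :: "'a::real_inner \<Rightarrow> 'b::{real_inner,complete_space}"
  assumes ip: "\<And>x y. x \<in> B \<Longrightarrow> y \<in> B \<Longrightarrow> T x \<bullet> T y = x \<bullet> y"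
    and dense: "closure (span B) = UNIV"
  obtains U where "bounded_linear U" "\<And>x y. U x \<bullet> U y = x \<bullet> y" "\<And>x. x \<in> B \<Longrightarrow> U x = T x"
proof -
  obtain B' where B': "B' \<subseteq> B" "independent B'" "B \<subseteq> span B'"
    using maximal_independent_subset by blast
  have spanB: "span B' = span B"
    using B' by (metis span_mono span_span subset_antisym)
  obtain L where L: "linear L" "\<And>x. x \<in> B' \<Longrightarrow> L x = T x"
    using linear_independent_extend[OF B'(2), of T] by auto
  have 1: "T x \<bullet> L y = x \<bullet> y" if "x \<in> B" "y \<in> span B'" for x y
    using that(2)
  proof (induction rule: span_induct)
    case (step y)
    then show ?case using L(2)[of y] ip[of x y] that(1) B'(1) by auto
  next
    case base
    show ?case
      by (auto simp: subspace_def linear_0[OF L(1)] linear_add[OF L(1)] linear_scale[OF L(1)]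
          inner_add_right)
  qed
  have 2: "L x \<bullet> L y = x \<bullet> y" if "x \<in> span B'" "y \<in> span B'" for x y
    using that(1)
  proof (induction rule: span_induct)
    case (step x)
    then show ?case using L(2)[of x] 1[of x y] that(2) B'(1) by auto
  next
    case base
    show ?case
      by (auto simp: subspace_def linear_0[OF L(1)] linear_add[OF L(1)] linear_scale[OF L(1)]
          inner_add_left)
  qed
  have LT: "L x = T x" if "x \<in> B" for x
  proof -
    have xs: "x \<in> span B'" using that B' by auto
    have "(L x - T x) \<bullet> (L x - T x) = L x \<bullet> L x - 2 * (T x \<bullet> L x) + T x \<bullet> T x"
      by (simp add: inner_diff_left inner_diff_right inner_commute)
    also have "\<dots> = 0" using 1[OF that xs] 2[OF xs xs] ip[OF that that] by simp
    finally show ?thesis by simp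
  qed
  have nL: "norm (L x) = norm x" if "x \<in> span B" for x
    using 2[of x x] that spanB by (simp add: norm_eq_sqrt_inner)
  have "uniformly_continuous_on (span B) L"
    unfolding uniformly_continuous_on_def
  proof (intro allI impI exI[of _ "e::real" for e] conjI ballI)
    fix e :: real and x y assume "0 < e" "x \<in> span B" "y \<in> span B" "dist y x < e"
    then show "dist (L y) (L x) < e"
      using nL[of "y - x"] by (simp add: dist_norm linear_diff[OF L(1)] span_diff)
  qed
  then obtain U where U: "uniformly_continuous_on (closure (span B)) U"
      "\<And>x. x \<in> span B \<Longrightarrow> L x = U x"
    using uniformly_continuous_on_extension_on_closure by metis
  have cont: "isCont U x" for x
    using uniformly_continuous_imp_continuous[OF U(1)] dense
    by (simp add: continuous_on_eq_continuous_at)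
  have approx: "\<exists>s. (\<forall>n. s n \<in> span B) \<and> s \<longlonglongrightarrow> x" for x
    using dense by (metis UNIV_I closure_sequential)
  have inner: "U x \<bullet> U y = x \<bullet> y" for x y
  proof -
    obtain s r where s: "\<And>n. s n \<in> span B" "s \<longlonglongrightarrow> x" and r: "\<And>n. r n \<in> span B" "r \<longlonglongrightarrow> y"
      using approx by metis
    have "(\<lambda>n. U (s n) \<bullet> U (r n)) \<longlonglongrightarrow> U x \<bullet> U y"
      by (intro tendsto_inner isCont_tendsto_compose[OF cont] s r)
    moreover have "(\<lambda>n. U (s n) \<bullet> U (r n)) = (\<lambda>n. s n \<bullet> r n)"
      using 2 s(1) r(1) spanB by (simp flip: U(2))
    moreover have "(\<lambda>n. s n \<bullet> r n) \<longlonglongrightarrow> x \<bullet> y"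
      by (intro tendsto_inner s r)
    ultimately show ?thesis using LIMSEQ_unique by metis
  qed
  have lin: "U (x + c *\<^sub>R y) = U x + c *\<^sub>R U y" for x y c
  proof -
    have "(U (x + c *\<^sub>R y) - (U x + c *\<^sub>R U y)) \<bullet> (U (x + c *\<^sub>R y) - (U x + c *\<^sub>R U y)) = 0"
      by (simp add: inner_diff_left inner_diff_right inner_add_left inner_add_right inner
          algebra_simps)
    then show ?thesis by simp
  qed
  have "bounded_linear U"
  proof (rule bounded_linear_intro[of _ 1])
    show "U (x + y) = U x + U y" for x y using lin[of x 1 y] by simp
    have "U 0 = 0" using inner[of 0 0] by simp
    then show "U (c *\<^sub>R y) = c *\<^sub>R U y" for c y using lin[of 0 c y] by simp
    show "norm (U x) \<le> norm x * 1" for x using inner[of x x] by (simp add: norm_eq_sqrt_inner)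
  qed
  then show thesis
    using that[of U] inner U(2) LT by (simp add: span_base)
qed

section \<open>Density of the Gaussians\<close>

definition gauss :: "real \<Rightarrow> 'a::euclidean_space \<Rightarrow> 'a \<Rightarrow> 'a \<Rightarrow> complex" where
  "gauss t u v x = exp (of_real (2 * pi * (u \<bullet> x) - pi * t * (norm x)\<^sup>2) + \<i> * of_real (2 * pi * (v \<bullet> x)))"

definition gauss_classes :: "'a::euclidean_space l2 set" where
  "gauss_classes = {abs_l2 (\<lambda>x. c * gauss t u v x) |c t u v. 0 < t}"

lemma gauss_measurable [measurable]: "gauss t u v \<in> borel_measurable borel"
  unfolding gauss_def by measurable

lemma norm_gauss: "norm (gauss t u v x) = exp (2 * pi * (u \<bullet> x) - pi * t * (norm x)\<^sup>2)"
  by (simp add: gauss_def norm_exp_eq_Re)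

lemma integrable_lborel_prod:
  fixes f :: "'a::euclidean_space \<Rightarrow> real \<Rightarrow> 'c::{real_normed_field,banach,second_countable_topology}"
  assumes "\<And>b. b \<in> Basis \<Longrightarrow> integrable lborel (f b)"
  shows "integrable lborel (\<lambda>x. \<Prod>b\<in>Basis. f b (x \<bullet> b))"
    and "(LINT x|lborel. (\<Prod>b\<in>Basis. f b (x \<bullet> b))) = (\<Prod>b\<in>Basis. (LINT x|lborel. f b x))"
proof -
  interpret product_sigma_finite "\<lambda>b. lborel :: real measure" ..
  have meas: "f b \<in> borel_measurable borel" if "b \<in> Basis" for b
    using assms[OF that] by (simp add: integrable_iff_bounded)
  have m1: "(\<lambda>x::'a. \<Prod>b\<in>Basis. f b (x \<bullet> b)) \<in> borel_measurable borel"
    by (intro borel_measurable_prod measurable_compose[OF _ meas]) auto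
  have m2: "(\<lambda>g. \<Sum>b\<in>Basis. g b *\<^sub>R b) \<in> (\<Pi>\<^sub>M b\<in>Basis. lborel) \<rightarrow>\<^sub>M (borel :: 'a measure)"
    by measurable
  have eq: "(\<Prod>b\<in>Basis. f b ((\<Sum>c\<in>Basis. g c *\<^sub>R c) \<bullet> b)) = (\<Prod>b\<in>Basis. f b (g b))" for g :: "'a \<Rightarrow> real"
    by (rule prod.cong) (simp_all add: inner_sum_left inner_Basis if_distrib sum.delta cong: if_cong)
  show "integrable lborel (\<lambda>x. \<Prod>b\<in>Basis. f b (x \<bullet> b))"
    unfolding lborel_eq[where 'a='a] integrable_distr_eq[OF m2 m1] eq
    by (rule product_integrable_prod) (use assms in auto)
  show "(LINT x|lborel. (\<Prod>b\<in>Basis. f b (x \<bullet> b))) = (\<Prod>b\<in>Basis. (LINT x|lborel. f b x))"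
    unfolding lborel_eq[where 'a='a] integral_distr[OF m2 m1] eq
    by (subst product_integral_prod) (use assms in \<open>auto simp flip: lborel_eq\<close>)
qed

lemma gauss_integral_1d:
  assumes "0 < t"
  shows "integrable lborel (\<lambda>x::real. exp (- pi * t * x\<^sup>2))"
    "(LINT x|lborel. exp (- pi * t * x\<^sup>2 :: real)) = 1 / sqrt t"
proof -
  define s where "s = sqrt (1 / (2 * pi * t))"
  have s: "0 < s" "2 * s\<^sup>2 = 1 / (pi * t)" using assms by (auto simp: s_def)
  have nd: "normal_density 0 s x * (1 / sqrt t) = exp (- pi * t * x\<^sup>2)" for x
  proof -
    have "x\<^sup>2 / (2 * s\<^sup>2) = pi * t * x\<^sup>2" unfolding s(2) by simp
    moreover have "2 * pi * s\<^sup>2 = 1 / t"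
      using s(2) assms by (simp add: field_simps)
    ultimately show ?thesis using assms by (simp add: normal_density_def real_sqrt_divide)
  qed
  show "integrable lborel (\<lambda>x::real. exp (- pi * t * x\<^sup>2))"
    using integrable_mult_left[OF integrable_normal_density[OF s(1), of 0], of "1 / sqrt t"]
    unfolding nd .
  have "(LINT x|lborel. exp (- pi * t * x\<^sup>2 :: real)) = (LINT x|lborel. normal_density 0 s x * (1 / sqrt t))"
    by (simp only: nd)
  also have "\<dots> = 1 / sqrt t" using s(1) by simp
  finally show "(LINT x|lborel. exp (- pi * t * x\<^sup>2 :: real)) = 1 / sqrt t" .
qed

lemma gauss_integral_real:
  fixes t :: real
  assumes "0 < t"
  shows "integrable lborel (\<lambda>x::'a::euclidean_space. exp (- pi * t * (norm x)\<^sup>2))"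
    "(LINT x|lborel. exp (- pi * t * (norm (x::'a::euclidean_space))\<^sup>2)) = (1 / sqrt t) ^ DIM('a)"
proof -
  have eq: "exp (- pi * t * (norm x)\<^sup>2) = (\<Prod>b\<in>Basis. exp (- pi * t * (x \<bullet> b)\<^sup>2))" for x :: 'a
  proof -
    have n: "(norm x)\<^sup>2 = (\<Sum>b\<in>Basis. (x \<bullet> b)\<^sup>2)"
      unfolding power2_norm_eq_inner by (subst euclidean_inner) (simp add: power2_eq_square)
    show ?thesis unfolding n by (simp add: exp_sum[symmetric] sum_distrib_left)
  qed
  show "integrable lborel (\<lambda>x::'a::euclidean_space. exp (- pi * t * (norm x)\<^sup>2))"
    unfolding eq by (rule integrable_lborel_prod(1)) (rule gauss_integral_1d(1)[OF assms])
  show "(LINT x|lborel. exp (- pi * t * (norm (x::'a::euclidean_space))\<^sup>2)) = (1 / sqrt t) ^ DIM('a)"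
    unfolding eq by (subst integrable_lborel_prod(2)) (use assms gauss_integral_1d in auto)
qed

lemma exp_linear_quadratic_le:
  fixes k l r :: real
  assumes "0 < l"
  shows "exp (k * r - l * r\<^sup>2) \<le> exp (k\<^sup>2 / (2 * l)) * exp (- (l / 2) * r\<^sup>2)"
proof -
  have "0 \<le> (l * r - k)\<^sup>2 / (2 * l)" using assms by simp
  also have "\<dots> = (l / 2) * r\<^sup>2 - k * r + k\<^sup>2 / (2 * l)"
    using assms by (simp add: power2_diff field_simps power2_eq_square)
  finally show ?thesis by (simp add: mult_exp_exp)
qed

lemma norm_gauss_le:
  assumes "0 < t"
  shows "norm (gauss t u v x) \<le> exp (2 * pi * (norm u)\<^sup>2 / t) * exp (- pi * (t / 2) * (norm x)\<^sup>2)"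
proof -
  have "norm (gauss t u v x) \<le> exp ((2 * pi * norm u) * norm x - (pi * t) * (norm x)\<^sup>2)"
    using norm_cauchy_schwarz[of u x] by (simp add: norm_gauss)
  also have "\<dots> \<le> exp ((2 * pi * norm u)\<^sup>2 / (2 * (pi * t))) * exp (- (pi * t / 2) * (norm x)\<^sup>2)"
    by (rule exp_linear_quadratic_le) (use assms in simp)
  also have "(2 * pi * norm u)\<^sup>2 / (2 * (pi * t)) = 2 * pi * (norm u)\<^sup>2 / t"
    using assms by (simp add: power2_eq_square)
  finally show ?thesis by simp
qed

lemma integrable_gauss:
  assumes "0 < t"
  shows "integrable lborel (gauss t u v)"
proof (rule Bochner_Integration.integrable_bound)
  show "integrable lborel (\<lambda>x::'a. exp (2 * pi * (norm u)\<^sup>2 / t) * exp (- pi * (t / 2) * (norm x)\<^sup>2))"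
    by (intro integrable_mult_right gauss_integral_real(1)) (use assms in simp)
qed (use norm_gauss_le[OF assms] in auto)

lemma gauss_mult:
  "gauss t u v x * gauss t' u' v' x = gauss (t + t') (u + u') (v + v') x"
  by (simp add: gauss_def mult_exp_exp inner_add_left algebra_simps)

lemma cnj_gauss: "cnj (gauss t u v x) = gauss t u (- v) x"
  by (simp add: gauss_def exp_cnj)

lemma sq_integrable_gauss:
  assumes "0 < t"
  shows "sq_integrable (\<lambda>x. c * gauss t u v x)"
proof -
  have "integrable lborel (\<lambda>x. norm (gauss (t + t) (u + u) (v + v) x))"
    by (intro integrable_norm integrable_gauss) (use assms in simp)
  then have "integrable lborel (\<lambda>x. (norm c)\<^sup>2 * norm (gauss t u v x * gauss t u v x))"
    by (simp add: gauss_mult)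
  moreover have "(norm (c * gauss t u v x))\<^sup>2 = (norm c)\<^sup>2 * norm (gauss t u v x * gauss t u v x)" for x
    by (simp add: norm_mult power_mult_distrib power2_eq_square)
  ultimately show ?thesis
    unfolding sq_integrable_def by simp
qed

text \<open>
  Real combinations of real Gaussians \<open>exp (- \<pi> s |x|\<^sup>2 + 2 \<pi> u \<bullet> x)\<close>, with \<open>s = 0\<close> admitted so
  that the constants belong to the algebra.
\<close>

inductive gauss_alg :: "('a::euclidean_space \<Rightarrow> real) \<Rightarrow> bool" where
  base: "0 \<le> s \<Longrightarrow> gauss_alg (\<lambda>x. exp (2 * pi * (u \<bullet> x) - pi * s * (norm x)\<^sup>2))"
| add: "gauss_alg f \<Longrightarrow> gauss_alg g \<Longrightarrow> gauss_alg (\<lambda>x. f x + g x)"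
| scale: "gauss_alg f \<Longrightarrow> gauss_alg (\<lambda>x. c * f x)"

lemma gauss_alg_const: "gauss_alg (\<lambda>x. c)"
  using gauss_alg.scale[OF gauss_alg.base[of 0 0], of c] by simp

lemma gauss_alg_mult:
  assumes "gauss_alg f" "gauss_alg g"
  shows "gauss_alg (\<lambda>x. f x * g x)"
  using assms
proof (induction f)
  case (base s u)
  from base(2) show ?case
  proof (induction g)
    case (base s' u')
    have "gauss_alg (\<lambda>x. exp (2 * pi * ((u + u') \<bullet> x) - pi * (s + s') * (norm x)\<^sup>2))"
      by (rule gauss_alg.base) (use base \<open>0 \<le> s\<close> in simp)
    then show ?case by (simp add: mult_exp_exp inner_add_left algebra_simps)
  next
    case (add f g)
    then show ?case using gauss_alg.add by (simp add: distrib_left)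
  next
    case (scale f c)
    then show ?case using gauss_alg.scale[OF scale.IH, of c] by (simp add: mult_ac)
  qed
next
  case (add f1 f2)
  then show ?case using gauss_alg.add[OF add.IH] by (simp add: distrib_right)
next
  case (scale f c)
  then show ?case using gauss_alg.scale[OF scale.IH, of c] by (simp add: mult_ac)
qed

lemma gauss_alg_power: "gauss_alg f \<Longrightarrow> gauss_alg (\<lambda>x. f x ^ n)"
  by (induction n) (auto intro: gauss_alg_const gauss_alg_mult)

lemma gauss_alg_prod:
  "finite I \<Longrightarrow> (\<And>i. i \<in> I \<Longrightarrow> gauss_alg (f i)) \<Longrightarrow> gauss_alg (\<lambda>x. \<Prod>i\<in>I. f i x)"
  by (induction I rule: finite_induct) (auto intro: gauss_alg_const gauss_alg_mult)

text \<open>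
  A polynomial without constant term in the Gaussian \<open>y = exp (- s |x - a|\<^sup>2)\<close>.  As \<open>m\<close> grows it tends
  to \<open>1\<close> where \<open>y > 1/2\<close> and to \<open>0\<close> where \<open>y < 1/2\<close>, that is, inside and outside a ball; so balls are
  reached from Gaussians by bounded pointwise limits.
\<close>

definition bump :: "nat \<Rightarrow> 'a::euclidean_space \<Rightarrow> real \<Rightarrow> 'a \<Rightarrow> real" where
  "bump m a s x = 1 - (1 - exp (- s * (norm (x - a))\<^sup>2) ^ m) ^ (2 ^ m)"

lemma gauss_alg_bump:
  assumes "0 < s"
  shows "gauss_alg (bump m a s)"
proof -
  have "gauss_alg (\<lambda>x. exp (- s * (norm a)\<^sup>2) *
      exp (2 * pi * (((s / pi) *\<^sub>R a) \<bullet> x) - pi * (s / pi) * (norm x)\<^sup>2))" (is "gauss_alg ?g")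
    by (intro gauss_alg.scale gauss_alg.base) (use assms in simp)
  moreover have "?g x = exp (- s * (norm (x - a))\<^sup>2)" for x
    by (simp add: mult_exp_exp power2_norm_eq_inner inner_diff_left inner_diff_right inner_commute
        algebra_simps)
  ultimately have "gauss_alg (\<lambda>x. exp (- s * (norm (x - a))\<^sup>2))" by simp
  then have "gauss_alg (\<lambda>x. 1 + (-1) * (1 + (-1) * exp (- s * (norm (x - a))\<^sup>2) ^ m) ^ (2 ^ m))"
    by (intro gauss_alg.add gauss_alg.scale gauss_alg_power gauss_alg_const)
  then show ?thesis by (simp add: bump_def[abs_def])
qed

lemma bump_bounds:
  assumes "0 < s"
  shows "0 \<le> bump m a s x" "bump m a s x \<le> 1"
proof -
  have "exp (- s * (norm (x - a))\<^sup>2) ^ m \<le> 1"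
    using assms by (intro power_le_one) auto
  then show "0 \<le> bump m a s x" "bump m a s x \<le> 1"
    by (auto simp: bump_def intro: power_le_one)
qed

text \<open>
  With \<open>q = 1 - y ^ m\<close>, Bernoulli's inequality gives \<open>q ^ 2 ^ m \<ge> 1 - (2 y) ^ m\<close>, which tends
  to \<open>1\<close> when \<open>y < 1/2\<close>, and \<open>1 - z \<le> exp (- z)\<close> gives \<open>q ^ 2 ^ m \<le> exp (- (2 y) ^ m)\<close>, which
  tends to \<open>0\<close> when \<open>y > 1/2\<close>.
\<close>

lemma power_threshold:
  fixes y :: real
  assumes "0 < y" "y \<le> 1"
  shows "y < 1/2 \<Longrightarrow> (\<lambda>m. (1 - y ^ m) ^ (2 ^ m)) \<longlonglongrightarrow> 1"
    and "y > 1/2 \<Longrightarrow> (\<lambda>m. (1 - y ^ m) ^ (2 ^ m)) \<longlonglongrightarrow> 0"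
proof -
  have ym: "0 \<le> y ^ m" "y ^ m \<le> 1" for m using assms by (auto simp: power_le_one)
  show "(\<lambda>m. (1 - y ^ m) ^ (2 ^ m)) \<longlonglongrightarrow> 1" if "y < 1/2"
  proof (rule tendsto_sandwich)
    have "1 + real (2 ^ m) * (- (y ^ m)) \<le> (1 + - (y ^ m)) ^ (2 ^ m)" for m
      by (rule Bernoulli_inequality) (use ym[of m] in simp)
    then show "\<forall>\<^sub>F m in sequentially. 1 - (2 * y) ^ m \<le> (1 - y ^ m) ^ (2 ^ m)"
      by (intro always_eventually) (simp add: power_mult_distrib)
    show "\<forall>\<^sub>F m in sequentially. (1 - y ^ m) ^ (2 ^ m) \<le> 1"
      by (intro always_eventually allI power_le_one) (use ym in auto)
    have "(\<lambda>m. 1 - (2 * y) ^ m) \<longlonglongrightarrow> 1 - 0"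
      by (intro tendsto_intros LIMSEQ_realpow_zero) (use assms that in auto)
    then show "(\<lambda>m. 1 - (2 * y) ^ m) \<longlonglongrightarrow> 1" by simp
  qed simp
  show "(\<lambda>m. (1 - y ^ m) ^ (2 ^ m)) \<longlonglongrightarrow> 0" if "y > 1/2"
  proof (rule tendsto_sandwich)
    have "(1 - y ^ m) ^ (2 ^ m) \<le> inverse ((2 * y) ^ m)" for m
    proof -
      have "(1 - y ^ m) ^ (2 ^ m) \<le> exp (- (y ^ m)) ^ (2 ^ m)"
        using ym[of m] exp_ge_add_one_self[of "- (y ^ m)"] by (intro power_mono) auto
      also have "\<dots> = inverse (exp ((2 * y) ^ m))"
        by (simp flip: exp_of_nat_mult exp_minus add: power_mult_distrib)
      also have "\<dots> \<le> inverse ((2 * y) ^ m)"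
      proof (rule le_imp_inverse_le)
        show "(2 * y) ^ m \<le> exp ((2 * y) ^ m)"
          using exp_ge_add_one_self[of "(2 * y) ^ m"] by linarith
        show "0 < (2 * y) ^ m" using assms by simp
      qed
      finally show ?thesis .
    qed
    then show "\<forall>\<^sub>F m in sequentially. (1 - y ^ m) ^ (2 ^ m) \<le> inverse ((2 * y) ^ m)" by simp
    show "\<forall>\<^sub>F m in sequentially. 0 \<le> (1 - y ^ m) ^ (2 ^ m)"
      by (intro always_eventually allI zero_le_power) (use ym in auto)
    show "(\<lambda>m. inverse ((2 * y) ^ m)) \<longlonglongrightarrow> 0"
      by (rule LIMSEQ_inverse_realpow_zero) (use that in simp)
  qed simp
qed

lemma bump_tendsto_indicator:
  assumes "0 < r" "norm (x - a) \<noteq> r"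
  shows "(\<lambda>m. bump m a (ln 2 / r\<^sup>2) x) \<longlonglongrightarrow> indicator (ball a r) x"
proof -
  define y where "y = exp (- (ln 2 / r\<^sup>2) * (norm (x - a))\<^sup>2)"
  have y: "0 < y" "y \<le> 1" using assms by (auto simp: y_def)
  have half: "exp (- ln 2) = (1/2::real)" by (simp add: exp_minus)
  have "(\<lambda>m. 1 - (1 - y ^ m) ^ (2 ^ m)) \<longlonglongrightarrow> indicator (ball a r) x"
  proof (cases "norm (x - a) < r")
    case True
    then have "(norm (x - a))\<^sup>2 < r\<^sup>2" by (intro power_strict_mono) auto
    then have "- ln 2 < - (ln 2 / r\<^sup>2) * (norm (x - a))\<^sup>2" using assms(1) by (simp add: field_simps)
    then have "y > 1/2" unfolding y_def half[symmetric] by simp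
    then have "(\<lambda>m. 1 - (1 - y ^ m) ^ (2 ^ m)) \<longlonglongrightarrow> 1 - 0"
      by (intro tendsto_intros power_threshold y)
    then show ?thesis using True by (simp add: dist_norm norm_minus_commute)
  next
    case False
    then have "r\<^sup>2 < (norm (x - a))\<^sup>2" using assms by (intro power_strict_mono) auto
    then have "- (ln 2 / r\<^sup>2) * (norm (x - a))\<^sup>2 < - ln 2" using assms(1) by (simp add: field_simps)
    then have "y < 1/2" unfolding y_def half[symmetric] by simp
    then have "(\<lambda>m. 1 - (1 - y ^ m) ^ (2 ^ m)) \<longlonglongrightarrow> 1 - 1"
      by (intro tendsto_intros power_threshold y)
    then show ?thesis using False by (simp add: dist_norm norm_minus_commute)
  qed
  then show ?thesis by (simp add: bump_def y_def)
qed

definition ball_inters :: "'a::euclidean_space set set" where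
  "ball_inters = {\<Inter>i\<in>I. ball (fst i) (snd i) |I. finite I \<and> (\<forall>i\<in>I. 0 < snd i)}"

lemma borel_eq_ball_inters: "sets (borel :: 'a::euclidean_space measure) = sigma_sets UNIV ball_inters"
proof
  show "sigma_sets UNIV ball_inters \<subseteq> sets (borel :: 'a measure)"
    by (rule sets.sigma_sets_subset[of _ borel, simplified])
      (auto simp: ball_inters_def intro!: borel_open open_INT)
  have "U \<in> sigma_sets UNIV ball_inters" if "open U" for U :: "'a set"
  proof -
    obtain e where e: "\<And>x. x \<in> U \<Longrightarrow> 0 < e x \<and> ball x (e x) \<subseteq> U"
      using \<open>open U\<close> by (metis open_contains_ball)
    define F where "F = (\<lambda>x. ball x (e x)) ` U"
    have "\<Union> F = U" using e by (force simp: F_def)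
    moreover obtain F' where "F' \<subseteq> F" "countable F'" "\<Union> F' = \<Union> F"
      using Lindelof[of F] by (auto simp: F_def)
    moreover have "F \<subseteq> ball_inters"
    proof
      fix B assume "B \<in> F"
      then obtain x where "x \<in> U" "B = ball x (e x)" by (auto simp: F_def)
      then show "B \<in> ball_inters"
        using e by (auto simp: ball_inters_def intro!: exI[of _ "{(x, e x)}"])
    qed
    ultimately show ?thesis
      using sigma_sets_UNION[of F' UNIV ball_inters] by (metis sigma_sets.Basic subsetD)
  qed
  then show "sets (borel :: 'a measure) \<subseteq> sigma_sets UNIV ball_inters"
    unfolding borel_def by (subst sets_measure_of) (auto intro!: sigma_sets_mono)
qed

text \<open>
  The closed span of the Gaussians contains \<open>c \<phi> exp (- \<pi> |x|\<^sup>2)\<close> for \<open>\<phi>\<close> in the algebra, then,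
  by bounded limits, for \<open>\<phi>\<close> the indicator of a finite intersection of balls, then of any Borel
  set, and finally for every \<open>\<phi>\<close> that makes this square integrable.
\<close>

lemma closure_span_gauss_classes: "closure (span gauss_classes) = (UNIV :: 'a::euclidean_space l2 set)"
proof -
  define V where "V = closure (span (gauss_classes :: 'a l2 set))"
  define w where "w x = exp (- pi * (norm x)\<^sup>2)" for x :: 'a
  have w [measurable]: "w \<in> borel_measurable borel" unfolding w_def by measurable
  have wpos: "0 < w x" for x by (simp add: w_def)
  have wg: "of_real (w x) = gauss 1 0 0 x" for x
    by (simp add: w_def gauss_def flip: exp_of_real)
  have subV: "subspace V" unfolding V_def by (intro subspace_closure subspace_span)
  have clV: "closed V" by (simp add: V_def)
  have addV: "f \<in> V \<Longrightarrow> g \<in> V \<Longrightarrow> f + g \<in> V" for f g using subV by (rule subspace_add)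
  have scaleV: "f \<in> V \<Longrightarrow> c *\<^sub>R f \<in> V" for f c using subV by (rule subspace_scale)
  have limV: "F \<longlonglongrightarrow> f \<Longrightarrow> (\<And>n. F n \<in> V) \<Longrightarrow> f \<in> V" for F f
    using clV closed_sequentially by metis
  have main: "abs_l2 (\<lambda>x. c * of_real (f x)) \<in> V"
    if fm [measurable]: "f \<in> borel_measurable borel" and f0: "\<And>x. 0 \<le> f x"
      and fi: "sq_integrable (\<lambda>x. c * of_real (f x))"
    for c and f :: "'a \<Rightarrow> real"
  proof -
    let ?P = "\<lambda>\<phi>. sq_integrable (\<lambda>x. c * of_real (\<phi> x * w x)) \<and> abs_l2 (\<lambda>x. c * of_real (\<phi> x * w x)) \<in> V"
    have cw: "sq_integrable (\<lambda>x. c * of_real (w x))"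
      unfolding wg by (rule sq_integrable_gauss) simp
    have P_add: "?P (\<lambda>x. \<phi> x + \<psi> x)" if "?P \<phi>" "?P \<psi>" for \<phi> \<psi>
      using that sq_integrable_add[of "\<lambda>x. c * of_real (\<phi> x * w x)" "\<lambda>x. c * of_real (\<psi> x * w x)"]
        abs_l2_add[of "\<lambda>x. c * of_real (\<phi> x * w x)" "\<lambda>x. c * of_real (\<psi> x * w x)"]
      by (simp add: distrib_left distrib_right addV)
    have P_scale: "?P (\<lambda>x. k * \<phi> x)" if "?P \<phi>" for \<phi> and k :: real
      using that sq_integrable_scaleR[of "\<lambda>x. c * of_real (\<phi> x * w x)" k]
        abs_l2_scaleR[of "\<lambda>x. c * of_real (\<phi> x * w x)" k]
      by (simp add: scaleR_conv_of_real mult_ac scaleV)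
    have P_alg: "?P \<phi>" if "gauss_alg \<phi>" for \<phi>
      using that
    proof induction
      case (base s u)
      have eq: "of_real (exp (2 * pi * (u \<bullet> x) - pi * s * (norm x)\<^sup>2) * w x) = gauss (1 + s) u 0 x" for x
        by (simp add: gauss_def w_def mult_exp_exp exp_of_real[symmetric] algebra_simps del: exp_of_real)
      have "abs_l2 (\<lambda>x. c * gauss (1 + s) u 0 x) \<in> V"
        unfolding V_def by (rule subsetD[OF closure_subset], rule span_base)
          (unfold gauss_classes_def, use base in
            \<open>intro CollectI exI[of _ c] exI[of _ "1 + s"] exI[of _ u] exI[of _ 0]; simp\<close>)
      then show ?case
        unfolding eq using sq_integrable_gauss[of "1 + s" c u 0] base by auto
    next
      case (add f g)
      show ?case by (rule P_add[OF add(3,4)])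
    next
      case (scale f k)
      show ?case by (rule P_scale[OF scale(2)])
    qed
    have P_zero: "?P (\<lambda>x. 0)" by (rule P_alg) (rule gauss_alg_const)
    have P_lim: "?P \<psi>"
      if "\<And>n. ?P (\<phi> n)" "\<And>n. \<phi> n \<in> borel_measurable borel" "\<psi> \<in> borel_measurable borel"
        "\<And>n x. \<bar>\<phi> n x\<bar> \<le> 1" "AE x in lborel. (\<lambda>n. \<phi> n x) \<longlonglongrightarrow> \<psi> x"
      for \<phi> :: "nat \<Rightarrow> 'a \<Rightarrow> real" and \<psi>
    proof -
      note [measurable] = that(2,3)
      have l: "AE x in lborel. (\<lambda>n. c * of_real (\<phi> n x * w x)) \<longlonglongrightarrow> c * of_real (\<psi> x * w x)"
        using that(5) by eventually_elim (intro tendsto_intros)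
      have b: "norm (c * of_real (\<phi> n x * w x)) \<le> norm (c * of_real (w x) :: complex)" for n x
        using mult_left_mono[OF mult_right_mono[OF that(4)[of n x], of "w x"], of "norm c"] wpos[of x]
        by (simp add: norm_mult abs_mult)
      have m: "(\<lambda>x. c * of_real (\<phi> n x * w x)) \<in> borel_measurable borel"
        "(\<lambda>x. c * of_real (\<psi> x * w x)) \<in> borel_measurable borel" for n
        by measurable
      have lims: "sq_integrable (\<lambda>x. c * of_real (\<psi> x * w x))"
        "(\<lambda>n. abs_l2 (\<lambda>x. c * of_real (\<phi> n x * w x))) \<longlonglongrightarrow> abs_l2 (\<lambda>x. c * of_real (\<psi> x * w x))"
        by (rule abs_l2_dominated_convergence[OF cw m l AE_I2[OF b]])+
      show ?thesis using lims(1) limV[OF lims(2)] that(1) by simp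
    qed
    have P_balls: "?P (indicator A)" if "A \<in> ball_inters" for A
    proof -
      from that obtain I where I: "A = (\<Inter>i\<in>I. ball (fst i) (snd i))" "finite I" "\<forall>i\<in>I. 0 < snd i"
        unfolding ball_inters_def by blast
      have Ipos: "0 < snd i" if "i \<in> I" for i using I(3) that by blast
      have Is: "0 < ln 2 / (snd i)\<^sup>2" if "i \<in> I" for i
        by (intro divide_pos_pos zero_less_power Ipos that) simp
      let ?\<phi> = "\<lambda>n x. \<Prod>i\<in>I. bump n (fst i) (ln 2 / (snd i)\<^sup>2) x"
      show ?thesis
      proof (rule P_lim[of ?\<phi>])
        show "?P (?\<phi> n)" for n
          by (rule P_alg, rule gauss_alg_prod[OF I(2)], rule gauss_alg_bump, rule Is)
        show "?\<phi> n \<in> borel_measurable borel" for n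
          unfolding bump_def by measurable
        show "indicator A \<in> borel_measurable (borel :: 'a measure)"
          by (rule borel_measurable_indicator) (use I in \<open>auto intro!: borel_open open_INT\<close>)
        show "\<bar>?\<phi> n x\<bar> \<le> 1" for n x
          unfolding abs_prod
        proof (rule prod_le_1)
          fix i assume "i \<in> I"
          from bump_bounds[OF Is[OF this], of n "fst i" x]
          show "0 \<le> \<bar>bump n (fst i) (ln 2 / (snd i)\<^sup>2) x\<bar> \<and> \<bar>bump n (fst i) (ln 2 / (snd i)\<^sup>2) x\<bar> \<le> 1"
            by (simp add: abs_of_nonneg)
        qed
        have "AE x in lborel. \<forall>i\<in>I. norm (x - fst i) \<noteq> snd i"
        proof (rule AE_finite_allI[OF I(2)])
          fix i assume "i \<in> I"
          have "negligible (sphere (fst i) (snd i))" by (rule negligible_sphere)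
          then have "sphere (fst i) (snd i) \<in> null_sets lborel"
            by (simp add: negligible_iff_null_sets null_sets_completion_iff)
          then show "AE x in lborel. norm (x - fst i) \<noteq> snd i"
            by (rule AE_I') (auto simp: dist_norm norm_minus_commute)
        qed
        then show "AE x in lborel. (\<lambda>n. ?\<phi> n x) \<longlonglongrightarrow> indicator A x"
        proof eventually_elim
          case (elim x)
          have "(\<lambda>n. ?\<phi> n x) \<longlonglongrightarrow> (\<Prod>i\<in>I. indicator (ball (fst i) (snd i)) x)"
            by (intro tendsto_prod bump_tendsto_indicator Ipos; use elim in blast)
          also have "(\<Prod>i\<in>I. indicator (ball (fst i) (snd i)) x :: real) = indicator A x"
            using I(2) unfolding I(1) by (auto simp: indicator_def)
          finally show ?case .
        qed
      qed
    qed
    have P_borel: "?P (indicator A)" if "A \<in> sets borel" for A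
    proof -
      have "Int_stable (ball_inters :: 'a set set)"
      proof (rule Int_stableI)
        fix a b :: "'a set" assume ab: "a \<in> ball_inters" "b \<in> ball_inters"
        from ab(1) obtain I where I: "a = (\<Inter>i\<in>I. ball (fst i) (snd i))" "finite I" "\<forall>i\<in>I. 0 < snd i"
          unfolding ball_inters_def by blast
        from ab(2) obtain K where K: "b = (\<Inter>i\<in>K. ball (fst i) (snd i))" "finite K" "\<forall>i\<in>K. 0 < snd i"
          unfolding ball_inters_def by blast
        have "a \<inter> b = (\<Inter>i\<in>I \<union> K. ball (fst i) (snd i))" unfolding I K by blast
        then show "a \<inter> b \<in> ball_inters"
          unfolding ball_inters_def using I(2,3) K(2,3) by blast
      qed
      moreover have "ball_inters \<subseteq> Pow (UNIV :: 'a set)" by simp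
      moreover have "A \<in> sigma_sets UNIV ball_inters" using that by (simp add: borel_eq_ball_inters)
      ultimately show ?thesis
      proof (induction rule: sigma_sets_induct_disjoint)
        case (basic A)
        then show ?case by (rule P_balls)
      next
        case empty
        then show ?case using P_zero by simp
      next
        case (compl A)
        have one: "?P (\<lambda>x. 1)" by (rule P_alg) (rule gauss_alg_const)
        have "1 + (-1) * indicator A x = (indicator (UNIV - A) x :: real)" for x
          by (auto simp: indicator_def)
        then show ?case using P_add[OF one P_scale[OF compl(2), of "-1"]] by (simp only:)
      next
        case (union A)
        then have bA: "A i \<in> sets borel" for i by (auto simp: borel_eq_ball_inters)
        show ?case
        proof (rule P_lim[of "\<lambda>n x. \<Sum>i<n. indicator (A i) x"])
          show "?P (\<lambda>x. \<Sum>i<n. indicator (A i) x)" for n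
          proof (induction n)
            case 0
            then show ?case using P_zero by simp
          next
            case (Suc n)
            show ?case unfolding sum.lessThan_Suc by (rule P_add[OF Suc union(3)])
          qed
          have eq: "(\<Sum>i<n. indicator (A i) x :: real) = indicator (\<Union>i<n. A i) x" for n x
            by (subst indicator_UN_disjoint) (use union(1) in \<open>auto simp: disjoint_family_on_def\<close>)
          show "\<bar>\<Sum>i<n. indicator (A i) x :: real\<bar> \<le> 1" for n x
            unfolding eq by (simp add: indicator_def)
          show "AE x in lborel. (\<lambda>n. \<Sum>i<n. indicator (A i) x) \<longlonglongrightarrow> indicat_real (\<Union> (range A)) x"
          proof (rule AE_I2)
            fix x
            show "(\<lambda>n. \<Sum>i<n. indicator (A i) x) \<longlonglongrightarrow> indicat_real (\<Union> (range A)) x"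
              unfolding eq by (rule LIMSEQ_indicator_UN)
          qed
          show "(\<lambda>x. \<Sum>i<n. indicat_real (A i) x) \<in> borel_measurable borel" for n
            using bA by measurable
          show "indicat_real (\<Union> (range A)) \<in> borel_measurable borel"
            using bA by measurable
        qed
      qed
    qed
    define \<psi> where "\<psi> x = f x / w x" for x
    have \<psi>m: "\<psi> \<in> borel_measurable borel" unfolding \<psi>_def by measurable
    have \<psi>0: "0 \<le> \<psi> x" for x using f0[of x] wpos[of x] by (simp add: \<psi>_def)
    have f_eq: "f x = \<psi> x * w x" for x using wpos[of x] by (simp add: \<psi>_def)
    have nle: "norm (c * of_real (p * w x)) \<le> norm (c * of_real (q * w x) :: complex)"
      if "0 \<le> p" "p \<le> q" for p q x
      unfolding norm_mult norm_of_real abs_mult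
      by (intro mult_left_mono mult_right_mono) (use that in auto)
    have "sq_integrable (\<lambda>x. c * of_real (\<psi> x * w x)) \<longrightarrow> ?P \<psi>"
      using \<psi>m \<psi>0
    proof (induction \<psi> rule: borel_measurable_induct_real)
      case (set A)
      then show ?case using P_borel by blast
    next
      case (mult u k)
      show ?case
      proof (cases "k = 0")
        case True
        then show ?thesis using P_zero by simp
      next
        case False
        show ?thesis
        proof
          assume "sq_integrable (\<lambda>x. c * of_real (k * u x * w x))"
          from sq_integrable_scaleR[OF this, of "1 / k"] False
          have "sq_integrable (\<lambda>x. c * of_real (u x * w x))"
            by (simp add: scaleR_conv_of_real)
          then show "?P (\<lambda>x. k * u x)" using P_scale mult by blast
        qed
      qed
    next
      case (add u v)
      note [measurable] = add.hyps(1,3)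
      show ?case
      proof
        assume A: "sq_integrable (\<lambda>x. c * of_real ((v x + u x) * w x))"
        have "sq_integrable (\<lambda>x. c * of_real (u x * w x))"
        proof (rule sq_integrable_bound[OF A, of _ 1])
          show "AE x in lborel. norm (c * of_real (u x * w x)) \<le> 1 * norm (c * of_real ((v x + u x) * w x))"
            unfolding mult_1 by (intro AE_I2 nle) (use add.hyps(2,4) in auto)
        qed measurable
        moreover have "sq_integrable (\<lambda>x. c * of_real (v x * w x))"
        proof (rule sq_integrable_bound[OF A, of _ 1])
          show "AE x in lborel. norm (c * of_real (v x * w x)) \<le> 1 * norm (c * of_real ((v x + u x) * w x))"
            unfolding mult_1 by (intro AE_I2 nle) (use add.hyps(2,4) in auto)
        qed measurable
        ultimately show "?P (\<lambda>x. v x + u x)" using P_add add.IH by blast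
      qed
    next
      case (seq U)
      note [measurable] = seq.hyps(1) \<psi>m
      show ?case
      proof
        assume A: "sq_integrable (\<lambda>x. c * of_real (\<psi> x * w x))"
        have le: "U n x \<le> \<psi> x" for n x
          using seq.hyps(4)[of x] seq.hyps(3) by (intro incseq_le) (auto simp: incseq_def le_fun_def)
        have b: "norm (c * of_real (U n x * w x)) \<le> norm (c * of_real (\<psi> x * w x) :: complex)" for n x
          by (rule nle[OF seq.hyps(2) le])
        have PU: "?P (U n)" for n
        proof -
          have "sq_integrable (\<lambda>x. c * of_real (U n x * w x))"
          proof (rule sq_integrable_bound[OF A, of _ 1])
            show "AE x in lborel. norm (c * of_real (U n x * w x)) \<le> 1 * norm (c * of_real (\<psi> x * w x))"
              unfolding mult_1 by (intro AE_I2 b)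
          qed measurable
          then show ?thesis using seq.IH by blast
        qed
        have lims: "(\<lambda>n. abs_l2 (\<lambda>x. c * of_real (U n x * w x))) \<longlonglongrightarrow> abs_l2 (\<lambda>x. c * of_real (\<psi> x * w x))"
        proof (rule abs_l2_dominated_convergence(2)[OF A])
          show "AE x in lborel. (\<lambda>n. c * of_real (U n x * w x)) \<longlonglongrightarrow> c * of_real (\<psi> x * w x)"
            using seq.hyps(4) by (intro AE_I2 tendsto_intros) auto
          show "AE x in lborel. norm (c * of_real (U n x * w x)) \<le> norm (c * of_real (\<psi> x * w x))" for n
            by (intro AE_I2 b)
        qed measurable
        show "?P \<psi>" using limV[OF lims] PU A by simp
      qed
    qed
    then show ?thesis using fi by (simp flip: f_eq)
  qed
  have "F \<in> V" for F :: "'a l2"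
  proof -
    define f where "f = rep_l2 F"
    have [measurable]: "f \<in> borel_measurable borel" by (simp add: f_def)
    have fi: "sq_integrable f" by (simp add: f_def)
    define p where "p c g x = c * (of_real (max 0 (g x)) :: complex)" for c and g :: "'a \<Rightarrow> real" and x
    have pV: "sq_integrable (p c g)" "abs_l2 (p c g) \<in> V"
      if [measurable]: "g \<in> borel_measurable borel" and le: "\<And>x. \<bar>g x\<bar> \<le> norm (f x)"
      for c and g :: "'a \<Rightarrow> real"
    proof -
      have "norm (p c g x) \<le> norm c * norm (f x)" for x
        unfolding p_def norm_mult using le[of x] by (intro mult_left_mono) auto
      then show 1: "sq_integrable (p c g)"
        by (intro sq_integrable_bound[OF fi, of _ "norm c"]) (auto simp: p_def[abs_def])
      then show "abs_l2 (p c g) \<in> V"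
        unfolding p_def[abs_def] by (intro main) auto
    qed
    have re: "\<bar>Re z\<bar> \<le> norm z" "\<bar>- Re z\<bar> \<le> norm z" "\<bar>Im z\<bar> \<le> norm z" "\<bar>- Im z\<bar> \<le> norm z" for z
      by (auto simp: abs_Re_le_cmod abs_Im_le_cmod)
    have mf: "(\<lambda>x. Re (f x)) \<in> borel_measurable borel" "(\<lambda>x. - Re (f x)) \<in> borel_measurable borel"
      "(\<lambda>x. Im (f x)) \<in> borel_measurable borel" "(\<lambda>x. - Im (f x)) \<in> borel_measurable borel"
      by measurable
    note q = pV[OF mf(1) re(1), of 1] pV[OF mf(2) re(2), of "-1"] pV[OF mf(3) re(3), of \<i>] pV[OF mf(4) re(4), of "-\<i>"]
    have "f x = (p 1 (\<lambda>x. Re (f x)) x + p (-1) (\<lambda>x. - Re (f x)) x)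
        + (p \<i> (\<lambda>x. Im (f x)) x + p (-\<i>) (\<lambda>x. - Im (f x)) x)" for x
      by (simp add: p_def complex_eq_iff max_def)
    then have "abs_l2 f = abs_l2 (\<lambda>x. (p 1 (\<lambda>x. Re (f x)) x + p (-1) (\<lambda>x. - Re (f x)) x)
        + (p \<i> (\<lambda>x. Im (f x)) x + p (-\<i>) (\<lambda>x. - Im (f x)) x))"
      by (intro arg_cong[where f=abs_l2] ext)
    also have "\<dots> = (abs_l2 (p 1 (\<lambda>x. Re (f x))) + abs_l2 (p (-1) (\<lambda>x. - Re (f x))))
        + (abs_l2 (p \<i> (\<lambda>x. Im (f x))) + abs_l2 (p (-\<i>) (\<lambda>x. - Im (f x))))"
      by (simp only: abs_l2_add sq_integrable_add q(1,3,5,7))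
    also have "\<dots> \<in> V" by (intro addV q(2,4,6,8))
    finally show ?thesis by (simp add: f_def)
  qed
  then show ?thesis by (auto simp: V_def)
qed

section \<open>Gaussian integrals by complex shifts\<close>

lemma exp_power_series_sums:
  fixes z :: "'b::{real_normed_field,banach}"
  shows "(\<lambda>k. z ^ k / fact k) sums exp z"
  using exp_converges[of z] by (simp add: scaleR_conv_of_real divide_inverse mult.commute)

text \<open>
  The exponential series may be integrated term by term, which exhibits the integral as a power series in
  \<open>t\<close> that converges everywhere.
\<close>

lemma entire_exponential_integral:
  fixes \<phi> m :: "'a::euclidean_space \<Rightarrow> complex"
  assumes [measurable]: "\<phi> \<in> borel_measurable borel" "m \<in> borel_measurable borel"
    and int: "\<And>R. integrable lborel (\<lambda>x. norm (\<phi> x) * exp (R * norm (m x)))"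
  shows "(\<lambda>t. LINT x|lborel. \<phi> x * exp (t * m x)) holomorphic_on UNIV"
proof -
  define a where "a k = (LINT x|lborel. \<phi> x * (m x ^ k / fact k))" for k
  have sums: "(\<lambda>k. a k * t ^ k) sums (LINT x|lborel. \<phi> x * exp (t * m x))" for t
  proof -
    let ?f = "\<lambda>k x. \<phi> x * ((t * m x) ^ k / fact k)"
    let ?g = "\<lambda>x. norm (\<phi> x) * exp (norm t * norm (m x))"
    have nf: "norm (?f k x) = norm (\<phi> x) * ((norm t * norm (m x)) ^ k / fact k)" for k x
      by (simp add: norm_mult norm_divide norm_power)
    have part: "(\<Sum>k<n. norm (?f k x)) \<le> ?g x" for n x
    proof -
      let ?e = "\<lambda>k. (norm t * norm (m x)) ^ k / fact k"
      have "(\<Sum>k<n. ?e k) \<le> suminf ?e"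
        using exp_power_series_sums[of "norm t * norm (m x)"] by (intro sum_le_suminf) (auto simp: sums_iff)
      then show ?thesis
        unfolding nf sum_distrib_left[symmetric]
        using exp_power_series_sums[of "norm t * norm (m x)"] by (intro mult_left_mono) (auto simp: sums_iff)
    qed
    have le: "norm (?f k x) \<le> ?g x" for k x
      using part[where n="Suc k" and x=x] sum_nonneg[of "{..<k}" "\<lambda>k. norm (?f k x)"] by simp
    have intf: "integrable lborel (?f k)" for k
      by (rule Bochner_Integration.integrable_bound[OF int[of "norm t"]])
        (use le[where k=k] in \<open>auto intro!: AE_I2\<close>)
    have "(\<lambda>k. LINT x|lborel. ?f k x) sums (LINT x|lborel. (\<Sum>k. ?f k x))"
    proof (rule sums_integral)
      show "AE x in lborel. summable (\<lambda>k. norm (?f k x))"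
        unfolding nf by (intro AE_I2 summable_mult) (use exp_power_series_sums in \<open>auto simp: sums_iff\<close>)
      show "summable (\<lambda>k. LINT x|lborel. norm (?f k x))"
      proof (rule summableI_nonneg_bounded[where x="LINT x|lborel. ?g x"])
        show "(\<Sum>k<n. LINT x|lborel. norm (?f k x)) \<le> (LINT x|lborel. ?g x)" for n
        proof -
          have "(\<Sum>k<n. LINT x|lborel. norm (?f k x)) = (LINT x|lborel. (\<Sum>k<n. norm (?f k x)))"
            by (rule Bochner_Integration.integral_sum[symmetric], rule integrable_norm, rule intf)
          also have "\<dots> \<le> (LINT x|lborel. ?g x)"
            by (intro integral_mono Bochner_Integration.integrable_sum integrable_norm intf int part)
          finally show ?thesis .
        qed
      qed simp
    qed (rule intf)
    moreover have "(\<Sum>k. ?f k x) = \<phi> x * exp (t * m x)" for x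
      using sums_mult[OF exp_power_series_sums[of "t * m x"], of "\<phi> x"] by (simp add: sums_iff)
    moreover have "(LINT x|lborel. ?f k x) = a k * t ^ k" for k
      unfolding a_def by (simp add: power_mult_distrib mult.assoc flip: integral_mult_left_zero)
        (simp add: mult_ac)
    ultimately show ?thesis by simp
  qed
  have "(\<lambda>t. LINT x|lborel. \<phi> x * exp (t * m x)) holomorphic_on ball 0 r" for r
    using sums by (intro power_series_holomorphic[of 0 r a]) simp
  then have "(\<lambda>t. LINT x|lborel. \<phi> x * exp (t * m x)) field_differentiable at z" for z
    using holomorphic_on_imp_differentiable_at[of _ "ball 0 (norm z + 1)" z] by simp
  then show ?thesis by (simp add: holomorphic_on_def field_differentiable_at_within)
qed

text \<open>
  Complex quadratic forms on a real space are represented by real bilinear maps into \<open>\<complex>\<close>.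
\<close>

definition gauss_form :: "('a::euclidean_space \<Rightarrow> 'a \<Rightarrow> complex) \<Rightarrow> bool" where
  "gauss_form Q \<longleftrightarrow> bounded_bilinear Q \<and> (\<forall>x y. Q x y = Q y x) \<and>
     (\<exists>l>0. \<forall>x. Re (Q x x) \<le> - l * (norm x)\<^sup>2)"

definition gauss_int :: "('a::euclidean_space \<Rightarrow> 'a \<Rightarrow> complex) \<Rightarrow> ('a \<Rightarrow> complex) \<Rightarrow> complex" where
  "gauss_int Q l = (LINT x|lborel. exp (Q x x + 2 * l x))"

lemma gauss_form_measurable:
  assumes "gauss_form Q"
  shows "(\<lambda>x. Q x x) \<in> borel_measurable borel"
proof -
  have "bounded_bilinear Q" using assms by (simp add: gauss_form_def)
  then have "continuous_on UNIV (\<lambda>x. Q x x)"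
    by (rule bounded_bilinear.continuous_on[OF _ continuous_on_id continuous_on_id])
  then show ?thesis by (rule borel_measurable_continuous_onI)
qed

lemma bounded_linear_measurable:
  fixes l :: "'a::euclidean_space \<Rightarrow> complex"
  assumes "bounded_linear l"
  shows "l \<in> borel_measurable borel"
  using linear_continuous_on[OF assms, of UNIV] by (rule borel_measurable_continuous_onI)

lemma gauss_form_dominated:
  assumes Q: "gauss_form Q"
  shows "integrable lborel (\<lambda>x. norm (exp (Q x x)) * exp (R * norm x))"
proof -
  obtain l where l: "0 < l" "\<And>x. Re (Q x x) \<le> - l * (norm x)\<^sup>2"
    using Q by (auto simp: gauss_form_def)
  note [measurable] = gauss_form_measurable[OF Q]
  have 1: "norm (exp (Q x x)) * exp (R * norm x) \<le> exp (R\<^sup>2 / (2 * l)) * exp (- pi * (l / (2 * pi)) * (norm x)\<^sup>2)" for x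
  proof -
    have "norm (exp (Q x x)) * exp (R * norm x) \<le> exp (R * norm x - l * (norm x)\<^sup>2)"
      using l(2)[of x] by (simp add: norm_exp_eq_Re mult_exp_exp)
    also have "\<dots> \<le> exp (R\<^sup>2 / (2 * l)) * exp (- (l / 2) * (norm x)\<^sup>2)"
      by (rule exp_linear_quadratic_le[OF l(1)])
    finally show ?thesis by simp
  qed
  show ?thesis
  proof (rule Bochner_Integration.integrable_bound)
    show "integrable lborel (\<lambda>x::'a. exp (R\<^sup>2 / (2 * l)) * exp (- pi * (l / (2 * pi)) * (norm x)\<^sup>2))"
      by (intro integrable_mult_right gauss_integral_real(1)) (use l in simp)
  qed (use 1 in auto)
qed

lemma integrable_gauss_form:
  fixes l m :: "'a::euclidean_space \<Rightarrow> complex"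
  assumes Q: "gauss_form Q" and l: "bounded_linear l" and m: "bounded_linear m"
  shows "integrable lborel (\<lambda>x. norm (exp (Q x x + 2 * l x)) * exp (R * norm (2 * m x)))"
    "integrable lborel (\<lambda>x. exp (Q x x + 2 * l x))"
proof -
  note [measurable] = gauss_form_measurable[OF Q] bounded_linear_measurable[OF l] bounded_linear_measurable[OF m]
  obtain K where K: "\<And>x. norm (l x) \<le> norm x * K"
    using bounded_linear.bounded[OF l] by auto
  obtain M where M: "\<And>x. norm (m x) \<le> norm x * M"
    using bounded_linear.bounded[OF m] by auto
  have *: "norm (exp (Q x x + 2 * l x)) * exp (R * norm (2 * m x))
      \<le> norm (exp (Q x x)) * exp ((2 * K + \<bar>R\<bar> * (2 * M)) * norm x)" for R x
  proof -
    have "Re (2 * l x) \<le> 2 * (norm x * K)"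
      using K[of x] complex_Re_le_cmod[of "l x"] by simp
    moreover have "R * norm (2 * m x) \<le> \<bar>R\<bar> * (2 * (norm x * M))"
      using mult_mono[of R "\<bar>R\<bar>" "norm (2 * m x)" "2 * (norm x * M)"] M[of x] by (simp add: norm_mult)
    ultimately have "Re (Q x x) + Re (2 * l x) + R * norm (2 * m x)
        \<le> Re (Q x x) + (2 * K + \<bar>R\<bar> * (2 * M)) * norm x"
      by (simp add: algebra_simps)
    then show ?thesis
      by (simp add: norm_exp_eq_Re mult_exp_exp)
  qed
  show 1: "integrable lborel (\<lambda>x. norm (exp (Q x x + 2 * l x)) * exp (R * norm (2 * m x)))" for R
    by (rule Bochner_Integration.integrable_bound[OF gauss_form_dominated[OF Q, of "2 * K + \<bar>R\<bar> * (2 * M)"]])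
      (use * in auto)
  show "integrable lborel (\<lambda>x. exp (Q x x + 2 * l x))"
    by (rule Bochner_Integration.integrable_bound[OF 1[of 0]]) auto
qed

lemma gauss_int_shift_real:
  assumes Q: "gauss_form Q" and l: "bounded_linear l"
  shows "gauss_int Q (\<lambda>x. l x + Q x a) = exp (- Q a a - 2 * l a) * gauss_int Q l"
proof -
  interpret Q: bounded_bilinear Q using Q by (simp add: gauss_form_def)
  interpret l: bounded_linear l by (rule l)
  note [measurable] = gauss_form_measurable[OF Q] bounded_linear_measurable[OF l]
  have sym: "Q a x = Q x a" for x using Q by (simp add: gauss_form_def)
  have "gauss_int Q l = (LINT x|distr lborel borel ((+) a). exp (Q x x + 2 * l x))"
    by (simp add: gauss_int_def lborel_distr_plus)
  also have "\<dots> = (LINT x|lborel. exp (Q (a + x) (a + x) + 2 * l (a + x)))"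
    by (subst integral_distr) auto
  also have "\<dots> = (LINT x|lborel. exp (Q a a + 2 * l a) * exp (Q x x + 2 * (l x + Q x a)))"
  proof -
    have "Q (a + x) (a + x) + 2 * l (a + x) = (Q a a + 2 * l a) + (Q x x + 2 * (l x + Q x a))" for x
      using sym[of x] by (simp add: Q.add_left Q.add_right l.add algebra_simps)
    then show ?thesis by (simp only: exp_add)
  qed
  also have "\<dots> = exp (Q a a + 2 * l a) * gauss_int Q (\<lambda>x. l x + Q x a)"
    by (simp add: gauss_int_def)
  finally show ?thesis by (simp flip: mult.assoc add: mult_exp_exp)
qed

text \<open>
  Completing the square with a complex vector: both sides are entire in \<open>t\<close>, and they agree for
  real \<open>t\<close> because Lebesgue measure is translation invariant.
\<close>

lemma gauss_int_shift_complex: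
  assumes Q: "gauss_form Q" and l: "bounded_linear l"
  shows "gauss_int Q (\<lambda>x. l x + t * Q x a) = exp (- t\<^sup>2 * Q a a - 2 * t * l a) * gauss_int Q l"
proof -
  interpret Q: bounded_bilinear Q using Q by (simp add: gauss_form_def)
  have Qa: "bounded_linear (\<lambda>x. Q x a)" by (rule Q.bounded_linear_left)
  note [measurable] = gauss_form_measurable[OF Q] bounded_linear_measurable[OF l] bounded_linear_measurable[OF Qa]
  define D where "D t = gauss_int Q (\<lambda>x. l x + t * Q x a) - exp (- t\<^sup>2 * Q a a - 2 * t * l a) * gauss_int Q l" for t
  have "(\<lambda>t. LINT x|lborel. exp (Q x x + 2 * l x) * exp (t * (2 * Q x a))) holomorphic_on UNIV"
    by (rule entire_exponential_integral) (measurable, rule integrable_gauss_form(1)[OF Q l Qa])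
  then have "(\<lambda>t. gauss_int Q (\<lambda>x. l x + t * Q x a)) holomorphic_on UNIV"
    by (simp add: gauss_int_def mult_exp_exp algebra_simps)
  then have hol: "D holomorphic_on UNIV"
    unfolding D_def[abs_def] by (intro holomorphic_intros)
  have real: "D (of_real s) = 0" for s
    using gauss_int_shift_real[OF Q l, of "s *\<^sub>R a"]
    by (simp add: D_def Q.scaleR_left Q.scaleR_right linear_scale[OF bounded_linear.linear[OF l]] scaleR_conv_of_real
        power2_eq_square algebra_simps)
  have "D t = 0"
  proof (rule analytic_continuation[OF hol, of "\<real>" 0])
    show "(0::complex) islimpt \<real>"
      unfolding islimpt_approachable
    proof (intro allI impI)
      fix e :: real assume "0 < e"
      then show "\<exists>x'\<in>\<real>. x' \<noteq> 0 \<and> dist x' (0::complex) < e"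
        by (intro bexI[of _ "of_real (e / 2)"]) (auto simp: norm_divide)
    qed
    show "D z = 0" if "z \<in> \<real>" for z using real that by (auto simp: Reals_def)
  qed auto
  then show ?thesis by (simp add: D_def)
qed

text \<open>
  A complex vector is \<open>a + \<i> b\<close> with real \<open>a\<close> and \<open>b\<close>, so shifting twice, with two complex parameters,
  evaluates the integral at every complex linear term that \<open>Q\<close> represents.
\<close>

lemma gauss_int_complex_point:
  assumes Q: "gauss_form Q"
  shows "gauss_int Q (\<lambda>x. s * Q x a + t * Q x b)
    = exp (- (s\<^sup>2 * Q a a + t\<^sup>2 * Q b b + 2 * s * t * Q b a)) * gauss_int Q (\<lambda>x. 0)"
proof -
  interpret Q: bounded_bilinear Q using Q by (simp add: gauss_form_def)
  have bl: "bounded_linear (\<lambda>x. s * Q x a)"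
    by (intro bounded_linear_const_mult Q.bounded_linear_left)
  show ?thesis
    using gauss_int_shift_complex[OF Q bl, of t b] gauss_int_shift_complex[OF Q bounded_linear_zero, of s a]
    by (simp add: mult_exp_exp algebra_simps)
qed

lemma gauss_form_inner:
  assumes "0 < t"
  shows "gauss_form (\<lambda>x y::'a::euclidean_space. of_real (- pi * t * (x \<bullet> y)))"
proof -
  have "bounded_bilinear (\<lambda>x y::'a. of_real (- pi * t * (x \<bullet> y)) :: complex)"
    unfolding bilinear_conv_bounded_bilinear[symmetric]
    by (auto simp: bilinear_def linear_iff inner_add_left inner_add_right algebra_simps scaleR_conv_of_real)
  then show ?thesis
    using assms by (auto simp: gauss_form_def inner_commute power2_norm_eq_inner intro!: exI[of _ "pi * t"])
qed

lemma integral_gauss: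
  fixes u v :: "'a::euclidean_space"
  assumes t: "0 < t"
  shows "(LINT x|lborel. gauss t u v x) = of_real ((1 / sqrt t) ^ DIM('a)) *
     exp (of_real (pi / t) * (of_real ((norm u)\<^sup>2 - (norm v)\<^sup>2) + \<i> * of_real (2 * (u \<bullet> v))))"
proof -
  let ?Q = "\<lambda>x y::'a. of_real (- pi * t * (x \<bullet> y)) :: complex"
  have "gauss_int ?Q (\<lambda>x. 0) = (LINT x|lborel. of_real (exp (- pi * t * (norm (x::'a))\<^sup>2)))"
    by (simp add: gauss_int_def power2_norm_eq_inner flip: exp_of_real)
  also have "\<dots> = of_real ((1 / sqrt t) ^ DIM('a))"
    by (subst integral_complex_of_real) (simp only: gauss_integral_real(2)[OF t])
  finally have 0: "gauss_int ?Q (\<lambda>x. 0) = of_real ((1 / sqrt t) ^ DIM('a))" .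
  have "(LINT x|lborel. gauss t u v x) = gauss_int ?Q (\<lambda>x. of_real (- 1 / t) * ?Q x u + (- \<i> / of_real t) * ?Q x v)"
  proof -
    have "of_real (- 1 / t) * ?Q x u = of_real (pi * (u \<bullet> x))"
      "(- \<i> / of_real t) * ?Q x v = \<i> * of_real (pi * (v \<bullet> x))" for x
      using t by (simp_all add: inner_commute)
    then show ?thesis
      unfolding gauss_int_def by (simp only:) (simp add: gauss_def power2_norm_eq_inner algebra_simps)
  qed
  also have "\<dots> = exp (- ((of_real (- 1 / t))\<^sup>2 * ?Q u u + (- \<i> / of_real t)\<^sup>2 * ?Q v v
      + 2 * of_real (- 1 / t) * (- \<i> / of_real t) * ?Q v u)) * of_real ((1 / sqrt t) ^ DIM('a))"
    by (rule trans[OF gauss_int_complex_point[OF gauss_form_inner[OF t], of "of_real (- 1 / t)" u "- \<i> / of_real t" v]])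
      (simp only: 0)
  also have "- ((of_real (- 1 / t))\<^sup>2 * ?Q u u + (- \<i> / of_real t)\<^sup>2 * ?Q v v
      + 2 * of_real (- 1 / t) * (- \<i> / of_real t) * ?Q v u)
      = of_real (pi / t) * (of_real ((norm u)\<^sup>2 - (norm v)\<^sup>2) + \<i> * of_real (2 * (u \<bullet> v)))"
    unfolding power2_norm_eq_inner using t by (simp add: inner_commute[of v u] power2_eq_square field_simps)
  finally show ?thesis by (simp add: mult.commute)
qed

section \<open>Gaussians are Schwartz functions\<close>

text \<open>Polynomial multiples of a fixed Gaussian; the class is closed under directional derivatives.\<close>

inductive poly_gauss :: "real \<Rightarrow> 'a::euclidean_space \<Rightarrow> 'a \<Rightarrow> ('a \<Rightarrow> complex) \<Rightarrow> bool"
  for t :: real and u v :: 'a where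
  base: "poly_gauss t u v (gauss t u v)"
| lin: "poly_gauss t u v f \<Longrightarrow> poly_gauss t u v (\<lambda>x. of_real (x \<bullet> b) * f x)"
| add: "poly_gauss t u v f \<Longrightarrow> poly_gauss t u v g \<Longrightarrow> poly_gauss t u v (\<lambda>x. f x + g x)"
| scale: "poly_gauss t u v f \<Longrightarrow> poly_gauss t u v (\<lambda>x. c * f x)"

lemma poly_gauss_has_derivative:
  assumes "poly_gauss t u v f"
  shows "\<exists>D. (\<forall>x. (f has_derivative D x) (at x)) \<and> (\<forall>w. poly_gauss t u v (\<lambda>x. D x w))"
  using assms
proof induction
  case base
  let ?D = "\<lambda>x w. (of_real (2 * pi * (u \<bullet> w)) + \<i> * of_real (2 * pi * (v \<bullet> w))) * gauss t u v x
      + (- of_real (2 * pi * t)) * (of_real (x \<bullet> w) * gauss t u v x)"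
  have "(gauss t u v has_derivative ?D x) (at x)" for x
  proof -
    let ?q = "\<lambda>x. of_real (2 * pi * (u \<bullet> x) - pi * t * (x \<bullet> x)) + \<i> * of_real (2 * pi * (v \<bullet> x)) :: complex"
    let ?q' = "\<lambda>w. of_real (2 * pi * (u \<bullet> w) - 2 * pi * t * (x \<bullet> w)) + \<i> * of_real (2 * pi * (v \<bullet> w)) :: complex"
    have "(?q has_derivative ?q') (at x)"
      by (rule derivative_eq_intros refl)+ (auto simp: inner_commute algebra_simps)
    from has_derivative_compose[OF this DERIV_exp[THEN has_field_derivative_imp_has_derivative]]
    have "((\<lambda>x. exp (?q x)) has_derivative (\<lambda>w. exp (?q x) * ?q' w)) (at x)" .
    moreover have "exp (?q x) = gauss t u v x" for x
      by (simp add: gauss_def power2_norm_eq_inner)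
    moreover have "gauss t u v x * ?q' w = ?D x w" for w by (simp add: algebra_simps)
    ultimately show ?thesis by simp
  qed
  moreover have "poly_gauss t u v (\<lambda>x. ?D x w)" for w
    by (intro poly_gauss.intros)
  ultimately show ?case by (intro exI[of _ ?D]) blast
next
  case (lin f b)
  then obtain D where D: "\<And>x. (f has_derivative D x) (at x)" "\<And>w. poly_gauss t u v (\<lambda>x. D x w)"
    by blast
  let ?E = "\<lambda>x w. of_real (x \<bullet> b) * D x w + of_real (w \<bullet> b) * f x"
  have "((\<lambda>x. of_real (x \<bullet> b) * f x) has_derivative ?E x) (at x)" for x
  proof -
    have "((\<lambda>x. x \<bullet> b) has_derivative (\<lambda>w. w \<bullet> b)) (at x)"
      by (intro bounded_linear_imp_has_derivative bounded_linear_inner_left)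
    from has_derivative_mult[OF has_derivative_of_real[OF this] D(1)[of x]] show ?thesis .
  qed
  moreover have "poly_gauss t u v (\<lambda>x. ?E x w)" for w
    by (intro poly_gauss.intros D lin)
  ultimately show ?case by (intro exI[of _ ?E]) blast
next
  case (add f g)
  then obtain D E where D: "\<And>x. (f has_derivative D x) (at x)" "\<And>w. poly_gauss t u v (\<lambda>x. D x w)"
     and E: "\<And>x. (g has_derivative E x) (at x)" "\<And>w. poly_gauss t u v (\<lambda>x. E x w)"
    by metis
  have "((\<lambda>x. f x + g x) has_derivative (\<lambda>w. D x w + E x w)) (at x)" for x
    by (intro has_derivative_add D E)
  moreover have "poly_gauss t u v (\<lambda>x. D x w + E x w)" for w
    by (intro poly_gauss.intros D E)
  ultimately show ?case by (intro exI[of _ "\<lambda>x w. D x w + E x w"]) blast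
next
  case (scale f c)
  then obtain D where D: "\<And>x. (f has_derivative D x) (at x)" "\<And>w. poly_gauss t u v (\<lambda>x. D x w)"
    by blast
  have "((\<lambda>x. c * f x) has_derivative (\<lambda>w. c * D x w)) (at x)" for x
    by (intro has_derivative_mult_right D)
  moreover have "poly_gauss t u v (\<lambda>x. c * D x w)" for w
    by (intro poly_gauss.intros D)
  ultimately show ?case by (intro exI[of _ "\<lambda>x w. c * D x w"]) blast
qed

lemma power_le_exp:
  fixes r :: real assumes "0 \<le> r"
  shows "r ^ k \<le> fact k * exp r"
proof -
  have "sum (\<lambda>k. r ^ k / fact k) {k} \<le> (\<Sum>k. r ^ k / fact k)"
    using exp_power_series_sums[of r] assms by (intro sum_le_suminf) (auto simp: sums_iff)
  also have "\<dots> = exp r" using exp_power_series_sums[of r] by (simp add: sums_iff)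
  finally show ?thesis by (simp add: divide_le_eq mult.commute)
qed

lemma poly_gauss_decay:
  assumes "poly_gauss t u v f" "0 < t"
  shows "\<exists>C. \<forall>x. norm x ^ k * norm (f x) \<le> C"
  using assms(1)
proof (induction arbitrary: k)
  case base
  define K where "K = exp (2 * pi * (norm u)\<^sup>2 / t)"
  define a where "a = pi * (t / 2)"
  have a: "0 < a" using assms(2) by (simp add: a_def)
  have "norm x ^ k * norm (gauss t u v x) \<le> fact k * K * exp (1 / (2 * a))" for x
  proof -
    have "norm x ^ k * norm (gauss t u v x) \<le> (fact k * exp (norm x)) * (K * exp (- a * (norm x)\<^sup>2))"
      using norm_gauss_le[OF assms(2), of u v x]
      by (intro mult_mono power_le_exp) (auto simp: K_def a_def)
    also have "\<dots> = fact k * K * exp (1 * norm x - a * (norm x)\<^sup>2)"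
      by (simp add: exp_diff exp_minus field_simps)
    also have "exp (1 * norm x - a * (norm x)\<^sup>2) \<le> exp (1\<^sup>2 / (2 * a)) * exp (- (a / 2) * (norm x)\<^sup>2)"
      by (rule exp_linear_quadratic_le[OF a])
    also have "exp (1\<^sup>2 / (2 * a)) * exp (- (a / 2) * (norm x)\<^sup>2) \<le> exp (1 / (2 * a)) * 1"
      using a by (intro mult_mono) auto
    finally show ?thesis by (simp add: K_def mult_left_mono)
  qed
  then show ?case by blast
next
  case (lin f b)
  obtain C where C: "\<And>x. norm x ^ Suc k * norm (f x) \<le> C" using lin.IH by blast
  have "norm x ^ k * norm (of_real (x \<bullet> b) * f x) \<le> norm b * C" for x
  proof -
    have "norm x ^ k * norm (of_real (x \<bullet> b) * f x) = norm x ^ k * (\<bar>x \<bullet> b\<bar> * norm (f x))"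
      by (simp add: norm_mult)
    also have "\<dots> \<le> norm x ^ k * ((norm x * norm b) * norm (f x))"
      by (intro mult_left_mono mult_right_mono Cauchy_Schwarz_ineq2) auto
    also have "\<dots> = norm b * (norm x ^ Suc k * norm (f x))" by simp
    also have "\<dots> \<le> norm b * C" by (intro mult_left_mono C) auto
    finally show ?thesis .
  qed
  then show ?case by blast
next
  case (add f g)
  obtain C D where C: "\<And>x. norm x ^ k * norm (f x) \<le> C" and D: "\<And>x. norm x ^ k * norm (g x) \<le> D"
    using add.IH by metis
  have "norm x ^ k * norm (f x + g x) \<le> C + D" for x
  proof -
    have "norm x ^ k * norm (f x + g x) \<le> norm x ^ k * (norm (f x) + norm (g x))"
      by (intro mult_left_mono norm_triangle_ineq) auto
    also have "\<dots> \<le> C + D" using C[of x] D[of x] by (simp add: distrib_left)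
    finally show ?thesis .
  qed
  then show ?case by blast
next
  case (scale f c)
  obtain C where C: "\<And>x. norm x ^ k * norm (f x) \<le> C" using scale.IH by blast
  have "norm x ^ k * norm (c * f x) \<le> norm c * C" for x
    using mult_left_mono[OF C[of x], of "norm c"] by (simp add: norm_mult mult_ac)
  then show ?case by blast
qed

lemma schwartz_gauss:
  assumes "0 < t"
  shows "schwartz (\<lambda>x. c * gauss t u v x)"
proof -
  have pg: "poly_gauss t u v (iter_deriv vs (\<lambda>x. c * gauss t u v x))" for vs
  proof (induction vs)
    case Nil
    then show ?case by (auto intro: poly_gauss.intros)
  next
    case (Cons w vs)
    obtain D where D: "\<And>x. (iter_deriv vs (\<lambda>x. c * gauss t u v x) has_derivative D x) (at x)"
       "\<And>w. poly_gauss t u v (\<lambda>x. D x w)"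
      using poly_gauss_has_derivative[OF Cons] by blast
    have "frechet_derivative (iter_deriv vs (\<lambda>x. c * gauss t u v x)) (at x) = D x" for x
      using frechet_derivative_at[OF D(1)] by simp
    then show ?case using D(2)[of w] by simp
  qed
  show ?thesis
    unfolding schwartz_def
    using poly_gauss_has_derivative[OF pg] poly_gauss_decay[OF pg assms]
    by (meson differentiableI)
qed

lemma schwartz_decay:
  assumes f: "schwartz f"
  shows "\<exists>C\<ge>0. \<forall>x. (1 + (norm x)\<^sup>2) ^ n * norm (f x) \<le> C"
proof -
  have "\<forall>k. \<exists>C. \<forall>x. norm x ^ k * norm (f x) \<le> C"
    using f[unfolded schwartz_def, rule_format, of "[]"] by simp
  then obtain C0 C1 where C: "\<And>x. norm x ^ 0 * norm (f x) \<le> C0" "\<And>x. norm x ^ (2 * n) * norm (f x) \<le> C1"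
    by metis
  have "(1 + (norm x)\<^sup>2) ^ n * norm (f x) \<le> 2 ^ n * (C0 + C1)" for x
  proof -
    have "1 + (norm x)\<^sup>2 \<le> 2 * max 1 ((norm x)\<^sup>2)" by simp
    then have "(1 + (norm x)\<^sup>2) ^ n \<le> (2 * max 1 ((norm x)\<^sup>2)) ^ n"
      by (intro power_mono) auto
    also have "\<dots> \<le> 2 ^ n * (1 + (norm x) ^ (2 * n))"
      by (auto simp: power_mult_distrib max_def power_mult intro!: mult_left_mono)
    finally have "(1 + (norm x)\<^sup>2) ^ n * norm (f x) \<le> 2 ^ n * (1 + (norm x) ^ (2 * n)) * norm (f x)"
      by (rule mult_right_mono) simp
    also have "\<dots> = 2 ^ n * (norm (f x) + norm x ^ (2 * n) * norm (f x))"
      by (simp add: algebra_simps)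
    also have "\<dots> \<le> 2 ^ n * (C0 + C1)"
      using C[of x] by (intro mult_left_mono add_mono) auto
    finally show ?thesis .
  qed
  moreover from this[of 0] have "0 \<le> 2 ^ n * (C0 + C1)"
    by (rule order_trans[rotated]) simp
  ultimately show ?thesis by blast
qed

lemma schwartz_measurable:
  assumes "schwartz f" shows "f \<in> borel_measurable borel"
proof -
  have "f differentiable at x" for x
    using assms[unfolded schwartz_def, rule_format, of "[]"] by simp
  then have "continuous_on UNIV f"
    by (simp add: continuous_on_eq_continuous_within differentiable_imp_continuous_within)
  then show ?thesis by (rule borel_measurable_continuous_onI)
qed

lemma integrable_inverse_1_plus_square: "integrable lborel (\<lambda>x::real. inverse (1 + x\<^sup>2))"
  using Sinc_Integral.integrable_inverse_1_plus_square by (simp add: set_integrable_def)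

lemma schwartz_integrable:
  fixes f :: "'a::euclidean_space \<Rightarrow> complex"
  assumes f: "schwartz f"
  shows "integrable lborel f" "sq_integrable f"
proof -
  note [measurable] = schwartz_measurable[OF f]
  obtain C where C: "0 \<le> C" "\<And>x. (1 + (norm x)\<^sup>2) ^ DIM('a) * norm (f x) \<le> C"
    using schwartz_decay[OF f] by blast
  let ?g = "\<lambda>x::'a. C * (\<Prod>b\<in>Basis. inverse (1 + (x \<bullet> b)\<^sup>2))"
  have b: "norm (f x) \<le> ?g x" for x
  proof -
    have "(\<Prod>b\<in>Basis. 1 + (x \<bullet> b)\<^sup>2) \<le> (\<Prod>b\<in>(Basis::'a set). 1 + (norm x)\<^sup>2)"
      by (intro prod_mono) (auto simp: abs_le_square_iff[symmetric] Basis_le_norm)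
    then have "(\<Prod>b\<in>Basis. 1 + (x \<bullet> b)\<^sup>2) * norm (f x) \<le> C"
      using C(2)[of x] mult_right_mono[of "(\<Prod>b\<in>Basis. 1 + (x \<bullet> b)\<^sup>2)" _ "norm (f x)"] by fastforce
    moreover have "0 < (\<Prod>b\<in>(Basis::'a set). 1 + (x \<bullet> b)\<^sup>2)"
      by (intro prod_pos) (auto intro: add_pos_nonneg)
    ultimately show ?thesis
      using prod_inversef[of "\<lambda>b. 1 + (x \<bullet> b)\<^sup>2" "Basis :: 'a set"]
      by (simp add: comp_def pos_le_divide_eq mult.commute flip: divide_inverse)
  qed
  have ig: "integrable lborel ?g"
    by (intro integrable_mult_right integrable_lborel_prod integrable_inverse_1_plus_square)
  show 1: "integrable lborel f"
    by (rule Bochner_Integration.integrable_bound[OF ig]) (use b in \<open>auto intro!: order_trans[OF b]\<close>)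
  obtain K where K: "\<And>x. norm (f x) \<le> K" "0 \<le> K"
    using schwartz_decay[OF f, of 0] by auto
  have "integrable lborel (\<lambda>x. (norm (f x))\<^sup>2)"
  proof (rule Bochner_Integration.integrable_bound)
    show "integrable lborel (\<lambda>x. K * norm (f x))" using 1 by simp
    show "AE x in lborel. norm ((norm (f x))\<^sup>2) \<le> norm (K * norm (f x))"
      using K by (auto simp: power2_eq_square abs_mult intro!: mult_right_mono)
  qed simp
  then show "sq_integrable f" by (simp add: sq_integrable_def)
qed

text \<open>
  Gaussians are Schwartz functions with dense span, so a bounded operator with the prescribed values on
  Schwartz functions is unique.
\<close>

lemma l2_extension_eq:
  fixes U :: "'a::euclidean_space l2 \<Rightarrow> 'a l2"
  assumes U: "bounded_linear U" and eq: "\<And>f. schwartz f \<Longrightarrow> U (abs_l2 f) = abs_l2 (K f)"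
  shows "l2_extension K = U"
  unfolding l2_extension_def
proof (rule the_equality)
  fix V assume V: "bounded_linear V \<and> (\<forall>f. schwartz f \<longrightarrow> V (abs_l2 f) = abs_l2 (K f))"
  show "V = U"
  proof (rule bounded_linear_eq_on_dense_span[OF _ U _ closure_span_gauss_classes])
    fix x :: "'a l2" assume "x \<in> gauss_classes"
    then obtain c t u v where "0 < t" and x: "x = abs_l2 (\<lambda>x. c * gauss t u v x)"
      by (auto simp: gauss_classes_def)
    then have "schwartz (\<lambda>x. c * gauss t u v x)" by (intro schwartz_gauss)
    then show "V x = U x" unfolding x using V eq by simp
  qed (use V in blast)
qed (use assms in blast)

section \<open>The Fourier transform as a unitary operator\<close>

lemma fourier_integral_measurable [measurable]:
  assumes [measurable]: "f \<in> borel_measurable borel"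
  shows "fourier_integral f \<in> borel_measurable borel"
  unfolding fourier_integral_def by measurable

lemma norm_fourier_integral_le: "norm (fourier_integral f \<xi>) \<le> (LINT x|lborel. norm (f x))"
proof -
  have "norm (fourier_integral f \<xi>)
      \<le> (LINT x|lborel. norm (f x * exp (- (2 * of_real pi * \<i> * of_real (\<xi> \<bullet> x)))))"
    unfolding fourier_integral_def by (rule integral_norm_bound)
  also have "\<dots> = (LINT x|lborel. norm (f x))" by (simp add: norm_mult norm_exp_eq_Re)
  finally show ?thesis .
qed

lemma fourier_integral_rep_abs:
  assumes "sq_integrable f"
  shows "fourier_integral (rep_l2 (abs_l2 f)) = fourier_integral f"
proof
  fix \<xi>
  note [measurable] = sq_integrable_borel[OF assms]
  show "fourier_integral (rep_l2 (abs_l2 f)) \<xi> = fourier_integral f \<xi>"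
    unfolding fourier_integral_def
    by (rule integral_cong_AE) (use AE_rep_abs[OF assms] in auto)
qed

lemma fourier_multiplication:
  fixes f k :: "'a::euclidean_space \<Rightarrow> complex"
  assumes f: "integrable lborel f" and k: "integrable lborel k"
  shows "(LINT x|lborel. fourier_integral f x * k x) = (LINT x|lborel. f x * fourier_integral k x)"
proof -
  have [measurable]: "f \<in> borel_measurable borel" "k \<in> borel_measurable borel"
    using f k by (simp_all add: integrable_iff_bounded)
  let ?e = "\<lambda>x y::'a. exp (- (2 * of_real pi * \<i> * of_real (x \<bullet> y))) :: complex"
  have ne: "norm (f x * (k y * ?e y x)) = norm (f x) * norm (k y)" for x y
    by (simp add: norm_mult norm_exp_eq_Re)
  have int: "integrable (lborel \<Otimes>\<^sub>M lborel) (\<lambda>(x, y). f x * (k y * ?e y x))"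
  proof (rule lborel_pair.Fubini_integrable)
    show "(\<lambda>(x, y). f x * (k y * ?e y x)) \<in> borel_measurable (lborel \<Otimes>\<^sub>M lborel)"
      by measurable
    show "integrable lborel (\<lambda>x. LINT y|lborel. norm (case (x, y) of (x, y) \<Rightarrow> f x * (k y * ?e y x)))"
      using f by (simp add: ne del: norm_mult)
    have "integrable lborel (\<lambda>y. k y * ?e y x)" for x
      by (rule Bochner_Integration.integrable_bound[OF k]) (auto simp: norm_mult norm_exp_eq_Re)
    then show "AE x in lborel. integrable lborel (\<lambda>y. case (x, y) of (x, y) \<Rightarrow> f x * (k y * ?e y x))"
      by simp
  qed
  have "(LINT x|lborel. f x * fourier_integral k x) = (LINT x|lborel. LINT y|lborel. f x * (k y * ?e y x))"
    unfolding fourier_integral_def by (simp add: inner_commute)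
  also have "\<dots> = (LINT y|lborel. LINT x|lborel. f x * (k y * ?e y x))"
    by (rule lborel_pair.Fubini_integral[OF int, symmetric])
  also have "\<dots> = (LINT y|lborel. fourier_integral f y * k y)"
    unfolding fourier_integral_def integral_mult_left_zero[symmetric] by (simp add: mult_ac)
  finally show ?thesis by simp
qed

definition gauss_const :: "real \<Rightarrow> 'a::euclidean_space \<Rightarrow> 'a \<Rightarrow> complex" where
  "gauss_const t u v = of_real ((1 / sqrt t) ^ DIM('a)) *
     exp (of_real (pi / t) * (of_real ((norm u)\<^sup>2 - (norm v)\<^sup>2) + \<i> * of_real (2 * (u \<bullet> v))))"

lemma fourier_gauss:
  assumes t: "0 < t"
  shows "fourier_integral (\<lambda>x. c * gauss t u v x) \<xi>
    = c * gauss_const t u v * gauss (1 / t) (v /\<^sub>R t) (- (u /\<^sub>R t)) \<xi>"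
proof -
  have "gauss t u v x * exp (- (2 * of_real pi * \<i> * of_real (\<xi> \<bullet> x))) = gauss t u (v - \<xi>) x" for x
    by (simp add: gauss_def mult_exp_exp inner_diff_left algebra_simps)
  then have "fourier_integral (\<lambda>x. c * gauss t u v x) \<xi> = c * (LINT x|lborel. gauss t u (v - \<xi>) x)"
    by (simp add: fourier_integral_def mult.assoc)
  also have "\<dots> = c * (of_real ((1 / sqrt t) ^ DIM('a)) *
     exp (of_real (pi / t) * (of_real ((norm u)\<^sup>2 - (norm (v - \<xi>))\<^sup>2) + \<i> * of_real (2 * (u \<bullet> (v - \<xi>))))))"
    by (subst integral_gauss[OF t]) simp
  also have "of_real (pi / t) * (of_real ((norm u)\<^sup>2 - (norm (v - \<xi>))\<^sup>2) + \<i> * of_real (2 * (u \<bullet> (v - \<xi>))))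
     = of_real (pi / t) * (of_real ((norm u)\<^sup>2 - (norm v)\<^sup>2) + \<i> * of_real (2 * (u \<bullet> v)))
      + (of_real (2 * pi * ((v /\<^sub>R t) \<bullet> \<xi>) - pi * (1 / t) * (norm \<xi>)\<^sup>2)
          + \<i> * of_real (2 * pi * (- (u /\<^sub>R t) \<bullet> \<xi>)))"
    unfolding power2_norm_eq_inner
    using t by (simp add: inner_diff_left inner_diff_right inner_commute[of \<xi> v] field_simps)
  finally show ?thesis by (simp add: gauss_const_def gauss_def exp_add mult.assoc)
qed

lemma gauss_const_inverse:
  assumes t: "0 < t"
  shows "gauss_const t u v * gauss_const (1 / t) (v /\<^sub>R t) (- (u /\<^sub>R t)) = 1"
proof -
  define X where "X = of_real (pi / t) * (of_real ((norm u)\<^sup>2 - (norm v)\<^sup>2) + \<i> * of_real (2 * (u \<bullet> v)))"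
  define Y where "Y = of_real (pi / (1 / t)) * (of_real ((norm (v /\<^sub>R t))\<^sup>2 - (norm (- (u /\<^sub>R t)))\<^sup>2)
        + \<i> * of_real (2 * ((v /\<^sub>R t) \<bullet> (- (u /\<^sub>R t)))))"
  have XY: "X + Y = 0"
    unfolding power2_norm_eq_inner X_def Y_def
    using t by (simp add: inner_commute[of v u] field_simps)
  have "(1 / sqrt t) ^ n * (1 / sqrt (1 / t)) ^ n = 1" for n
    using t by (simp add: real_sqrt_divide flip: power_mult_distrib)
  then have AB: "of_real ((1 / sqrt t) ^ n) * of_real ((1 / sqrt (1 / t)) ^ n) = (1::complex)" for n
    by (metis of_real_1 of_real_mult)
  have "(A * exp X) * (B * exp Y) = (A * B) * exp (X + Y)" for A B
    by (simp add: exp_add)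
  then show ?thesis
    unfolding gauss_const_def X_def[symmetric] Y_def[symmetric] by (simp only: AB XY exp_zero mult_1)
qed

lemma gauss_uminus: "gauss t u v (- x) = gauss t (- u) (- v) x"
  by (simp add: gauss_def)

definition is_gauss :: "('a::euclidean_space \<Rightarrow> complex) \<Rightarrow> bool" where
  "is_gauss f \<longleftrightarrow> (\<exists>c t u v. 0 < t \<and> f = (\<lambda>x. c * gauss t u v x))"

lemma gauss_classes_eq: "gauss_classes = abs_l2 ` {f. is_gauss f}"
  unfolding gauss_classes_def is_gauss_def image_def by blast

lemma is_gaussI: "0 < t \<Longrightarrow> is_gauss (\<lambda>x. c * gauss t u v x)"
  by (auto simp: is_gauss_def)

lemma is_gaussE:
  assumes "is_gauss f" obtains c t u v where "0 < t" "f = (\<lambda>x. c * gauss t u v x)"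
  using assms by (auto simp: is_gauss_def)

lemma is_gauss_schwartz: "is_gauss f \<Longrightarrow> schwartz f"
  by (auto simp: is_gauss_def intro: schwartz_gauss)

lemma is_gauss_integrable: "is_gauss f \<Longrightarrow> integrable lborel f"
  and is_gauss_sq_integrable: "is_gauss f \<Longrightarrow> sq_integrable f"
  and is_gauss_measurable: "is_gauss f \<Longrightarrow> f \<in> borel_measurable borel"
  using schwartz_integrable schwartz_measurable is_gauss_schwartz by blast+

lemma is_gauss_bounded: "is_gauss f \<Longrightarrow> \<exists>C. \<forall>x. norm (f x) \<le> C"
  using schwartz_decay[OF is_gauss_schwartz, of f 0] by auto

lemma fourier_gauss_fun:
  assumes "0 < t"
  shows "fourier_integral (\<lambda>x. c * gauss t u v x)
    = (\<lambda>x. (c * gauss_const t u v) * gauss (1 / t) (v /\<^sub>R t) (- (u /\<^sub>R t)) x)"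
  by (rule ext) (simp add: fourier_gauss[OF assms])

lemma is_gauss_fourier: "is_gauss f \<Longrightarrow> is_gauss (fourier_integral f)"
  by (elim is_gaussE) (simp only: fourier_gauss_fun, rule is_gaussI, simp)

lemma is_gauss_cnj: "is_gauss f \<Longrightarrow> is_gauss (\<lambda>x. cnj (f x))"
  by (elim is_gaussE) (simp only: complex_cnj_mult cnj_gauss, rule is_gaussI)

lemma is_gauss_uminus: "is_gauss f \<Longrightarrow> is_gauss (\<lambda>x. f (- x))"
  by (elim is_gaussE) (simp only: gauss_uminus, rule is_gaussI)

lemma fourier_fourier_gauss:
  assumes "is_gauss f"
  shows "fourier_integral (fourier_integral f) \<xi> = f (- \<xi>)"
proof -
  obtain c t u v where t: "0 < t" and f: "f = (\<lambda>x. c * gauss t u v x)"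
    using assms by (rule is_gaussE)
  have "fourier_integral (fourier_integral f) \<xi>
      = c * (gauss_const t u v * gauss_const (1 / t) (v /\<^sub>R t) (- (u /\<^sub>R t))) * gauss t (- u) (- v) \<xi>"
    unfolding f fourier_gauss_fun[OF t] using t by (subst fourier_gauss) simp_all
  then show ?thesis by (simp add: gauss_const_inverse[OF t] f gauss_uminus)
qed

lemma fourier_cnj: "fourier_integral (\<lambda>x. cnj (f x)) \<xi> = cnj (fourier_integral f (- \<xi>))"
proof -
  have "cnj (fourier_integral f (- \<xi>)) = (LINT x|lborel. cnj (f x * exp (- (2 * of_real pi * \<i> * of_real (- \<xi> \<bullet> x)))))"
    unfolding fourier_integral_def by (rule Bochner_Integration.integral_cnj[symmetric])
  then show ?thesis by (simp add: fourier_integral_def exp_cnj)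
qed

lemma integrable_mult_bounded:
  fixes f g :: "'a::euclidean_space \<Rightarrow> complex"
  assumes f: "integrable lborel f" and g: "g \<in> borel_measurable borel" and C: "\<And>x. norm (g x) \<le> C"
  shows "integrable lborel (\<lambda>x. f x * g x)"
proof (rule Bochner_Integration.integrable_bound)
  show "integrable lborel (\<lambda>x. C * norm (f x))" using f by simp
  have [measurable]: "f \<in> borel_measurable borel" using f by (simp add: integrable_iff_bounded)
  show "(\<lambda>x. f x * g x) \<in> borel_measurable lborel" using g by simp
  have "0 \<le> C" using order_trans[OF norm_ge_zero C] .
  then show "AE x in lborel. norm (f x * g x) \<le> norm (C * norm (f x))"
    using C by (auto simp: norm_mult abs_mult mult.commute[of C] intro!: mult_left_mono)
qed

lemma inner_complex_eq: "z \<bullet> w = Re (z * cnj w)" for z w :: complex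
  by (simp add: inner_complex_def)

text \<open>
  Only one of the two functions has to be a Gaussian: it is the Fourier transform of a function whose
  inversion formula is explicit, and the multiplication formula moves the transform to the other function.
\<close>

lemma fourier_parseval_gauss:
  assumes f: "integrable lborel f" and k: "is_gauss k"
  shows "(LINT x|lborel. fourier_integral f x \<bullet> fourier_integral k x) = (LINT x|lborel. f x \<bullet> k x)"
proof -
  have fm [measurable]: "f \<in> borel_measurable borel" using f by (simp add: integrable_iff_bounded)
  note g1 = is_gauss_cnj[OF is_gauss_fourier[OF k]]
  obtain C where C: "\<And>x. norm (k x) \<le> C" using is_gauss_bounded[OF k] by blast
  have i1: "integrable lborel (\<lambda>x. fourier_integral f x * cnj (fourier_integral k x))"
    using integrable_mult_bounded[OF is_gauss_integrable[OF g1] fourier_integral_measurable[OF fm] norm_fourier_integral_le[of f]]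
    by (simp add: mult.commute)
  have i2: "integrable lborel (\<lambda>x. f x * cnj (k x))"
    by (rule integrable_mult_bounded[OF f is_gauss_measurable[OF is_gauss_cnj[OF k]]]) (use C in simp)
  have "fourier_integral (\<lambda>x. cnj (fourier_integral k x)) \<xi> = cnj (k \<xi>)" for \<xi>
    by (simp add: fourier_cnj fourier_fourier_gauss[OF k])
  then have "(LINT x|lborel. fourier_integral f x * cnj (fourier_integral k x)) = (LINT x|lborel. f x * cnj (k x))"
    using fourier_multiplication[OF f is_gauss_integrable[OF g1]] by simp
  then show ?thesis
    unfolding inner_complex_eq using integral_Re[OF i1] integral_Re[OF i2] by simp
qed

lemma gauss_surj_fourier:
  assumes "is_gauss k"
  obtains g where "is_gauss g" "fourier_integral g = k"
proof
  define h where "h x = k (- x)" for x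
  have h: "is_gauss h" using is_gauss_uminus[OF assms] by (simp add: h_def[abs_def])
  show "is_gauss (fourier_integral h)" by (rule is_gauss_fourier[OF h])
  show "fourier_integral (fourier_integral h) = k"
    using fourier_fourier_gauss[OF h] by (auto simp: h_def)
qed

lemma orthogonal_gauss_zero:
  fixes F :: "'a::euclidean_space l2"
  assumes "\<And>k. is_gauss k \<Longrightarrow> F \<bullet> abs_l2 k = 0"
  shows "F = 0"
proof -
  have "(\<lambda>G. F \<bullet> G) = (\<lambda>G. 0)"
    by (rule bounded_linear_eq_on_dense_span[OF _ _ _ closure_span_gauss_classes])
      (auto simp: gauss_classes_eq assms bounded_linear_inner_right)
  then have "F \<bullet> F = 0" by (rule fun_cong)
  then show ?thesis by simp
qed

text \<open>
  For integrable square integrable \<open>f\<close> the integral and the isometric extension agree: their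
  difference, multiplied by a Gaussian to make it square integrable, is orthogonal to all
  Gaussians by Parseval's identity.
\<close>

lemma fourier_isometry_exists:
  "\<exists>U :: 'a::euclidean_space l2 \<Rightarrow> 'a l2. bounded_linear U \<and> (\<forall>F G. U F \<bullet> U G = F \<bullet> G) \<and>
     (\<forall>f. integrable lborel f \<and> sq_integrable f \<longrightarrow>
       sq_integrable (fourier_integral f) \<and> U (abs_l2 f) = abs_l2 (fourier_integral f))"
proof -
  define T where "T F = abs_l2 (fourier_integral (rep_l2 F))" for F :: "'a l2"
  have T: "T (abs_l2 f) = abs_l2 (fourier_integral f)" if "is_gauss f" for f
    by (simp add: T_def fourier_integral_rep_abs is_gauss_sq_integrable[OF that])
  have ip: "T F \<bullet> T G = F \<bullet> G" if FG: "F \<in> gauss_classes" "G \<in> gauss_classes" for F G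
  proof -
    obtain f g where fg: "is_gauss f" "is_gauss g" "F = abs_l2 f" "G = abs_l2 g"
      using FG by (auto simp: gauss_classes_eq)
    show ?thesis
      unfolding fg(3,4) T[OF fg(1)] T[OF fg(2)]
      using fourier_parseval_gauss[OF is_gauss_integrable[OF fg(1)] fg(2)] fg(1,2)
      by (simp add: inner_abs_l2 is_gauss_sq_integrable is_gauss_fourier)
  qed
  obtain U where U: "bounded_linear U" "\<And>F G. U F \<bullet> U G = F \<bullet> G" "\<And>F. F \<in> gauss_classes \<Longrightarrow> U F = T F"
    using isometry_extension[OF ip closure_span_gauss_classes] by blast
  have Ug: "U (abs_l2 k) = abs_l2 (fourier_integral k)" if "is_gauss k" for k
    using U(3)[of "abs_l2 k"] T[OF that] that by (auto simp: gauss_classes_eq)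
  have "sq_integrable (fourier_integral f) \<and> U (abs_l2 f) = abs_l2 (fourier_integral f)"
    if f: "integrable lborel f" "sq_integrable f" for f
  proof -
    have [measurable]: "f \<in> borel_measurable borel" using f by (simp add: integrable_iff_bounded)
    define g where "g = rep_l2 (U (abs_l2 f))"
    have g: "sq_integrable g" "abs_l2 g = U (abs_l2 f)" by (simp_all add: g_def)
    note [measurable] = sq_integrable_borel[OF g(1)]
    define D where "D x = fourier_integral f x - g x" for x
    have [measurable]: "D \<in> borel_measurable borel" unfolding D_def by measurable
    \<comment> \<open>So far \<open>fourier_integral f\<close> is only known to be bounded; the weight makes it square integrable.\<close>
    let ?w = "\<lambda>x::'a. 1 * gauss 1 0 0 x"
    have wg: "is_gauss ?w" unfolding is_gauss_def by (intro exI[of _ 1] exI[of _ 0]) auto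
    have wm: "multiplier ?w"
      by (rule multiplierI[of _ 1]) (auto simp: norm_gauss)
    have s1: "sq_integrable (\<lambda>x. ?w x * fourier_integral f x)"
    proof (rule sq_integrable_bound[OF is_gauss_sq_integrable[OF wg]])
      show "AE x in lborel. norm (?w x * fourier_integral f x) \<le> (LINT x|lborel. norm (f x)) * norm (?w x)"
        by (auto simp: norm_mult mult.commute intro!: mult_right_mono norm_fourier_integral_le)
    qed measurable
    have s2: "sq_integrable (\<lambda>x. ?w x * g x)" by (rule sq_integrable_mult[OF wm g(1)])
    have sD: "sq_integrable (\<lambda>x. ?w x * D x)"
      using sq_integrable_diff[OF s1 s2] by (simp add: D_def right_diff_distrib)
    have "abs_l2 (\<lambda>x. ?w x * D x) = 0"
    proof (rule orthogonal_gauss_zero)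
      fix k :: "'a \<Rightarrow> complex" assume k: "is_gauss k"
      have wk: "is_gauss (\<lambda>x. ?w x * k x)"
      proof -
        obtain c t u v where "0 < t" "k = (\<lambda>x. c * gauss t u v x)" using k by (auto simp: is_gauss_def)
        then show ?thesis unfolding is_gauss_def
          by (intro exI[of _ c] exI[of _ "1 + t"] exI[of _ u] exI[of _ v])
            (auto simp: fun_eq_iff gauss_mult[of 1 0 0 _ t u v, simplified, symmetric])
      qed
      then obtain h where h: "is_gauss h" "fourier_integral h = (\<lambda>x. ?w x * k x)"
        by (rule gauss_surj_fourier)
      have "(LINT x|lborel. g x \<bullet> fourier_integral h x) = U (abs_l2 f) \<bullet> U (abs_l2 h)"
        unfolding Ug[OF h(1)] g(2)[symmetric]
        by (rule inner_abs_l2[OF g(1) is_gauss_sq_integrable[OF is_gauss_fourier[OF h(1)]], symmetric])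
      also have "\<dots> = (LINT x|lborel. f x \<bullet> h x)"
        unfolding U(2) by (rule inner_abs_l2[OF f(2) is_gauss_sq_integrable[OF h(1)]])
      also have "\<dots> = (LINT x|lborel. fourier_integral f x \<bullet> fourier_integral h x)"
        by (rule fourier_parseval_gauss[OF f(1) h(1), symmetric])
      finally have e: "(LINT x|lborel. g x \<bullet> fourier_integral h x) = \<dots>" .
      have mv: "(?w x * z) \<bullet> k x = z \<bullet> fourier_integral h x" for x z
        unfolding h(2) by (simp add: inner_complex_eq gauss_def exp_cnj mult_ac flip: exp_of_real)
      have "abs_l2 (\<lambda>x. ?w x * D x) \<bullet> abs_l2 k = (LINT x|lborel. (?w x * D x) \<bullet> k x)"
        by (rule inner_abs_l2[OF sD is_gauss_sq_integrable[OF k]])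
      also have "\<dots> = (LINT x|lborel. (?w x * fourier_integral f x) \<bullet> k x - (?w x * g x) \<bullet> k x)"
        by (simp add: D_def right_diff_distrib inner_diff_left)
      also have "\<dots> = (LINT x|lborel. (?w x * fourier_integral f x) \<bullet> k x) - (LINT x|lborel. (?w x * g x) \<bullet> k x)"
        by (rule Bochner_Integration.integral_diff)
          (intro sq_integrable_inner s1 s2 is_gauss_sq_integrable[OF k])+
      also have "\<dots> = 0" unfolding mv e by simp
      finally show "abs_l2 (\<lambda>x. ?w x * D x) \<bullet> abs_l2 k = 0" .
    qed
    then have "AE x in lborel. ?w x * D x = 0"
      using abs_l2_eqD[OF sD sq_integrable_zero] abs_l2_zero[where 'a='a] by simp
    then have ae: "AE x in lborel. g x = fourier_integral f x"
      by eventually_elim (simp add: gauss_def D_def)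
    have "sq_integrable (fourier_integral f)"
      by (rule sq_integrable_bound[OF g(1), of _ 1]) (use ae in auto)
    moreover from this have "U (abs_l2 f) = abs_l2 (fourier_integral f)"
      unfolding g(2)[symmetric] by (intro abs_l2_eqI g(1) ae)
    ultimately show ?thesis by blast
  qed
  then show ?thesis using U by blast
qed

definition fourier_l2 :: "'a::euclidean_space l2 \<Rightarrow> 'a l2" where
  "fourier_l2 = l2_extension fourier_integral"

lemma fourier_l2_props:
  shows bounded_linear_fourier_l2: "bounded_linear (fourier_l2 :: 'a::euclidean_space l2 \<Rightarrow> 'a l2)"
    and inner_fourier_l2: "fourier_l2 F \<bullet> fourier_l2 (G :: 'a l2) = F \<bullet> G"
    and sq_integrable_fourier: "integrable lborel f \<Longrightarrow> sq_integrable f \<Longrightarrow> sq_integrable (fourier_integral (f :: 'a \<Rightarrow> complex))"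
    and fourier_l2_abs: "integrable lborel f \<Longrightarrow> sq_integrable f \<Longrightarrow> fourier_l2 (abs_l2 (f :: 'a \<Rightarrow> complex)) = abs_l2 (fourier_integral f)"
proof -
  obtain U :: "'a l2 \<Rightarrow> 'a l2" where U: "bounded_linear U" "\<And>F G. U F \<bullet> U G = F \<bullet> G"
    "\<And>f. integrable lborel f \<Longrightarrow> sq_integrable f \<Longrightarrow>
       sq_integrable (fourier_integral f) \<and> U (abs_l2 f) = abs_l2 (fourier_integral f)"
    using fourier_isometry_exists by blast
  have eq: "fourier_l2 = U"
    unfolding fourier_l2_def by (rule l2_extension_eq[OF U(1)]) (use U(3) schwartz_integrable in blast)
  show "bounded_linear (fourier_l2 :: 'a l2 \<Rightarrow> 'a l2)" "fourier_l2 F \<bullet> fourier_l2 (G :: 'a l2) = F \<bullet> G"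
    "integrable lborel f \<Longrightarrow> sq_integrable f \<Longrightarrow> sq_integrable (fourier_integral (f :: 'a \<Rightarrow> complex))"
    "integrable lborel f \<Longrightarrow> sq_integrable f \<Longrightarrow> fourier_l2 (abs_l2 (f :: 'a \<Rightarrow> complex)) = abs_l2 (fourier_integral f)"
    using U by (simp_all add: eq)
qed

lemma norm_fourier_l2 [simp]: "norm (fourier_l2 F) = norm F"
  using inner_fourier_l2[of F F] by (simp add: norm_eq_sqrt_inner)

lemma lborel_distr_uminus_euclidean: "distr lborel borel uminus = (lborel :: 'a::euclidean_space measure)"
proof -
  have "(\<lambda>x::'a. 0 + (-1) *\<^sub>R x) = uminus" by auto
  then show ?thesis
    using lborel_affine[of "-1" "0::'a"] by (simp add: density_1 flip: one_ennreal_def)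
qed

lemma sq_integrable_uminus:
  assumes "sq_integrable f" shows "sq_integrable (\<lambda>x. f (- x))"
proof -
  note [measurable] = sq_integrable_borel[OF assms]
  have "integrable (distr lborel borel uminus) (\<lambda>x. (norm (f x))\<^sup>2)"
    using assms by (simp add: lborel_distr_uminus_euclidean sq_integrable_def)
  then have "integrable lborel (\<lambda>x. (norm (f (- x)))\<^sup>2)"
    by (subst (asm) integrable_distr_eq) auto
  then show ?thesis by (simp add: sq_integrable_def)
qed

lemma AE_uminus:
  assumes "AE x in lborel. P (x::'a::euclidean_space)" "Measurable.pred borel P"
  shows "AE x in lborel. P (- x)"
proof -
  have "AE x in distr lborel borel uminus. P x"
    unfolding lborel_distr_uminus_euclidean by (rule assms(1))
  then show ?thesis using AE_distr_iff[of uminus lborel borel P] assms(2) by (simp add: pred_def)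
qed

definition reflect :: "'a::euclidean_space l2 \<Rightarrow> 'a l2" where
  "reflect F = abs_l2 (\<lambda>x. rep_l2 F (- x))"

lemma reflect_abs:
  assumes "sq_integrable f"
  shows "reflect (abs_l2 f) = abs_l2 (\<lambda>x. f (- x))"
proof -
  note [measurable] = sq_integrable_borel[OF assms]
  show ?thesis unfolding reflect_def
    by (intro abs_l2_eqI sq_integrable_uminus assms sq_integrable_rep AE_uminus AE_rep_abs) measurable
qed

lemma norm_reflect: "norm (reflect F) = norm F"
proof -
  have "(norm (reflect F))\<^sup>2 = (LINT x|lborel. (norm (rep_l2 F (- x)))\<^sup>2)"
    by (simp add: reflect_def norm_abs_l2_sq sq_integrable_uminus)
  also have "\<dots> = (LINT x|distr lborel borel uminus. (norm (rep_l2 F x))\<^sup>2)"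
    by (subst integral_distr) auto
  also have "\<dots> = (norm F)\<^sup>2" by (simp add: lborel_distr_uminus_euclidean norm_l2_sq)
  finally show ?thesis by simp
qed

lemma bounded_linear_reflect: "bounded_linear reflect"
proof (rule bounded_linear_intro[of _ 1])
  fix F G :: "'a l2" and c :: real
  have "reflect (abs_l2 (rep_l2 F) + abs_l2 (rep_l2 G)) = reflect (abs_l2 (rep_l2 F)) + reflect (abs_l2 (rep_l2 G))"
    by (simp add: reflect_abs sq_integrable_add sq_integrable_uminus del: abs_rep_l2 flip: abs_l2_add)
  then show "reflect (F + G) = reflect F + reflect G" by simp
  have "reflect (c *\<^sub>R abs_l2 (rep_l2 F)) = c *\<^sub>R reflect (abs_l2 (rep_l2 F))"
    by (simp add: reflect_abs sq_integrable_scaleR sq_integrable_uminus del: abs_rep_l2 flip: abs_l2_scaleR)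
  then show "reflect (c *\<^sub>R F) = c *\<^sub>R reflect F" by simp
  show "norm (reflect F) \<le> norm F * 1" by (simp add: norm_reflect)
qed

lemma reflect_reflect [simp]: "reflect (reflect F) = F"
proof -
  have "reflect (reflect (abs_l2 (rep_l2 F))) = abs_l2 (rep_l2 F)"
    by (simp add: reflect_abs sq_integrable_uminus del: abs_rep_l2)
  then show ?thesis by simp
qed

lemma eq_on_gauss:
  assumes "bounded_linear U" "bounded_linear V" "\<And>f. is_gauss f \<Longrightarrow> U (abs_l2 f) = V (abs_l2 f)"
  shows "U = V"
  by (rule bounded_linear_eq_on_dense_span[OF assms(1,2) _ closure_span_gauss_classes])
    (use assms(3) in \<open>auto simp: gauss_classes_eq\<close>)

lemma fourier_l2_gauss: "is_gauss f \<Longrightarrow> fourier_l2 (abs_l2 f) = abs_l2 (fourier_integral f)"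
  by (simp add: fourier_l2_abs is_gauss_integrable is_gauss_sq_integrable)

lemma fourier_fourier_l2:
  fixes F :: "'a::euclidean_space l2"
  shows "fourier_l2 (fourier_l2 F) = reflect F"
proof -
  have "(\<lambda>F::'a l2. fourier_l2 (fourier_l2 F)) = reflect"
  proof (rule eq_on_gauss)
    fix f :: "'a \<Rightarrow> complex" assume f: "is_gauss f"
    show "fourier_l2 (fourier_l2 (abs_l2 f)) = reflect (abs_l2 f)"
      by (simp add: fourier_l2_gauss f is_gauss_fourier reflect_abs is_gauss_sq_integrable
          fourier_fourier_gauss[OF f, abs_def])
  qed (intro bounded_linear_compose[OF bounded_linear_fourier_l2] bounded_linear_fourier_l2 bounded_linear_reflect)+
  then show ?thesis by (rule fun_cong)
qed

lemma reflect_fourier_l2: "reflect (fourier_l2 F) = fourier_l2 (reflect F)"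
  by (simp flip: fourier_fourier_l2)

definition inv_fourier_l2 :: "'a::euclidean_space l2 \<Rightarrow> 'a l2" where
  "inv_fourier_l2 F = fourier_l2 (reflect F)"

lemma inv_fourier_fourier [simp]: "inv_fourier_l2 (fourier_l2 F) = F"
  by (simp add: inv_fourier_l2_def reflect_fourier_l2 fourier_fourier_l2)

lemma fourier_inv_fourier [simp]: "fourier_l2 (inv_fourier_l2 F) = F"
  by (simp add: inv_fourier_l2_def fourier_fourier_l2)

lemma bounded_linear_inv_fourier_l2: "bounded_linear inv_fourier_l2"
  unfolding inv_fourier_l2_def[abs_def]
  by (rule bounded_linear_compose[OF bounded_linear_fourier_l2 bounded_linear_reflect])

section \<open>Linear changes of variables\<close>

lemma matrix_inv_both:
  fixes A :: "'a::semiring_1 ^ 'n ^ 'm"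
  assumes "invertible A"
  shows matrix_inv_right: "A ** matrix_inv A = mat 1" and matrix_inv_left: "matrix_inv A ** A = mat 1"
proof -
  have "\<exists>A'. A ** A' = mat 1 \<and> A' ** A = mat 1" using assms by (simp add: invertible_def)
  from someI_ex[OF this] show "A ** matrix_inv A = mat 1" "matrix_inv A ** A = mat 1"
    by (simp_all add: matrix_inv_def)
qed

lemma matrix_vector_measurable [measurable]:
  fixes E :: "real ^ 'n ^ 'm" shows "(\<lambda>x. E *v x) \<in> borel_measurable borel"
  by (intro borel_measurable_continuous_onI linear_continuous_on) (simp add: matrix_vector_mul_bounded_linear)

text \<open>
  By Fubini, integrating first over the coordinate that is sheared: with the others fixed the shear is a
  translation.
\<close>

lemma nn_integral_shear:
  fixes g :: "'a::euclidean_space \<Rightarrow> ennreal"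
  assumes m: "m \<in> Basis" and p: "p \<bullet> m = 0" and [measurable]: "g \<in> borel_measurable borel"
  shows "(\<integral>\<^sup>+x. g (x + (x \<bullet> p) *\<^sub>R m) \<partial>lborel) = (\<integral>\<^sup>+x. g x \<partial>lborel)"
proof -
  interpret product_sigma_finite "\<lambda>b. lborel :: real measure" ..
  define I where "I = (Basis :: 'a set) - {m}"
  have I: "finite I" "m \<notin> I" "insert m I = Basis" using m by (auto simp: I_def)
  define s where "s f = (\<Sum>b\<in>Basis. f b *\<^sub>R b)" for f :: "'a \<Rightarrow> real"
  define w where "w f = (\<Sum>b\<in>I. f b *\<^sub>R b)" for f :: "'a \<Rightarrow> real"
  have s_upd: "s (f(m := y)) = y *\<^sub>R m + w f" for f y
    unfolding s_def w_def I(3)[symmetric] using I(1,2)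
    by (simp add: sum.insert) (intro sum.cong, auto)
  have sm [measurable]: "s \<in> (\<Pi>\<^sub>M b\<in>Basis. lborel) \<rightarrow>\<^sub>M borel"
    unfolding s_def by measurable
  have expand: "(\<integral>\<^sup>+x. h x \<partial>lborel) = (\<integral>\<^sup>+f. (\<integral>\<^sup>+y. h (y *\<^sub>R m + w f) \<partial>lborel) \<partial>(\<Pi>\<^sub>M b\<in>I. lborel))"
    if [measurable]: "h \<in> borel_measurable borel" for h :: "'a \<Rightarrow> ennreal"
  proof -
    have "(\<integral>\<^sup>+x. h x \<partial>lborel) = (\<integral>\<^sup>+f. h (s f) \<partial>(\<Pi>\<^sub>M b\<in>insert m I. lborel))"
      unfolding lborel_eq[where 'a='a] I(3) by (subst nn_integral_distr) (auto simp: s_def[symmetric])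
    also have "\<dots> = (\<integral>\<^sup>+f. (\<integral>\<^sup>+y. h (s (f(m := y))) \<partial>lborel) \<partial>(\<Pi>\<^sub>M b\<in>I. lborel))"
      by (rule product_nn_integral_insert[OF I(1,2)]) (unfold I(3), measurable)
    finally show ?thesis by (simp add: s_upd)
  qed
  have "(\<integral>\<^sup>+x. g (x + (x \<bullet> p) *\<^sub>R m) \<partial>lborel)
      = (\<integral>\<^sup>+f. (\<integral>\<^sup>+y. g ((w f \<bullet> p + y) *\<^sub>R m + w f) \<partial>lborel) \<partial>(\<Pi>\<^sub>M b\<in>I. lborel))"
    using p by (subst expand) (simp_all add: inner_add_left inner_commute[of m p] algebra_simps)
  also have "(\<lambda>f. \<integral>\<^sup>+y. g ((w f \<bullet> p + y) *\<^sub>R m + w f) \<partial>lborel) = (\<lambda>f. \<integral>\<^sup>+y. g (y *\<^sub>R m + w f) \<partial>lborel)"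
  proof
    fix f
    have "(\<integral>\<^sup>+y. g (y *\<^sub>R m + w f) \<partial>lborel) = (\<integral>\<^sup>+y. g (y *\<^sub>R m + w f) \<partial>distr lborel borel ((+) (w f \<bullet> p)))"
      by (simp add: lborel_distr_plus)
    also have "\<dots> = (\<integral>\<^sup>+y. g ((w f \<bullet> p + y) *\<^sub>R m + w f) \<partial>lborel)"
      by (subst nn_integral_distr) auto
    finally show "(\<integral>\<^sup>+y. g ((w f \<bullet> p + y) *\<^sub>R m + w f) \<partial>lborel) = (\<integral>\<^sup>+y. g (y *\<^sub>R m + w f) \<partial>lborel)" ..
  qed
  also have "(\<integral>\<^sup>+f. (\<integral>\<^sup>+y. g (y *\<^sub>R m + w f) \<partial>lborel) \<partial>(\<Pi>\<^sub>M b\<in>I. lborel)) = (\<integral>\<^sup>+x. g x \<partial>lborel)"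
    by (rule expand[symmetric]) measurable
  finally show ?thesis .
qed

lemma prod_Basis_vec: "(\<Prod>b\<in>(Basis :: (real ^ 'n) set). g b) = (\<Prod>j\<in>UNIV. g (axis j 1))"
proof -
  have B: "(Basis :: (real ^ 'n) set) = (\<lambda>j. axis j 1) ` UNIV"
    by (auto simp: Basis_vec_def)
  show ?thesis
    unfolding B by (subst prod.reindex) (auto simp: inj_on_def axis_eq_axis)
qed

lemma lborel_swap:
  fixes m n :: "'n::finite"
  shows "distr lborel borel (\<lambda>x :: real ^ 'n. \<chi> i. x $ Transposition.transpose m n i) = lborel"
proof (rule lborel_eqI[symmetric])
  fix l u :: "real ^ 'n" assume lu: "\<And>b. b \<in> Basis \<Longrightarrow> l \<bullet> b \<le> u \<bullet> b"
  let ?t = "Transposition.transpose m n"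
  let ?s = "\<lambda>x :: real ^ 'n. \<chi> i. x $ ?t i"
  have [measurable]: "?s \<in> borel_measurable borel"
    by (intro borel_measurable_continuous_onI continuous_intros)
  have lu': "l $ i \<le> u $ i" for i
    using lu[of "axis i 1"] by (simp add: inner_axis axis_in_Basis_iff)
  have "?s -` box l u = box (?s l) (?s u)"
    by (auto simp: mem_box_cart) (metis transpose_involutory)+
  then have "emeasure (distr lborel borel ?s) (box l u) = emeasure lborel (box (?s l) (?s u))"
    by (simp add: emeasure_distr)
  also have "\<dots> = (\<Prod>b\<in>Basis. (?s u - ?s l) \<bullet> b)"
    by (rule emeasure_lborel_box) (auto simp: Basis_vec_def inner_axis lu')
  also have "(\<Prod>b\<in>Basis. (?s u - ?s l) \<bullet> b) = (\<Prod>i\<in>UNIV. (u - l) $ ?t i)"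
    by (simp add: prod_Basis_vec inner_axis)
  also have "\<dots> = (\<Prod>i\<in>UNIV. (u - l) $ i)"
    by (rule prod.reindex_bij_betw) simp
  also have "\<dots> = (\<Prod>b\<in>Basis. (u - l) \<bullet> b)"
    by (simp add: prod_Basis_vec inner_axis)
  finally show "emeasure (distr lborel borel ?s) (box l u) = (\<Prod>b\<in>Basis. (u - l) \<bullet> b)" .
qed simp

text \<open>
  Both sides are multiplicative in the matrix, so elementary matrices suffice.  A diagonal matrix rescales
  the coordinates; transpositions and shears have determinant \<open>1\<close> in absolute value and preserve the
  measure.
\<close>

lemma nn_integral_linear:
  fixes E :: "real ^ 'n ^ 'n" and g :: "real ^ 'n \<Rightarrow> ennreal"
  assumes "det E \<noteq> 0" "g \<in> borel_measurable borel"
  shows "(\<integral>\<^sup>+x. g x \<partial>lborel) = ennreal \<bar>det E\<bar> * (\<integral>\<^sup>+x. g (E *v x) \<partial>lborel)"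
  using assms
proof (induction E arbitrary: g rule: induct_matrix_elementary[case_names mult zero_row diagonal swap1 idplus])
  case (mult A B)
  note [measurable] = mult.prems(2)
  have "(\<integral>\<^sup>+x. g x \<partial>lborel) = ennreal \<bar>det A\<bar> * (\<integral>\<^sup>+x. g (A *v x) \<partial>lborel)"
    using mult.prems by (intro mult.IH) (auto simp: det_mul)
  also have "(\<integral>\<^sup>+x. g (A *v x) \<partial>lborel) = ennreal \<bar>det B\<bar> * (\<integral>\<^sup>+x. g (A *v (B *v x)) \<partial>lborel)"
    using mult.prems by (intro mult.IH) (auto simp: det_mul)
  finally show ?case
    by (simp add: det_mul abs_mult ennreal_mult matrix_vector_mul_assoc mult.assoc)
next
  case (zero_row A i)
  then show ?case by (simp add: det_zero_row)
next
  case (diagonal A)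
  note [measurable] = diagonal.prems(2)
  define c where "c b = b \<bullet> (A *v b)" for b
  have cA: "c (axis i 1) = A $ i $ i" for i
    by (simp add: c_def inner_axis' matrix_vector_mult_basis column_def)
  have det: "det A = (\<Prod>b\<in>Basis. c b)"
    using det_diagonal[of A] diagonal.hyps by (simp add: prod_Basis_vec cA)
  have c: "c b \<noteq> 0" if "b \<in> Basis" for b
    using diagonal.prems(1) that unfolding det by (auto simp: prod_zero_iff)
  have eq: "0 + (\<Sum>b\<in>Basis. (c b * (x \<bullet> b)) *\<^sub>R b) = A *v x" for x
  proof -
    have "(A *v x) $ i = A $ i $ i * x $ i" for i
      unfolding matrix_vector_mult_def using diagonal.hyps[of i]
      by (simp add: sum.remove[of UNIV i])
    then have "(A *v x) \<bullet> b = c b * (x \<bullet> b)" if "b \<in> Basis" for b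
      using that by (auto simp: Basis_vec_def inner_axis cA)
    then show ?thesis using euclidean_representation[of "A *v x"] by simp
  qed
  have "lborel = density (distr lborel borel (\<lambda>x. A *v x)) (\<lambda>_. (\<Prod>b\<in>Basis. \<bar>c b\<bar>))"
    using lborel_affine_euclidean[of c 0, OF c] unfolding eq .
  then have "(\<integral>\<^sup>+x. g x \<partial>lborel) = (\<integral>\<^sup>+x. g x \<partial>density (distr lborel borel (\<lambda>x. A *v x)) (\<lambda>_. ennreal (\<Prod>b\<in>Basis. \<bar>c b\<bar>)))"
    by (rule arg_cong)
  also have "\<dots> = ennreal \<bar>det A\<bar> * (\<integral>\<^sup>+x. g (A *v x) \<partial>lborel)"
    by (simp add: nn_integral_density nn_integral_distr nn_integral_cmult det abs_prod)
  finally show ?case .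
next
  case (swap1 m n)
  note [measurable] = swap1.prems(2)
  let ?A = "\<chi> i j. (mat 1 :: real ^ 'n ^ 'n) $ i $ Transposition.transpose m n j"
  have "\<bar>det ?A\<bar> = 1"
    by (subst det_permute_columns) (auto simp: permutes_swap_id abs_mult sign_def)
  moreover have "?A *v x = (\<chi> i. x $ Transposition.transpose m n i)" for x
  proof -
    have "(?A *v x) $ i = (\<Sum>j\<in>UNIV. if j = Transposition.transpose m n i then x $ j else 0)" for i
    proof -
      have "(?A *v x) $ i = (\<Sum>j\<in>UNIV. ?A $ i $ j * x $ j)"
        by (simp add: matrix_vector_mult_def)
      also have "\<dots> = (\<Sum>j\<in>UNIV. if j = Transposition.transpose m n i then x $ j else 0)"
      proof (intro sum.cong refl)
        fix j
        have "i = Transposition.transpose m n j \<longleftrightarrow> j = Transposition.transpose m n i"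
          by (metis transpose_involutory)
        then show "?A $ i $ j * x $ j = (if j = Transposition.transpose m n i then x $ j else 0)"
          by (simp add: mat_def)
      qed
      finally show ?thesis .
    qed
    then show ?thesis by (simp add: vec_eq_iff)
  qed
  moreover have "(\<integral>\<^sup>+x. g x \<partial>lborel) = (\<integral>\<^sup>+x. g x \<partial>distr lborel borel (\<lambda>x. \<chi> i. x $ Transposition.transpose m n i))"
    by (simp only: lborel_swap)
  moreover have "(\<lambda>x :: real ^ 'n. \<chi> i. x $ Transposition.transpose m n i) \<in> borel_measurable borel"
    by (intro borel_measurable_continuous_onI continuous_intros)
  ultimately show ?case by (simp add: nn_integral_distr)
next
  case (idplus m n c)
  note [measurable] = idplus.prems(2)
  let ?A = "\<chi> i j. if i = m \<and> j = n then c else of_bool (i = j) :: real ^ 'n ^ 'n"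
  have "?A = (\<chi> k. if k = m then row m (mat 1) + c *s row n (mat 1) else row k (mat 1))"
    using idplus.hyps by (auto simp: vec_eq_iff row_def mat_def)
  then have det: "det ?A = 1" using det_row_operation[OF idplus.hyps, of "mat 1" c] by simp
  have Ax: "?A *v x = x + (x \<bullet> (c *\<^sub>R axis n 1)) *\<^sub>R axis m 1" for x
  proof -
    have "(?A *v x) $ i = x $ i + (if i = m then c * x $ n else 0)" for i
    proof -
      have "(?A *v x) $ i = (\<Sum>j\<in>UNIV. (if j = i then x $ j else 0) + (if i = m then (if j = n then c * x $ j else 0) else 0))"
      proof -
        have "(?A *v x) $ i = (\<Sum>j\<in>UNIV. ?A $ i $ j * x $ j)"
          by (simp add: matrix_vector_mult_def)
        also have "\<dots> = (\<Sum>j\<in>UNIV. (if j = i then x $ j else 0) + (if i = m then (if j = n then c * x $ j else 0) else 0))"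
          using idplus.hyps by (intro sum.cong refl) auto
        finally show ?thesis .
      qed
      then show ?thesis by (simp add: sum.distrib)
    qed
    moreover have "x \<bullet> axis n 1 = x $ n" by (simp add: inner_axis)
    ultimately show ?thesis by (simp add: vec_eq_iff axis_def[of m])
  qed
  have "(\<integral>\<^sup>+x. g (?A *v x) \<partial>lborel) = (\<integral>\<^sup>+x. g x \<partial>lborel)"
    unfolding Ax by (rule nn_integral_shear)
      (use idplus.hyps in \<open>auto simp: axis_in_Basis_iff inner_axis_axis\<close>)
  then show ?case by (simp add: det)
qed

lemma lborel_linear:
  fixes E :: "real ^ 'n ^ 'n"
  assumes E: "invertible E"
  shows "lborel = density (distr lborel borel (\<lambda>x. E *v x)) (\<lambda>_. ennreal \<bar>det E\<bar>)"
proof (rule measure_eqI)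
  fix A :: "(real ^ 'n) set" assume "A \<in> sets lborel"
  then have [measurable]: "A \<in> sets borel" by simp
  have "emeasure lborel A = (\<integral>\<^sup>+x. indicator A x \<partial>lborel)" by simp
  also have "\<dots> = ennreal \<bar>det E\<bar> * (\<integral>\<^sup>+x. indicator A (E *v x) \<partial>lborel)"
    by (rule nn_integral_linear) (use E in \<open>auto simp: invertible_det_nz\<close>)
  also have "(\<integral>\<^sup>+x. indicator A (E *v x) \<partial>lborel) = (\<integral>\<^sup>+x. indicator A x \<partial>distr lborel borel (\<lambda>x. E *v x))"
    by (subst nn_integral_distr) auto
  also have "ennreal \<bar>det E\<bar> * (\<integral>\<^sup>+x. indicator A x \<partial>distr lborel borel (\<lambda>x. E *v x))
      = emeasure (density (distr lborel borel (\<lambda>x. E *v x)) (\<lambda>_. ennreal \<bar>det E\<bar>)) A"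
    by (simp add: emeasure_density nn_integral_cmult)
  finally show "emeasure lborel A = emeasure (density (distr lborel borel (\<lambda>x. E *v x)) (\<lambda>_. ennreal \<bar>det E\<bar>)) A" .
qed simp

lemma AE_linear:
  fixes E :: "real ^ 'n ^ 'n"
  assumes E: "invertible E" and P: "AE x in lborel. P x" "Measurable.pred borel P"
  shows "AE x in lborel. P (E *v x)"
proof -
  have "0 < \<bar>det E\<bar>" using E by (simp add: invertible_det_nz)
  have "AE x in density (distr lborel borel (\<lambda>x. E *v x)) (\<lambda>_. ennreal \<bar>det E\<bar>). P x"
    unfolding lborel_linear[OF E, symmetric] by (rule P(1))
  then have "AE x in distr lborel borel (\<lambda>x. E *v x). P x"
    using \<open>0 < \<bar>det E\<bar>\<close> by (subst (asm) AE_density) auto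
  then show ?thesis
    using AE_distr_iff[of "\<lambda>x. E *v x" lborel borel P] P(2) by (simp add: pred_def)
qed

lemma integral_linear_image:
  fixes E :: "real ^ 'n ^ 'n" and g :: "real ^ 'n \<Rightarrow> real"
  assumes E: "invertible E" and [measurable]: "g \<in> borel_measurable borel"
  shows "integrable lborel g \<longleftrightarrow> integrable lborel (\<lambda>x. g (E *v x))"
    and "(LINT x|lborel. g x) = \<bar>det E\<bar> * (LINT x|lborel. g (E *v x))"
proof -
  have nz: "det E \<noteq> 0" using E by (simp add: invertible_det_nz)
  have "integrable lborel g \<longleftrightarrow>
      integrable (density (distr lborel borel (\<lambda>x. E *v x)) (\<lambda>_. ennreal \<bar>det E\<bar>)) g"
    using lborel_linear[OF E] by simp
  also have "\<dots> \<longleftrightarrow> integrable (distr lborel borel (\<lambda>x. E *v x)) (\<lambda>x. \<bar>det E\<bar> * g x)"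
    by (subst integrable_density) auto
  also have "\<dots> \<longleftrightarrow> integrable lborel (\<lambda>x. g (E *v x))"
    using nz by (subst integrable_distr_eq) auto
  finally show "integrable lborel g \<longleftrightarrow> integrable lborel (\<lambda>x. g (E *v x))" .
  have "(LINT x|lborel. g x) =
      (LINT x|density (distr lborel borel (\<lambda>x. E *v x)) (\<lambda>_. ennreal \<bar>det E\<bar>). g x)"
    using lborel_linear[OF E] by simp
  also have "\<dots> = (LINT x|distr lborel borel (\<lambda>x. E *v x). \<bar>det E\<bar> * g x)"
    by (subst integral_density) auto
  also have "\<dots> = \<bar>det E\<bar> * (LINT x|lborel. g (E *v x))"
    by (subst integral_distr) auto
  finally show "(LINT x|lborel. g x) = \<bar>det E\<bar> * (LINT x|lborel. g (E *v x))" .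
qed

lemma norm_i_powi [simp]: "norm (\<i> powi m) = 1"
  by (simp add: norm_power_int)

lemma sq_integrable_linear:
  fixes E :: "real ^ 'n ^ 'n"
  assumes E: "invertible E" and f: "sq_integrable f"
  shows "sq_integrable (\<lambda>x. c * f (E *v x))"
proof -
  note [measurable] = sq_integrable_borel[OF f]
  have "sq_integrable (\<lambda>x. f (E *v x))"
    using f integral_linear_image(1)[OF E, of "\<lambda>x. (norm (f x))\<^sup>2"] by (simp add: sq_integrable_def)
  then show ?thesis using sq_integrable_mult[OF multiplier_const] by blast
qed

lemma T_op_abs:
  fixes E :: "real ^ 'n ^ 'n"
  assumes E: "invertible E" and f: "sq_integrable f"
  shows "T_op m E (abs_l2 f) = abs_l2 (\<lambda>x. \<i> powi m * of_real (sqrt \<bar>det E\<bar>) * f (E *v x))"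
  unfolding T_op_def
proof (rule abs_l2_eqI)
  note [measurable] = sq_integrable_borel[OF f]
  have "AE x in lborel. rep_l2 (abs_l2 f) (E *v x) = f (E *v x)"
    by (rule AE_linear[OF E AE_rep_abs[OF f]]) measurable
  then show "AE x in lborel. \<i> powi m * of_real (sqrt \<bar>det E\<bar>) * rep_l2 (abs_l2 f) (E *v x)
      = \<i> powi m * of_real (sqrt \<bar>det E\<bar>) * f (E *v x)"
    by eventually_elim simp
qed (intro sq_integrable_linear E f sq_integrable_rep)+

lemma norm_T_op:
  fixes E :: "real ^ 'n ^ 'n"
  assumes E: "invertible E"
  shows "norm (T_op m E F) = norm F"
proof -
  have "(norm (T_op m E F))\<^sup>2 = (LINT x|lborel. \<bar>det E\<bar> * (norm (rep_l2 F (E *v x)))\<^sup>2)"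
    unfolding T_op_def
    by (subst norm_abs_l2_sq[OF sq_integrable_linear[OF E sq_integrable_rep]])
      (simp add: norm_mult power_mult_distrib)
  also have "\<dots> = (norm F)\<^sup>2"
    by (simp add: norm_l2_sq integral_linear_image(2)[OF E, of "\<lambda>x. (norm (rep_l2 F x))\<^sup>2"])
  finally show ?thesis by simp
qed

lemma bounded_linear_T_op:
  fixes E :: "real ^ 'n ^ 'n"
  assumes E: "invertible E"
  shows "bounded_linear (T_op m E)"
proof (rule bounded_linear_intro[of _ 1])
  fix F G :: "(real ^ 'n) l2" and c :: real
  have "T_op m E (abs_l2 (rep_l2 F) + abs_l2 (rep_l2 G)) = T_op m E (abs_l2 (rep_l2 F)) + T_op m E (abs_l2 (rep_l2 G))"
    by (simp add: T_op_abs E sq_integrable_add sq_integrable_linear distrib_left del: abs_rep_l2 flip: abs_l2_add)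
  then show "T_op m E (F + G) = T_op m E F + T_op m E G" by simp
  have "T_op m E (c *\<^sub>R abs_l2 (rep_l2 F)) = c *\<^sub>R T_op m E (abs_l2 (rep_l2 F))"
    by (simp add: T_op_abs E sq_integrable_scaleR sq_integrable_linear del: abs_rep_l2 flip: abs_l2_scaleR)
  then show "T_op m E (c *\<^sub>R F) = c *\<^sub>R T_op m E F" by simp
  show "norm (T_op m E F) \<le> norm F * 1" by (simp add: norm_T_op[OF E])
qed

lemma T_op_T_op:
  fixes E E' :: "real ^ 'n ^ 'n"
  assumes E: "invertible E" and E': "invertible E'"
  shows "T_op m E (T_op m' E' F) = T_op (m + m') (E' ** E) F"
proof -
  have "T_op m E (T_op m' E' (abs_l2 (rep_l2 F))) = T_op (m + m') (E' ** E) (abs_l2 (rep_l2 F))"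
    unfolding T_op_abs[OF E' sq_integrable_rep] T_op_abs[OF E sq_integrable_linear[OF E' sq_integrable_rep]]
      T_op_abs[OF invertible_mult[OF E' E] sq_integrable_rep]
    by (simp add: power_int_add matrix_vector_mul_assoc det_mul abs_mult real_sqrt_mult mult_ac)
  then show ?thesis by simp
qed

lemma T_op_mult_op:
  fixes E :: "real ^ 'n ^ 'n"
  assumes E: "invertible E" and k: "multiplier k"
  shows "T_op m E (mult_op k F) = mult_op (\<lambda>x. k (E *v x)) (T_op m E F)"
proof -
  have k': "multiplier (\<lambda>x. k (E *v x))"
    using k by (auto simp: multiplier_def)
  have "T_op m E (mult_op k (abs_l2 (rep_l2 F))) = mult_op (\<lambda>x. k (E *v x)) (T_op m E (abs_l2 (rep_l2 F)))"
    unfolding mult_op_abs[OF k sq_integrable_rep] T_op_abs[OF E sq_integrable_mult[OF k sq_integrable_rep]]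
      T_op_abs[OF E sq_integrable_rep] mult_op_abs[OF k' sq_integrable_linear[OF E sq_integrable_rep]]
    by (simp add: mult_ac)
  then show ?thesis by simp
qed

lemma T_op_id: "T_op 0 (mat 1) = id"
  by (rule ext) (simp add: T_op_def)

section \<open>The generators\<close>

definition chirp :: "complex ^ 'n ^ 'n \<Rightarrow> real ^ 'n \<Rightarrow> complex" where
  "chirp Q x = exp (\<i> * of_real pi * cdot (Q *v cvec x) (cvec x))"

lemma p_op_eq: "p_op Q = mult_op (chirp Q)"
  by (rule ext) (simp add: p_op_def mult_op_def chirp_def)

lemma cdot_matrix: "cdot (Q *v z) w = (\<Sum>i\<in>UNIV. \<Sum>j\<in>UNIV. Q $ i $ j * z $ j * w $ i)"
  by (simp add: cdot_def matrix_vector_mult_def sum_distrib_right)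

lemma chirp_measurable [measurable]: "chirp Q \<in> borel_measurable borel"
  unfolding chirp_def cdot_matrix cvec_def by (intro borel_measurable_continuous_onI continuous_intros)

lemma Im_cdot: "Im (cdot (Q *v cvec x) (cvec x)) = x \<bullet> ((\<chi> i j. Im (Q $ i $ j)) *v x)"
  unfolding cdot_matrix by (simp add: cvec_def inner_vec_def matrix_vector_mult_def sum_distrib_left mult_ac)

lemma norm_chirp: "norm (chirp Q x) = exp (- pi * (x \<bullet> ((\<chi> i j. Im (Q $ i $ j)) *v x)))"
  by (simp add: chirp_def norm_exp_eq_Re Im_cdot)

lemma norm_chirp_le: "Q \<in> Sigma_ge0 \<Longrightarrow> norm (chirp Q x) \<le> 1"
  by (simp add: norm_chirp Sigma_ge0_def)

lemma multiplier_chirp: "Q \<in> Sigma_ge0 \<Longrightarrow> multiplier (chirp Q)"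
  by (rule multiplierI[of _ 1]) (auto intro: norm_chirp_le)

lemma chirp_add: "chirp (Q + Q') x = chirp Q x * chirp Q' x"
  by (simp add: chirp_def cdot_matrix mult_exp_exp distrib_left distrib_right sum.distrib)

lemma p_op_props:
  assumes "Q \<in> Sigma_ge0"
  shows "bounded_linear (p_op Q)" "norm (p_op Q F) \<le> norm F"
  using bounded_linear_mult_op[OF multiplier_chirp[OF assms]]
    norm_mult_op_le[of "chirp Q" 1 F] norm_chirp_le[OF assms]
  by (auto simp: p_op_eq)

lemma p_op_p_op:
  assumes "Q \<in> Sigma_ge0" "Q' \<in> Sigma_ge0"
  shows "p_op Q (p_op Q' F) = p_op (Q + Q') F"
  by (simp add: p_op_eq mult_op_mult_op multiplier_chirp assms chirp_add[abs_def])

lemma p_op_zero: "p_op 0 = id"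
  by (rule ext) (simp add: p_op_eq chirp_def[abs_def] cdot_matrix)

definition F_phase :: "nat \<Rightarrow> complex" where
  "F_phase n = \<i> powr (- of_nat n / 2)"

lemma norm_F_phase: "norm (F_phase n) = 1"
  by (simp add: F_phase_def powr_def norm_exp_eq_Re)

lemma F_phase_sq: "F_phase n * F_phase n = \<i> powi (- int n)"
proof -
  have "F_phase n * F_phase n = exp (- (of_nat n * Ln \<i>))"
    by (simp add: F_phase_def powr_def mult_exp_exp mult_ac)
  also have "\<dots> = inverse (exp (Ln \<i>) ^ n)"
    by (simp only: exp_minus exp_of_nat_mult)
  also have "\<dots> = inverse (\<i> ^ n)" by (subst exp_Ln) simp_all
  finally show ?thesis by (simp add: power_int_minus)
qed

lemma fourier_l2_cmult: "fourier_l2 (mult_op (\<lambda>x. c) F) = mult_op (\<lambda>x. c) (fourier_l2 (F :: 'a::euclidean_space l2))"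
proof -
  have "(\<lambda>F::'a l2. fourier_l2 (mult_op (\<lambda>x. c) F)) = (\<lambda>F. mult_op (\<lambda>x. c) (fourier_l2 F))"
  proof (rule eq_on_gauss)
    show "bounded_linear (\<lambda>F::'a l2. fourier_l2 (mult_op (\<lambda>x. c) F))"
      by (rule bounded_linear_compose[OF bounded_linear_fourier_l2 bounded_linear_mult_op]) simp
    show "bounded_linear (\<lambda>F::'a l2. mult_op (\<lambda>x. c) (fourier_l2 F))"
      by (rule bounded_linear_compose[OF bounded_linear_mult_op bounded_linear_fourier_l2]) simp
    fix f :: "'a \<Rightarrow> complex" assume f: "is_gauss f"
    have cf: "is_gauss (\<lambda>x. c * f x)"
      using f by (elim is_gaussE) (simp add: is_gaussI flip: mult.assoc)
    have "fourier_integral (\<lambda>x. c * f x) = (\<lambda>\<xi>. c * fourier_integral f \<xi>)"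
      by (simp add: fourier_integral_def mult.assoc fun_eq_iff)
    then show "fourier_l2 (mult_op (\<lambda>x. c) (abs_l2 f)) = mult_op (\<lambda>x. c) (fourier_l2 (abs_l2 f))"
      by (simp add: mult_op_abs is_gauss_sq_integrable is_gauss_fourier f cf fourier_l2_gauss)
  qed
  then show ?thesis by (rule fun_cong)
qed

lemma F_op_eq: "F_op = (\<lambda>F :: (real ^ 'n) l2. mult_op (\<lambda>x. F_phase CARD('n)) (fourier_l2 F))"
  unfolding F_op_def
proof (rule l2_extension_eq)
  show "bounded_linear (\<lambda>F :: (real ^ 'n) l2. mult_op (\<lambda>x. F_phase CARD('n)) (fourier_l2 F))"
    by (rule bounded_linear_compose[OF bounded_linear_mult_op bounded_linear_fourier_l2]) simp
  fix f :: "real ^ 'n \<Rightarrow> complex" assume "schwartz f"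
  note f = schwartz_integrable[OF this]
  show "mult_op (\<lambda>x. F_phase CARD('n)) (fourier_l2 (abs_l2 f))
     = abs_l2 (\<lambda>\<xi>. \<i> powr (- of_nat CARD('n) / 2) * fourier_integral f \<xi>)"
    by (simp add: fourier_l2_abs f mult_op_abs sq_integrable_fourier F_phase_def)
qed

lemma det_uminus_mat: "det (- mat 1 :: real ^ 'n ^ 'n) = (-1) ^ CARD('n)"
proof -
  have "- mat 1 = (\<chi> i. (-1) *s (mat 1 :: real ^ 'n ^ 'n) $ i)"
    by (simp add: vec_eq_iff)
  then show ?thesis by (simp only: det_rows_mul) simp
qed

lemma invertible_uminus_mat: "invertible (- mat 1 :: real ^ 'n ^ 'n)"
  by (simp add: invertible_det_nz det_uminus_mat)

lemma uminus_mat_mult_vec: "(- mat 1 :: real ^ 'n ^ 'n) *v x = - x"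
proof -
  have "(\<Sum>j\<in>UNIV. - (if i = j then 1 else 0) * x $ j) = - (\<Sum>j\<in>UNIV. if i = j then x $ j else 0)" for i
    unfolding sum_negf[symmetric] by (intro sum.cong) auto
  then show ?thesis by (simp add: vec_eq_iff matrix_vector_mult_def mat_def)
qed

text \<open>
  The square of the Fourier transform is the reflection, whose determinant has the sign that matches the
  phase \<open>\<i> powi (- n)\<close> of \<open>F_op \<circ> F_op\<close>.  This makes the inverse of \<open>F_op\<close> a product of generators.
\<close>

lemma F_op_F_op: "F_op (F_op F) = T_op (- int CARD('n)) (- mat 1) (F :: (real ^ 'n) l2)"
proof -
  have "F_op (F_op F) = mult_op (\<lambda>x. \<i> powi (- int CARD('n))) (reflect F)"
    by (simp add: F_op_eq fourier_l2_cmult mult_op_mult_op fourier_fourier_l2 F_phase_sq)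
  also have "\<dots> = abs_l2 (\<lambda>x. \<i> powi (- int CARD('n)) * rep_l2 F (- x))"
    unfolding reflect_def by (simp add: mult_op_abs sq_integrable_uminus)
  also have "\<dots> = T_op (- int CARD('n)) (- mat 1) F"
    by (simp add: T_op_def det_uminus_mat power_abs uminus_mat_mult_vec)
  finally show ?thesis .
qed

section \<open>Tensor products\<close>

lemma integrable_prod_vec:
  fixes f :: "'n::finite \<Rightarrow> real \<Rightarrow> 'c::{real_normed_field,banach,second_countable_topology}"
  assumes "\<And>j. integrable lborel (f j)"
  shows "integrable lborel (\<lambda>x :: real ^ 'n. \<Prod>j\<in>UNIV. f j (x $ j))"
    and "(LINT x|lborel. (\<Prod>j\<in>UNIV. f j ((x :: real ^ 'n) $ j))) = (\<Prod>j\<in>UNIV. (LINT x|lborel. f j x))"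
proof -
  define g where "g b = f (SOME j. b = axis j 1)" for b :: "real ^ 'n"
  have g: "g (axis j 1) = f j" for j by (simp add: g_def axis_eq_axis)
  have eq: "(\<Prod>b\<in>Basis. g b (x \<bullet> b)) = (\<Prod>j\<in>UNIV. f j (x $ j))" for x
    by (simp add: prod_Basis_vec g inner_axis)
  have "\<And>b. integrable lborel (g b)" by (simp add: g_def assms)
  from integrable_lborel_prod[of g, OF this]
  show "integrable lborel (\<lambda>x :: real ^ 'n. \<Prod>j\<in>UNIV. f j (x $ j))"
    "(LINT x|lborel. (\<Prod>j\<in>UNIV. f j ((x :: real ^ 'n) $ j))) = (\<Prod>j\<in>UNIV. (LINT x|lborel. f j x))"
    by (simp_all add: eq) (simp add: prod_Basis_vec g)
qed

lemma vec_nth_measurable [measurable]: "(\<lambda>x::real ^ 'n. x $ j) \<in> borel_measurable borel"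
  by (intro borel_measurable_continuous_onI continuous_intros)

text \<open>
  The preimage of a null set under a coordinate projection is a product set with one factor of measure
  zero.
\<close>

lemma AE_coordinate:
  assumes "AE y in (lborel :: real measure). P y"
  shows "AE x in (lborel :: (real ^ 'n) measure). P (x $ j)"
proof -
  obtain N where N: "N \<in> null_sets lborel" "{y. \<not> P y} \<subseteq> N"
    using assms by (auto elim!: AE_E simp: null_sets_def)
  then have [measurable]: "N \<in> sets borel" by (auto simp: null_sets_def)
  define g :: "real ^ 'n \<Rightarrow> real \<Rightarrow> real" where "g b = (if b = axis j 1 then indicator N else (\<lambda>_. 1))" for b
  have g: "(\<Prod>b\<in>Basis. g b (x \<bullet> b)) = indicator N (x $ j)" for x
    by (simp add: prod_Basis_vec g_def axis_eq_axis inner_axis if_distrib[of "\<lambda>f. f _"] prod.delta)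
  have "emeasure lborel {x :: real ^ 'n. x $ j \<in> N} = (\<integral>\<^sup>+x. indicator {x :: real ^ 'n. x $ j \<in> N} x \<partial>lborel)"
    by (rule nn_integral_indicator[symmetric]) measurable
  also have "\<dots> = (\<integral>\<^sup>+x. ennreal (\<Prod>b\<in>Basis. g b (x \<bullet> b)) \<partial>lborel)"
    by (intro nn_integral_cong) (simp add: g indicator_def)
  also have "\<dots> = (\<integral>\<^sup>+x. (\<Prod>b\<in>Basis. ennreal (g b (x \<bullet> b))) \<partial>lborel)"
    by (subst prod_ennreal) (auto simp: g_def)
  also have "\<dots> = (\<Prod>b\<in>Basis. (\<integral>\<^sup>+x. ennreal (g b x) \<partial>lborel))"
    by (subst nn_integral_lborel_prod[of "\<lambda>b x. ennreal (g b x)", symmetric]) (auto simp: g_def)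
  also have "(\<integral>\<^sup>+x. ennreal (g (axis j 1) x) \<partial>lborel) = 0"
    using N(1) by (simp add: g_def null_sets_def ennreal_indicator)
  then have "(\<Prod>b\<in>Basis. (\<integral>\<^sup>+x. ennreal (g b x) \<partial>lborel)) = 0"
    by (auto simp: prod_Basis_vec intro!: exI[of _ j])
  finally have "{x :: real ^ 'n. x $ j \<in> N} \<in> null_sets lborel"
    by (auto simp: null_sets_def)
  then show ?thesis
    by (rule AE_I') (use N(2) in auto)
qed

lemma sq_integrable_prod:
  fixes g :: "'n::finite \<Rightarrow> real \<Rightarrow> complex"
  assumes "\<And>j. sq_integrable (g j)"
  shows "sq_integrable (\<lambda>x :: real ^ 'n. \<Prod>j\<in>UNIV. g j (x $ j))"
proof -
  have "integrable lborel (\<lambda>x :: real ^ 'n. \<Prod>j\<in>UNIV. (norm (g j (x $ j)))\<^sup>2)"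
    by (rule integrable_prod_vec(1)) (use assms in \<open>auto simp: sq_integrable_def\<close>)
  moreover have "(\<lambda>x :: real ^ 'n. \<Prod>j\<in>UNIV. g j (x $ j)) \<in> borel_measurable borel"
    by (intro borel_measurable_prod measurable_compose[OF vec_nth_measurable] sq_integrable_borel assms)
  ultimately show ?thesis by (simp add: sq_integrable_def prod_norm prod_power_distrib flip: prod_norm)
qed

lemma tensor_fun_abs:
  fixes g :: "'n::finite \<Rightarrow> real \<Rightarrow> complex"
  assumes g: "\<And>j. sq_integrable (g j)"
  shows "tensor_fun (\<lambda>j. abs_l2 (g j)) = abs_l2 (\<lambda>x. \<Prod>j\<in>UNIV. g j (x $ j))"
  unfolding tensor_fun_def
proof (rule abs_l2_eqI)
  have "AE x in lborel. \<forall>j\<in>UNIV. rep_l2 (abs_l2 (g j)) ((x :: real ^ 'n) $ j) = g j (x $ j)"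
    by (intro AE_finite_allI AE_coordinate[OF AE_rep_abs[OF g]]) simp
  then show "AE x in lborel. (\<Prod>j\<in>UNIV. rep_l2 (abs_l2 (g j)) ((x :: real ^ 'n) $ j)) = (\<Prod>j\<in>UNIV. g j (x $ j))"
    by eventually_elim simp
qed (intro sq_integrable_prod g sq_integrable_rep)+

lemma norm_tensor_fun: "norm (tensor_fun f) = (\<Prod>j\<in>UNIV. norm (f j))"
proof (rule power2_eq_imp_eq)
  have "(norm (tensor_fun f))\<^sup>2 = (LINT x|lborel. (\<Prod>j\<in>UNIV. (norm (rep_l2 (f j) (x $ j)))\<^sup>2))"
    unfolding tensor_fun_def
    by (subst norm_abs_l2_sq[OF sq_integrable_prod[of "\<lambda>j. rep_l2 (f j)", OF sq_integrable_rep]])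
      (simp add: prod_power_distrib flip: prod_norm)
  also have "\<dots> = (\<Prod>j\<in>UNIV. (norm (f j))\<^sup>2)"
    by (subst integrable_prod_vec(2))
      (auto simp: norm_l2_sq sq_integrable_rep[unfolded sq_integrable_def])
  finally show "(norm (tensor_fun f))\<^sup>2 = (\<Prod>j\<in>UNIV. norm (f j))\<^sup>2"
    by (simp add: prod_power_distrib)
qed (auto intro: prod_nonneg)

lemma bounded_linear_tensor_fun:
  fixes f :: "'n::finite \<Rightarrow> real l2"
  shows "bounded_linear (\<lambda>h. tensor_fun (f(i := h)))"
proof (rule bounded_linear_intro[of _ "\<Prod>j\<in>UNIV - {i}. norm (f j)"])
  let ?c = "\<lambda>x :: real ^ 'n. (\<Prod>j\<in>UNIV - {i}. rep_l2 (f j) (x $ j))"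
  have sq: "sq_integrable (\<lambda>x :: real ^ 'n. h (x $ i) * ?c x)" if "sq_integrable h" for h
  proof -
    have "sq_integrable (\<lambda>x :: real ^ 'n. \<Prod>j\<in>UNIV. ((\<lambda>j. rep_l2 (f j))(i := h)) j (x $ j))"
      by (rule sq_integrable_prod) (use that in auto)
    then show ?thesis
      by (subst (asm) prod.remove[of _ i]) (auto simp: mult.commute cong: prod.cong_simp)
  qed
  have t: "tensor_fun (f(i := abs_l2 h)) = abs_l2 (\<lambda>x. h (x $ i) * ?c x)" if "sq_integrable h" for h
  proof -
    have "f(i := abs_l2 h) = (\<lambda>j. abs_l2 (((\<lambda>j. rep_l2 (f j))(i := h)) j))"
      by auto
    then have "tensor_fun (f(i := abs_l2 h)) = abs_l2 (\<lambda>x. \<Prod>j\<in>UNIV. ((\<lambda>j. rep_l2 (f j))(i := h)) j (x $ j))"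
      using that by (simp only:) (rule tensor_fun_abs, simp)
    also have "\<dots> = abs_l2 (\<lambda>x. h (x $ i) * ?c x)"
      by (subst prod.remove[of _ i]) (auto cong: prod.cong_simp)
    finally show ?thesis .
  qed
  fix F G :: "real l2" and c :: real
  have "tensor_fun (f(i := abs_l2 (rep_l2 F) + abs_l2 (rep_l2 G)))
      = tensor_fun (f(i := abs_l2 (rep_l2 F))) + tensor_fun (f(i := abs_l2 (rep_l2 G)))"
    by (simp add: t sq sq_integrable_add distrib_right del: abs_rep_l2 flip: abs_l2_add)
  then show "tensor_fun (f(i := F + G)) = tensor_fun (f(i := F)) + tensor_fun (f(i := G))" by simp
  have "tensor_fun (f(i := c *\<^sub>R abs_l2 (rep_l2 F))) = c *\<^sub>R tensor_fun (f(i := abs_l2 (rep_l2 F)))"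
    by (simp add: t sq sq_integrable_scaleR del: abs_rep_l2 flip: abs_l2_scaleR)
  then show "tensor_fun (f(i := c *\<^sub>R F)) = c *\<^sub>R tensor_fun (f(i := F))" by simp
  show "norm (tensor_fun (f(i := F))) \<le> norm F * (\<Prod>j\<in>UNIV - {i}. norm (f j))"
    unfolding norm_tensor_fun by (subst prod.remove[of _ i]) (auto cong: prod.cong_simp)
qed

lemma gauss_prod:
  fixes u v :: "real ^ 'n"
  shows "gauss t u v x = (\<Prod>j\<in>UNIV. gauss t (u $ j) (v $ j) (x $ j))"
proof -
  have n: "(norm x)\<^sup>2 = (\<Sum>j\<in>UNIV. (x $ j)\<^sup>2)"
    unfolding power2_norm_eq_inner inner_vec_def by (simp add: power2_eq_square)
  show ?thesis
    unfolding gauss_def n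
    by (simp add: exp_sum[symmetric] inner_vec_def sum.distrib sum_subtractf sum_distrib_left algebra_simps)
qed

text \<open>
  Classes of Gaussians on the product are tensor products of classes of Gaussians, so tensor
  products span a dense subspace.
\<close>

lemma eq_on_tensors:
  fixes U V :: "(real ^ 'n) l2 \<Rightarrow> (real ^ 'n) l2"
  assumes "bounded_linear U" "bounded_linear V"
    and eq: "\<And>f. U (tensor_fun f) = V (tensor_fun f)"
  shows "U = V"
proof (rule eq_on_gauss[OF assms(1,2)])
  fix f :: "real ^ 'n \<Rightarrow> complex" assume "is_gauss f"
  then obtain c t u v where t: "0 < t" and f: "f = (\<lambda>x. c * gauss t u v x)" by (rule is_gaussE)
  \<comment> \<open>The scalar \<open>c\<close> is put into an arbitrary one of the factors.\<close>
  obtain i :: 'n where True by simp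
  define g where "g j x = (if j = i then c else 1) * gauss t (u $ j) (v $ j) x" for j and x :: real
  have "(\<Prod>j\<in>UNIV. g j (x $ j)) = f x" for x
    by (simp add: g_def f gauss_prod prod.distrib prod.delta)
  moreover have "sq_integrable (g j)" for j
    unfolding g_def[abs_def] by (rule sq_integrable_gauss[OF t])
  ultimately have "abs_l2 f = tensor_fun (\<lambda>j. abs_l2 (g j))"
    using tensor_fun_abs[of g] by simp
  then show "U (abs_l2 f) = V (abs_l2 f)" using eq by simp
qed

text \<open>
  Both sides are bounded and linear in each tensor factor separately, so the Gaussian factors can be
  replaced by arbitrary ones one coordinate at a time.
\<close>

lemma tensor_action_from_gauss:
  fixes U :: "(real ^ 'n) l2 \<Rightarrow> (real ^ 'n) l2"
  assumes U: "bounded_linear U" and A: "\<And>j. bounded_linear (A j)"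
    and gauss: "\<And>g. (\<And>j. is_gauss (g j)) \<Longrightarrow>
      U (tensor_fun (\<lambda>j. abs_l2 (g j))) = tensor_fun (\<lambda>j. A j (abs_l2 (g j)))"
  shows "U (tensor_fun f) = tensor_fun (\<lambda>j. A j (f j))"
proof -
  have "\<forall>f. (\<forall>j. j \<notin> I \<longrightarrow> f j \<in> gauss_classes) \<longrightarrow> U (tensor_fun f) = tensor_fun (\<lambda>j. A j (f j))"
    if "finite I" for I
    using that
  proof (induction I)
    case empty
    show ?case
    proof (intro allI impI)
      fix f :: "'n \<Rightarrow> real l2" assume "\<forall>j. j \<notin> {} \<longrightarrow> f j \<in> gauss_classes"
      then have "\<forall>j. \<exists>g. is_gauss g \<and> f j = abs_l2 g" by (auto simp: gauss_classes_eq)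
      then obtain g where g: "\<And>j. is_gauss (g j)" "\<And>j. f j = abs_l2 (g j)" by metis
      then have "f = (\<lambda>j. abs_l2 (g j))" by auto
      then show "U (tensor_fun f) = tensor_fun (\<lambda>j. A j (f j))" using gauss[of g, OF g(1)] by simp
    qed
  next
    case (insert i I)
    show ?case
    proof (intro allI impI)
      fix f :: "'n \<Rightarrow> real l2" assume f: "\<forall>j. j \<notin> insert i I \<longrightarrow> f j \<in> gauss_classes"
      have "(\<lambda>h. U (tensor_fun (f(i := h)))) = (\<lambda>h. tensor_fun ((\<lambda>j. A j (f j))(i := A i h)))"
      proof (rule bounded_linear_eq_on_dense_span[OF _ _ _ closure_span_gauss_classes])
        show "bounded_linear (\<lambda>h. U (tensor_fun (f(i := h))))"
          by (rule bounded_linear_compose[OF U bounded_linear_tensor_fun])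
        show "bounded_linear (\<lambda>h. tensor_fun ((\<lambda>j. A j (f j))(i := A i h)))"
          by (rule bounded_linear_compose[OF bounded_linear_tensor_fun A])
        fix h :: "real l2" assume "h \<in> gauss_classes"
        then have "\<forall>j. j \<notin> I \<longrightarrow> (f(i := h)) j \<in> gauss_classes" using f by auto
        then have "U (tensor_fun (f(i := h))) = tensor_fun (\<lambda>j. A j ((f(i := h)) j))"
          using insert.IH by blast
        also have "(\<lambda>j. A j ((f(i := h)) j)) = (\<lambda>j. A j (f j))(i := A i h)" by auto
        finally show "U (tensor_fun (f(i := h))) = tensor_fun ((\<lambda>j. A j (f j))(i := A i h))" .
      qed
      from fun_cong[OF this, of "f i"] show "U (tensor_fun f) = tensor_fun (\<lambda>j. A j (f j))"
        by (simp add: fun_upd_idem)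
    qed
  qed
  from this[of UNIV] show ?thesis by simp
qed

lemma tensor_op_eq:
  fixes U :: "(real ^ 'n) l2 \<Rightarrow> (real ^ 'n) l2"
  assumes U: "bounded_linear U" and eq: "\<And>f. U (tensor_fun f) = tensor_fun (\<lambda>j. A j (f j))"
  shows "tensor_op A = U"
  unfolding tensor_op_def
proof (rule the_equality)
  fix V assume "bounded_linear V \<and> (\<forall>f. V (tensor_fun f) = tensor_fun (\<lambda>j. A j (f j)))"
  then show "V = U" using eq_on_tensors[of V U] U eq by simp
qed (use assms in blast)

lemma fourier_l2_tensor:
  fixes f :: "'n::finite \<Rightarrow> real l2"
  shows "fourier_l2 (tensor_fun f) = tensor_fun (\<lambda>j. fourier_l2 (f j))"
proof (rule tensor_action_from_gauss[where A="\<lambda>j. fourier_l2"])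
  show "bounded_linear (fourier_l2 :: (real ^ 'n) l2 \<Rightarrow> (real ^ 'n) l2)" "bounded_linear (fourier_l2 :: real l2 \<Rightarrow> real l2)"
    by (rule bounded_linear_fourier_l2)+
  fix g :: "'n \<Rightarrow> real \<Rightarrow> complex" assume g: "\<And>j. is_gauss (g j)"
  let ?G = "\<lambda>x :: real ^ 'n. \<Prod>j\<in>UNIV. g j (x $ j)"
  have i: "integrable lborel ?G" by (rule integrable_prod_vec(1)) (rule is_gauss_integrable[OF g])
  have s: "sq_integrable ?G" by (rule sq_integrable_prod) (rule is_gauss_sq_integrable[OF g])
  have "fourier_integral ?G = (\<lambda>\<xi>. \<Prod>j\<in>UNIV. fourier_integral (g j) (\<xi> $ j))"
  proof
    fix \<xi> :: "real ^ 'n"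
    have e: "?G x * exp (- (2 * of_real pi * \<i> * of_real (\<xi> \<bullet> x)))
        = (\<Prod>j\<in>UNIV. g j (x $ j) * exp (- (2 * of_real pi * \<i> * of_real (\<xi> $ j \<bullet> x $ j))))" for x
      unfolding prod.distrib exp_sum[OF finite, symmetric] inner_vec_def
      by (simp add: sum_distrib_left sum_negf)
    have ij: "integrable lborel (\<lambda>x. g j x * exp (- (2 * of_real pi * \<i> * of_real (\<xi> $ j \<bullet> x))))" for j
      by (rule integrable_mult_bounded[OF is_gauss_integrable[OF g], of _ 1]) (auto simp: norm_exp_eq_Re)
    show "fourier_integral ?G \<xi> = (\<Prod>j\<in>UNIV. fourier_integral (g j) (\<xi> $ j))"
      unfolding fourier_integral_def e by (rule integrable_prod_vec(2)[OF ij])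
  qed
  then have "fourier_l2 (abs_l2 ?G) = tensor_fun (\<lambda>j. abs_l2 (fourier_integral (g j)))"
    by (simp add: fourier_l2_abs[OF i s] tensor_fun_abs is_gauss_sq_integrable is_gauss_fourier g)
  then show "fourier_l2 (tensor_fun (\<lambda>j. abs_l2 (g j))) = tensor_fun (\<lambda>j. fourier_l2 (abs_l2 (g j)))"
    by (simp add: tensor_fun_abs is_gauss_sq_integrable fourier_l2_gauss g)
qed

lemma reflect_tensor:
  fixes f :: "'n::finite \<Rightarrow> real l2"
  shows "reflect (tensor_fun f) = tensor_fun (\<lambda>j. reflect (f j))"
proof -
  have "reflect (tensor_fun (\<lambda>j. abs_l2 (rep_l2 (f j)))) = tensor_fun (\<lambda>j. reflect (abs_l2 (rep_l2 (f j))))"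
    unfolding tensor_fun_abs[of "\<lambda>j. rep_l2 (f j)", OF sq_integrable_rep]
      reflect_abs[OF sq_integrable_prod[of "\<lambda>j. rep_l2 (f j)", OF sq_integrable_rep]]
      reflect_abs[OF sq_integrable_rep] tensor_fun_abs[of "\<lambda>j x. rep_l2 (f j) (- x)", OF sq_integrable_uminus[OF sq_integrable_rep]]
    by simp
  then show ?thesis by simp
qed

lemma inv_fourier_l2_tensor:
  fixes f :: "'n::finite \<Rightarrow> real l2"
  shows "inv_fourier_l2 (tensor_fun f) = tensor_fun (\<lambda>j. inv_fourier_l2 (f j))"
  by (simp add: inv_fourier_l2_def reflect_tensor fourier_l2_tensor)

lemma multiplier_prod:
  fixes m :: "'n::finite \<Rightarrow> real \<Rightarrow> complex"
  assumes "\<And>j. multiplier (m j)"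
  shows "multiplier (\<lambda>x :: real ^ 'n. \<Prod>j\<in>UNIV. m j (x $ j))"
proof -
  obtain C where C: "\<And>j x. norm (m j x) \<le> C j" using assms unfolding multiplier_def by metis
  show ?thesis
  proof (rule multiplierI)
    show "(\<lambda>x :: real ^ 'n. \<Prod>j\<in>UNIV. m j (x $ j)) \<in> borel_measurable borel"
      using assms by (intro borel_measurable_prod measurable_compose[OF vec_nth_measurable]) (auto simp: multiplier_def)
    show "norm (\<Prod>j\<in>UNIV. m j (x $ j)) \<le> (\<Prod>j\<in>UNIV. C j)" for x :: "real ^ 'n"
      unfolding prod_norm[symmetric] by (intro prod_mono) (auto intro: C)
  qed
qed

lemma mult_op_tensor:
  fixes f :: "'n::finite \<Rightarrow> real l2"
  assumes m: "\<And>j. multiplier (m j)"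
  shows "mult_op (\<lambda>x. \<Prod>j\<in>UNIV. m j (x $ j)) (tensor_fun f) = tensor_fun (\<lambda>j. mult_op (m j) (f j))"
proof -
  have "mult_op (\<lambda>x. \<Prod>j\<in>UNIV. m j (x $ j)) (tensor_fun (\<lambda>j. abs_l2 (rep_l2 (f j))))
     = tensor_fun (\<lambda>j. mult_op (m j) (abs_l2 (rep_l2 (f j))))"
    unfolding tensor_fun_abs[of "\<lambda>j. rep_l2 (f j)", OF sq_integrable_rep]
      mult_op_abs[OF multiplier_prod[of m, OF m] sq_integrable_prod[of "\<lambda>j. rep_l2 (f j)", OF sq_integrable_rep]]
      mult_op_abs[OF m sq_integrable_rep]
      tensor_fun_abs[of "\<lambda>j x. m j x * rep_l2 (f j) x", OF sq_integrable_mult[OF m sq_integrable_rep]]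
    by (simp add: prod.distrib)
  then show ?thesis by simp
qed

section \<open>Fourier inversion for Schwartz functions of one variable\<close>

lemma iter_deriv_append: "iter_deriv vs (iter_deriv us f) = iter_deriv (vs @ us) f"
  by (induction vs) auto

lemma schwartz_iter_deriv:
  assumes "schwartz f" "set us \<subseteq> Basis" shows "schwartz (iter_deriv us f)"
  using assms unfolding schwartz_def iter_deriv_append by (metis Un_subset_iff set_append)

lemma schwartz_deriv:
  fixes f :: "real \<Rightarrow> complex"
  assumes f: "schwartz f"
  shows "schwartz (iter_deriv [1] f)" "(f has_vector_derivative iter_deriv [1] f x) (at x)"
proof -
  show "schwartz (iter_deriv [1] f)" by (rule schwartz_iter_deriv[OF f]) simp
  have "f differentiable (at x)"
    using f[unfolded schwartz_def, rule_format, of "[]"] by simp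
  then have d: "(f has_derivative frechet_derivative f (at x)) (at x)"
    by (simp add: frechet_derivative_works)
  have "frechet_derivative f (at x) h = h *\<^sub>R frechet_derivative f (at x) 1" for h
    using linear_scale[OF has_derivative_linear[OF d], of h 1] by simp
  then have "frechet_derivative f (at x) = (\<lambda>h. h *\<^sub>R frechet_derivative f (at x) 1)" by (rule ext)
  from has_derivative_eq_rhs[OF d this] show "(f has_vector_derivative iter_deriv [1] f x) (at x)"
    by (simp add: has_vector_derivative_def)
qed

lemma schwartz_tendsto_zero:
  fixes f :: "real \<Rightarrow> complex"
  assumes f: "schwartz f" and F: "F \<le> at_infinity"
  shows "(f \<longlongrightarrow> 0) F"
proof -
  obtain C where C: "0 \<le> C" "\<And>x. (1 + (norm x)\<^sup>2) ^ 1 * norm (f x) \<le> C"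
    using schwartz_decay[OF f, of 1] by blast
  have "(f \<longlongrightarrow> 0) at_infinity"
  proof (rule Lim_null_comparison)
    have "norm (f x) \<le> C * inverse (norm x)" if "1 \<le> norm x" for x
    proof -
      have "norm x * norm (f x) \<le> (1 + (norm x)\<^sup>2) ^ 1 * norm (f x)"
        using mult_left_mono[OF that, of "norm x"] by (intro mult_right_mono) (auto simp: power2_eq_square)
      with C(2)[of x] have "norm x * norm (f x) \<le> C" by linarith
      then show ?thesis using that by (simp add: field_simps)
    qed
    then show "\<forall>\<^sub>F x in at_infinity. norm (f x) \<le> C * inverse (norm x)"
      by (auto simp: eventually_at_infinity)
    have "((\<lambda>x::real. inverse (norm x)) \<longlongrightarrow> 0) at_infinity"
      by (rule tendsto_inverse_0_at_top[OF filterlim_norm_at_top])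
    then show "((\<lambda>x::real. C * inverse (norm x)) \<longlongrightarrow> 0) at_infinity"
      by (rule tendsto_mult_right_zero)
  qed
  then show ?thesis by (rule filterlim_mono[OF _ order_refl F])
qed

lemma schwartz_continuous:
  fixes f :: "real \<Rightarrow> complex"
  assumes "schwartz f" shows "isCont f x"
  using schwartz_deriv(2)[OF assms, of x] by (rule has_vector_derivative_continuous)

lemma fourier_deriv:
  fixes f :: "real \<Rightarrow> complex"
  assumes f: "schwartz f"
  shows "fourier_integral (iter_deriv [1] f) \<xi> = 2 * of_real pi * \<i> * of_real \<xi> * fourier_integral f \<xi>"
proof -
  let ?f' = "iter_deriv [1] f"
  let ?c = "- (2 * of_real pi * \<i> * of_real \<xi>) :: complex"
  let ?e = "\<lambda>x::real. exp (?c * of_real x)"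
  have ne: "norm (?e x) = 1" for x by (simp add: norm_exp_eq_Re)
  have em: "?e \<in> borel_measurable borel" by measurable
  have i1: "integrable lborel (\<lambda>x. f x * ?e x)"
    by (rule integrable_mult_bounded[OF schwartz_integrable(1)[OF f] em, of 1]) (simp add: ne)
  have i2: "integrable lborel (\<lambda>x. ?f' x * ?e x)"
    by (rule integrable_mult_bounded[OF schwartz_integrable(1)[OF schwartz_deriv(1)[OF f]] em, of 1]) (simp add: ne)
  let ?h = "\<lambda>x. f x * ?e x" and ?h' = "\<lambda>x. ?f' x * ?e x + ?c * (f x * ?e x)"
  have ed: "(?e has_vector_derivative ?c * ?e x) (at x)" for x
  proof -
    have "((\<lambda>z. exp (?c * z)) has_field_derivative ?c * exp (?c * of_real x)) (at (of_real x))"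
      by (auto intro!: derivative_eq_intros simp del: mult_minus_left)
    from has_vector_derivative_real_field[OF this] show ?thesis .
  qed
  have hd: "(?h has_vector_derivative ?h' x) (at x)" for x
    using has_vector_derivative_mult[OF schwartz_deriv(2)[OF f] ed, of x] by (simp add: algebra_simps)
  have hi: "integrable lborel ?h'" using i1 i2 by simp
  have hz: "(?h \<longlongrightarrow> 0) F" if "F \<le> at_infinity" for F
  proof (rule tendsto_norm_zero_cancel)
    have "((\<lambda>x. norm (f x)) \<longlongrightarrow> 0) F"
      using schwartz_tendsto_zero[OF f that] by (rule tendsto_norm_zero)
    then show "((\<lambda>x. norm (?h x)) \<longlongrightarrow> 0) F" by (simp add: norm_mult ne del: of_real_mult mult_minus_left)
  qed
  have "(LBINT x=-\<infinity>..\<infinity>. ?h' x) = 0 - 0"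
  proof (rule interval_integral_FTC_integrable[of "-\<infinity>" \<infinity> ?h])
    show "isCont ?h' x" for x
      using schwartz_continuous[OF f, of x] schwartz_continuous[OF schwartz_deriv(1)[OF f], of x]
      by (intro continuous_intros) auto
    show "set_integrable lborel (einterval (-\<infinity>) \<infinity>) ?h'"
      using hi by (simp add: set_integrable_def)
    show "((?h \<circ> real_of_ereal) \<longlongrightarrow> 0) (at_right (-\<infinity>))" "((?h \<circ> real_of_ereal) \<longlongrightarrow> 0) (at_left \<infinity>)"
      unfolding ereal_tendsto_simps
      by (rule hz[OF at_bot_le_at_infinity], rule hz[OF at_top_le_at_infinity])
  qed (use hd in auto)
  then have "(LINT x|lborel. ?h' x) = 0"
    by (simp add: interval_lebesgue_integral_def set_lebesgue_integral_def)
  then have "(LINT x|lborel. ?f' x * ?e x) + ?c * (LINT x|lborel. f x * ?e x) = 0"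
    using i1 i2 by (simp add: Bochner_Integration.integral_add)
  then show ?thesis
    unfolding fourier_integral_def by (simp add: mult_ac add_eq_0_iff)
qed

text \<open>
  Integrating by parts twice bounds the transform by a multiple of \<open>1 / (1 + \<xi>\<^sup>2)\<close>.
\<close>

lemma schwartz_fourier_integrable:
  fixes f :: "real \<Rightarrow> complex"
  assumes f: "schwartz f"
  shows "integrable lborel (fourier_integral f)"
proof -
  note [measurable] = schwartz_measurable[OF f]
  let ?f2 = "iter_deriv [1] (iter_deriv [1] f)"
  define C where "C = (LINT x|lborel. norm (f x)) + (LINT x|lborel. norm (?f2 x))"
  have "norm (fourier_integral f \<xi>) \<le> norm (C * inverse (1 + \<xi>\<^sup>2))" for \<xi>
  proof -
    have "fourier_integral ?f2 \<xi> = (2 * of_real pi * \<i> * of_real \<xi>)\<^sup>2 * fourier_integral f \<xi>"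
      unfolding fourier_deriv[OF schwartz_deriv(1)[OF f]] fourier_deriv[OF f] by (simp add: power2_eq_square)
    then have "norm (fourier_integral ?f2 \<xi>) = (2 * pi)\<^sup>2 * \<xi>\<^sup>2 * norm (fourier_integral f \<xi>)"
      by (simp add: norm_mult norm_power power_mult_distrib)
    moreover have "1 * (\<xi>\<^sup>2 * norm (fourier_integral f \<xi>)) \<le> (2 * pi)\<^sup>2 * (\<xi>\<^sup>2 * norm (fourier_integral f \<xi>))"
    proof (rule mult_right_mono)
      show "1 \<le> (2 * pi)\<^sup>2" by (rule one_le_power) (use pi_gt3 in simp)
    qed simp
    ultimately have "(1 + \<xi>\<^sup>2) * norm (fourier_integral f \<xi>) \<le> C"
      using norm_fourier_integral_le[of f \<xi>] norm_fourier_integral_le[of ?f2 \<xi>]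
      by (simp add: C_def distrib_right)
    moreover have "0 < 1 + \<xi>\<^sup>2" by (simp add: add_pos_nonneg)
    ultimately have "norm (fourier_integral f \<xi>) \<le> C * inverse (1 + \<xi>\<^sup>2)"
      by (simp add: pos_le_divide_eq mult.commute flip: divide_inverse)
    then show ?thesis by simp
  qed
  then show ?thesis
    by (intro Bochner_Integration.integrable_bound[OF integrable_mult_right[OF integrable_inverse_1_plus_square, of C]])
      (auto intro!: AE_I2)
qed

text \<open>
  Needed for the rotation by the angle \<open>0\<close>, whose defining integral is the inverse Fourier integral; its
  kernel is not damped by a Gaussian.
\<close>

lemma schwartz_inversion:
  fixes f :: "real \<Rightarrow> complex"
  assumes f: "schwartz f"
  shows "abs_l2 (\<lambda>x. fourier_integral (fourier_integral f) (- x)) = abs_l2 f"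
proof -
  note i = schwartz_integrable[OF f] schwartz_fourier_integrable[OF f]
  note s = sq_integrable_fourier[OF i(1,2)]
  have "reflect (fourier_l2 (fourier_l2 (abs_l2 f))) = abs_l2 f"
    by (simp add: fourier_fourier_l2)
  moreover have "fourier_l2 (fourier_l2 (abs_l2 f)) = abs_l2 (fourier_integral (fourier_integral f))"
    by (simp add: fourier_l2_abs i s)
  ultimately show ?thesis by (simp add: reflect_abs sq_integrable_fourier[OF i(3) s])
qed

section \<open>Atomic contractions in terms of the generators\<close>

definition damp :: "real \<Rightarrow> real \<Rightarrow> complex" where
  "damp t x = of_real (exp (- pi * t * x\<^sup>2))"

lemma damp_measurable [measurable]: "damp t \<in> borel_measurable borel"
  unfolding damp_def by measurable

lemma norm_damp_le: "0 \<le> t \<Longrightarrow> norm (damp t x) \<le> 1"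
  by (simp add: damp_def)

lemma multiplier_damp: "0 \<le> t \<Longrightarrow> multiplier (damp t)"
  by (rule multiplierI[of _ 1]) (auto intro: norm_damp_le)

lemma damp_zero: "damp 0 = (\<lambda>x. 1)"
  by (simp add: damp_def fun_eq_iff)

text \<open>
  The hyperbolic half-angle tangent \<open>tanh (\<theta> / 2)\<close>.  At \<open>\<theta> = 0\<close> the quotient \<open>0 / 0\<close> has the value \<open>0\<close>, which is
  the right one.
\<close>

definition rot_shear :: "real \<Rightarrow> real" where
  "rot_shear \<theta> = (cosh \<theta> - 1) / sinh \<theta>"

lemma rot_shear_nonneg: "0 \<le> \<theta> \<Longrightarrow> 0 \<le> rot_shear \<theta>"
  by (simp add: rot_shear_def cosh_real_ge_1)

text \<open>
  A lower, an upper and again a lower triangular shear.  Rotations and Gaussian multipliers of one variable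
  are both of this form, which allows them to be treated together.
\<close>

definition shear_form :: "real \<Rightarrow> real \<Rightarrow> real \<Rightarrow> real l2 \<Rightarrow> real l2" where
  "shear_form r s t F = mult_op (damp r) (inv_fourier_l2 (mult_op (damp s) (fourier_l2 (mult_op (damp t) F))))"

lemma bounded_linear_shear_form:
  assumes "0 \<le> r" "0 \<le> s" "0 \<le> t"
  shows "bounded_linear (shear_form r s t)"
  unfolding shear_form_def[abs_def]
  by (intro bounded_linear_compose[OF bounded_linear_mult_op[OF multiplier_damp[OF assms(1)]]]
      bounded_linear_compose[OF bounded_linear_inv_fourier_l2]
      bounded_linear_compose[OF bounded_linear_mult_op[OF multiplier_damp[OF assms(2)]]]
      bounded_linear_compose[OF bounded_linear_fourier_l2] bounded_linear_mult_op multiplier_damp assms)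

lemma fourier_gauss_real:
  assumes "0 < t"
  shows "fourier_integral (gauss t 0 v) (y::real) = of_real (exp (- pi * (v - y)\<^sup>2 / t) / sqrt t)"
proof -
  have "fourier_integral (gauss t 0 v) y
     = of_real ((1 / sqrt t) * exp ((pi / t) * (- v\<^sup>2)) * exp (2 * pi * (v * y / t) - pi * (1 / t) * y\<^sup>2))"
  proof -
    have "fourier_integral (gauss t 0 v) y = gauss_const t 0 v * gauss (1 / t) (v /\<^sub>R t) 0 y"
      using fourier_gauss[OF assms, of 1 0 v y] by simp
    also have "gauss_const t 0 v = of_real ((1 / sqrt t) * exp ((pi / t) * (- v\<^sup>2)))"
      by (simp add: gauss_const_def flip: exp_of_real)
    also have "gauss (1 / t) (v /\<^sub>R t) 0 y = of_real (exp (2 * pi * (v * y / t) - pi * (1 / t) * y\<^sup>2))"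
      by (simp add: gauss_def divide_inverse mult_ac flip: exp_of_real)
    finally show ?thesis by simp
  qed
  also have "(1 / sqrt t) * exp ((pi / t) * (- v\<^sup>2)) * exp (2 * pi * (v * y / t) - pi * (1 / t) * y\<^sup>2)
     = exp (- pi * (v - y)\<^sup>2 / t) / sqrt t"
  proof -
    have "(pi / t) * (- v\<^sup>2) + (2 * pi * (v * y / t) - pi * (1 / t) * y\<^sup>2) = - pi * (v - y)\<^sup>2 / t"
      using assms by (simp add: field_simps power2_eq_square)
    then show ?thesis by (simp add: mult_exp_exp mult.assoc flip: exp_add)
  qed
  finally show ?thesis .
qed

text \<open>
  The symplectic matrix of the rotation factors into shears, so the operator is a Gaussian
  multiplier, a Gaussian Fourier multiplier and again a Gaussian multiplier.  On Schwartz
  functions both sides are integral operators with the same Gaussian kernel.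
\<close>

lemma R_op_eq:
  assumes "0 \<le> \<theta>"
  shows "R_op \<theta> = shear_form (rot_shear \<theta>) (sinh \<theta>) (rot_shear \<theta>)"
  unfolding R_op_def
proof (rule l2_extension_eq)
  let ?a = "rot_shear \<theta>" and ?s = "sinh \<theta>" and ?c = "cosh \<theta>"
  have a: "0 \<le> ?a" by (rule rot_shear_nonneg[OF assms])
  have s: "0 \<le> ?s" using assms by simp
  have c: "0 < ?c" by (rule cosh_real_pos)
  show "bounded_linear (shear_form ?a ?s ?a)" by (rule bounded_linear_shear_form[OF a s a])
  fix f :: "real \<Rightarrow> complex" assume f: "schwartz f"
  note fi = schwartz_integrable[OF f]
  note [measurable] = schwartz_measurable[OF f]
  define K where "K x = of_real (?c powr (-1/2)) *
     (LINT \<eta>|lborel. exp (\<i> * of_real pi *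
         (of_real (2 * x * \<eta>) + \<i> * of_real ((x\<^sup>2 + \<eta>\<^sup>2) * ?s)) / of_real ?c)
       * fourier_integral f \<eta>)" for x
  have "shear_form ?a ?s ?a (abs_l2 f) = abs_l2 K"
  proof (cases "\<theta> = 0")
    case True
    have "K x = fourier_integral (fourier_integral f) (- x)" for x
      by (simp add: K_def True fourier_integral_def mult_ac)
    then have "K = (\<lambda>x. fourier_integral (fourier_integral f) (- x))" by auto
    then show ?thesis
      by (simp add: shear_form_def True rot_shear_def damp_zero schwartz_inversion[OF f])
  next
    case False
    then have s: "0 < ?s" using assms by simp
    define u where "u x = damp ?a x * f x" for x
    have ui: "integrable lborel u"
      using integrable_mult_bounded[OF fi(1) damp_measurable norm_damp_le[OF a]]
      by (simp add: u_def[abs_def] mult.commute)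
    have us: "sq_integrable u"
      unfolding u_def[abs_def] by (rule sq_integrable_mult[OF multiplier_damp[OF a] fi(2)])
    note [measurable] = sq_integrable_borel[OF us]
    define w where "w x = damp ?s x * fourier_integral u x" for x
    have damp_gauss: "damp t = gauss t 0 0" for t
      by (rule ext) (simp add: damp_def gauss_def exp_of_real[symmetric] del: exp_of_real)
    have wi: "integrable lborel w"
      unfolding w_def[abs_def] damp_gauss
      by (rule integrable_mult_bounded[OF integrable_gauss[OF s] fourier_integral_measurable[OF sq_integrable_borel[OF us]] norm_fourier_integral_le])
    have ws: "sq_integrable w"
      unfolding w_def[abs_def]
      by (rule sq_integrable_mult[OF multiplier_damp sq_integrable_fourier[OF ui us]]) (use s in simp)
    note [measurable] = sq_integrable_borel[OF ws]
    have rs: "reflect (abs_l2 w) = abs_l2 (\<lambda>x. w (- x))" by (rule reflect_abs[OF ws])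
    have inv: "inv_fourier_l2 (abs_l2 w) = abs_l2 (\<lambda>x. fourier_integral w (- x))"
      unfolding inv_fourier_l2_def reflect_fourier_l2[symmetric]
      by (simp add: fourier_l2_abs[OF wi ws] reflect_abs[OF sq_integrable_fourier[OF wi ws]])
    have fw: "fourier_integral w (- x) = (LINT y|lborel. fourier_integral (gauss ?s 0 x) y * u y)" for x
    proof -
      have "fourier_integral w (- x) = (LINT \<eta>|lborel. gauss ?s 0 x \<eta> * fourier_integral u \<eta>)"
        unfolding fourier_integral_def[of w]
      proof (intro Bochner_Integration.integral_cong refl)
        fix \<eta>
        show "w \<eta> * exp (- (2 * of_real pi * \<i> * of_real (- x \<bullet> \<eta>))) = gauss ?s 0 x \<eta> * fourier_integral u \<eta>"
          by (simp add: w_def damp_gauss gauss_def mult_exp_exp mult_ac)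
      qed
      also have "\<dots> = (LINT y|lborel. fourier_integral (gauss ?s 0 x) y * u y)"
        by (rule fourier_multiplication[OF integrable_gauss[OF s] ui, symmetric])
      finally show ?thesis .
    qed
    \<comment> \<open>Both sides become integrals of \<open>f\<close> against a Gaussian kernel, after moving the Fourier transform from
      \<open>f\<close> and from \<open>u\<close> to the kernel by the multiplication formula.\<close>
    have Kx: "K x = damp ?a x * fourier_integral w (- x)" for x
    proof -
      have sc: "0 < ?s / ?c" using s c by simp
      have "(LINT \<eta>|lborel. exp (\<i> * of_real pi *
         (of_real (2 * x * \<eta>) + \<i> * of_real ((x\<^sup>2 + \<eta>\<^sup>2) * ?s)) / of_real ?c) * fourier_integral f \<eta>)
        = (LINT \<eta>|lborel. of_real (exp (- pi * ?s * x\<^sup>2 / ?c)) * (gauss (?s / ?c) 0 (x / ?c) \<eta> * fourier_integral f \<eta>))"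
      proof (intro Bochner_Integration.integral_cong refl)
        fix \<eta>
        have "\<i> * of_real pi * (of_real (2 * x * \<eta>) + \<i> * of_real ((x\<^sup>2 + \<eta>\<^sup>2) * ?s)) / of_real ?c
          = of_real (- pi * ?s * x\<^sup>2 / ?c) + (of_real (2 * pi * (0 \<bullet> \<eta>) - pi * (?s / ?c) * (norm \<eta>)\<^sup>2) + \<i> * of_real (2 * pi * ((x / ?c) \<bullet> \<eta>)))"
          using c by (simp add: complex_eq_iff field_simps)
        then show "exp (\<i> * of_real pi * (of_real (2 * x * \<eta>) + \<i> * of_real ((x\<^sup>2 + \<eta>\<^sup>2) * ?s)) / of_real ?c) * fourier_integral f \<eta>
          = of_real (exp (- pi * ?s * x\<^sup>2 / ?c)) * (gauss (?s / ?c) 0 (x / ?c) \<eta> * fourier_integral f \<eta>)"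
          unfolding gauss_def exp_of_real[symmetric] mult.assoc[symmetric] exp_add[symmetric] by simp
      qed
      also have "\<dots> = of_real (exp (- pi * ?s * x\<^sup>2 / ?c)) * (LINT y|lborel. fourier_integral (gauss (?s / ?c) 0 (x / ?c)) y * f y)"
        by (simp add: fourier_multiplication[OF integrable_gauss[OF sc] fi(1)])
      finally have "K x = of_real (?c powr (-1/2)) * (of_real (exp (- pi * ?s * x\<^sup>2 / ?c)) *
           (LINT y|lborel. fourier_integral (gauss (?s / ?c) 0 (x / ?c)) y * f y))"
        by (simp add: K_def)
      also have "\<dots> = (LINT y|lborel. of_real (?c powr (-1/2) * exp (- pi * ?s * x\<^sup>2 / ?c)) *
           (fourier_integral (gauss (?s / ?c) 0 (x / ?c)) y * f y))"
        by simp
      also have "\<dots> = (LINT y|lborel. damp ?a x * (fourier_integral (gauss ?s 0 x) y * u y))"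
      proof (intro Bochner_Integration.integral_cong refl)
        fix y
        have c2: "?c\<^sup>2 = ?s\<^sup>2 + 1" using cosh_square_eq[of \<theta>] by simp
        have "?c powr (-1/2) = 1 / sqrt ?c"
          using c by (simp add: powr_minus_divide powr_half_sqrt flip: minus_divide_left)
        then have k: "?c powr (-1/2) * (1 / sqrt (?s / ?c)) = 1 / sqrt ?s"
          using c s by (simp add: real_sqrt_divide)
        have e: "- pi * ?s * x\<^sup>2 / ?c + - pi * (x / ?c - y)\<^sup>2 / (?s / ?c)
            = - pi * ?a * x\<^sup>2 + - pi * (x - y)\<^sup>2 / ?s + - pi * ?a * y\<^sup>2"
        proof -
          have "?s * x\<^sup>2 / ?c + (x / ?c - y)\<^sup>2 / (?s / ?c) = ((?s\<^sup>2 + 1) * x\<^sup>2 / ?c - 2 * x * y + ?c * y\<^sup>2) / ?s"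
            using c s by (simp add: field_simps power2_eq_square)
          also have "(?s\<^sup>2 + 1) * x\<^sup>2 / ?c = ?c * x\<^sup>2"
            using c unfolding c2[symmetric] by (simp add: power2_eq_square)
          also have "(?c * x\<^sup>2 - 2 * x * y + ?c * y\<^sup>2) / ?s = ?a * x\<^sup>2 + (x - y)\<^sup>2 / ?s + ?a * y\<^sup>2"
            using s by (simp add: rot_shear_def field_simps power2_eq_square)
          finally have "- pi * (?s * x\<^sup>2 / ?c + (x / ?c - y)\<^sup>2 / (?s / ?c)) = - pi * (?a * x\<^sup>2 + (x - y)\<^sup>2 / ?s + ?a * y\<^sup>2)"
            by simp
          then show ?thesis by (simp only: distrib_left times_divide_eq_right mult.assoc)
        qed
        have "?c powr (-1/2) * exp (- pi * ?s * x\<^sup>2 / ?c) * (exp (- pi * (x / ?c - y)\<^sup>2 / (?s / ?c)) / sqrt (?s / ?c))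
            = (?c powr (-1/2) * (1 / sqrt (?s / ?c))) * exp (- pi * ?s * x\<^sup>2 / ?c + - pi * (x / ?c - y)\<^sup>2 / (?s / ?c))"
          by (simp only: exp_add) (simp add: mult_ac)
        also have "\<dots> = exp (- pi * ?a * x\<^sup>2) * (exp (- pi * (x - y)\<^sup>2 / ?s) / sqrt ?s) * exp (- pi * ?a * y\<^sup>2)"
          unfolding k e by (simp only: exp_add) (simp add: mult_ac)
        finally have r: "?c powr (-1/2) * exp (- pi * ?s * x\<^sup>2 / ?c) * (exp (- pi * (x / ?c - y)\<^sup>2 / (?s / ?c)) / sqrt (?s / ?c))
            = exp (- pi * ?a * x\<^sup>2) * (exp (- pi * (x - y)\<^sup>2 / ?s) / sqrt ?s) * exp (- pi * ?a * y\<^sup>2)" .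
        have "of_real (?c powr (-1/2) * exp (- pi * ?s * x\<^sup>2 / ?c)) * fourier_integral (gauss (?s / ?c) 0 (x / ?c)) y
           = damp ?a x * fourier_integral (gauss ?s 0 x) y * damp ?a y"
          unfolding fourier_gauss_real[OF s] fourier_gauss_real[OF sc] damp_def of_real_mult[symmetric] r ..
        then show "of_real (?c powr (-1/2) * exp (- pi * ?s * x\<^sup>2 / ?c)) * (fourier_integral (gauss (?s / ?c) 0 (x / ?c)) y * f y)
           = damp ?a x * (fourier_integral (gauss ?s 0 x) y * u y)"
          unfolding u_def by (simp only: mult.assoc[symmetric])
      qed
      also have "\<dots> = damp ?a x * fourier_integral w (- x)"
        unfolding fw by simp
      finally show ?thesis .
    qed
    have "shear_form ?a ?s ?a (abs_l2 f) = mult_op (damp ?a) (inv_fourier_l2 (mult_op (damp ?s) (fourier_l2 (abs_l2 u))))"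
      by (simp add: shear_form_def mult_op_abs[OF multiplier_damp[OF a] fi(2)] u_def[abs_def])
    also have "\<dots> = mult_op (damp ?a) (inv_fourier_l2 (abs_l2 w))"
      using s by (simp add: fourier_l2_abs[OF ui us] mult_op_abs multiplier_damp sq_integrable_fourier[OF ui us] w_def[abs_def])
    also have "\<dots> = abs_l2 (\<lambda>x. damp ?a x * fourier_integral w (- x))"
      unfolding inv
      by (rule mult_op_abs[OF multiplier_damp[OF a] sq_integrable_uminus[OF sq_integrable_fourier[OF wi ws]]])
    also have "\<dots> = abs_l2 K" by (rule arg_cong[where f=abs_l2]) (simp add: Kx fun_eq_iff)
    finally show ?thesis .
  qed
  then show "shear_form ?a ?s ?a (abs_l2 f) = abs_l2 (\<lambda>x. of_real (?c powr (-1/2)) *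
     (LINT \<eta>|lborel. exp (\<i> * of_real pi *
         (of_real (2 * x * \<eta>) + \<i> * of_real ((x\<^sup>2 + \<eta>\<^sup>2) * ?s)) / of_real ?c)
       * fourier_integral f \<eta>))"
    by (simp add: K_def[abs_def])
qed

fun atom_left :: "atom \<Rightarrow> real" where
  "atom_left (Rot \<theta>) = rot_shear \<theta>"
| "atom_left (Gauss \<alpha>) = \<alpha>"

fun atom_mid :: "atom \<Rightarrow> real" where
  "atom_mid (Rot \<theta>) = sinh \<theta>"
| "atom_mid (Gauss \<alpha>) = 0"

fun atom_right :: "atom \<Rightarrow> real" where
  "atom_right (Rot \<theta>) = rot_shear \<theta>"
| "atom_right (Gauss \<alpha>) = 0"

lemma atom_params_nonneg:
  assumes "atom_ok a"
  shows "0 \<le> atom_left a" "0 \<le> atom_mid a" "0 \<le> atom_right a"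
  using assms by (cases a; simp add: rot_shear_nonneg)+

lemma atom_op_eq:
  assumes "atom_ok a"
  shows "atom_op a = shear_form (atom_left a) (atom_mid a) (atom_right a)"
proof (cases a)
  case (Rot \<theta>)
  then show ?thesis using assms by (simp add: R_op_eq)
next
  case (Gauss \<alpha>)
  have "gauss_op \<alpha> = mult_op (damp \<alpha>)"
    by (simp add: fun_eq_iff gauss_op_def mult_op_def damp_def)
  then show ?thesis by (simp add: Gauss fun_eq_iff shear_form_def damp_zero)
qed

definition damp_mat :: "('n \<Rightarrow> real) \<Rightarrow> complex ^ 'n ^ 'n" where
  "damp_mat t = diag_mat (\<lambda>j. \<i> * of_real (t j))"

lemma chirp_damp_mat: "chirp (damp_mat t) x = (\<Prod>j\<in>UNIV. damp (t j) (x $ j))"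
proof -
  have "cdot (damp_mat t *v cvec x) (cvec x) = (\<Sum>i\<in>UNIV. \<i> * of_real (t i) * of_real (x $ i) * of_real (x $ i))"
    unfolding cdot_matrix
  proof (intro sum.cong refl)
    fix i
    have "(\<Sum>j\<in>UNIV. damp_mat t $ i $ j * cvec x $ j * cvec x $ i)
        = (\<Sum>j\<in>UNIV. if j = i then \<i> * of_real (t i) * of_real (x $ i) * of_real (x $ i) else 0)"
      by (intro sum.cong refl) (auto simp: damp_mat_def diag_mat_def cvec_def)
    then show "(\<Sum>j\<in>UNIV. damp_mat t $ i $ j * cvec x $ j * cvec x $ i)
        = \<i> * of_real (t i) * of_real (x $ i) * of_real (x $ i)" by simp
  qed
  then have "\<i> * of_real pi * cdot (damp_mat t *v cvec x) (cvec x) = (\<Sum>i\<in>UNIV. of_real (- pi * t i * (x $ i)\<^sup>2))"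
    by (simp add: sum_distrib_left power2_eq_square sum_negf[symmetric] mult_ac)
  then show ?thesis
    unfolding chirp_def damp_def by (simp only: exp_sum[OF finite] exp_of_real)
qed

lemma damp_mat_Sigma:
  fixes t :: "'n::finite \<Rightarrow> real"
  assumes "\<And>j. 0 \<le> t j"
  shows "damp_mat t \<in> Sigma_ge0"
proof -
  have "(\<chi> i j. Im (damp_mat t $ i $ j)) *v x = (\<chi> i. t i * x $ i)" for x :: "real ^ 'n"
  proof -
    have "((\<chi> i j. Im (damp_mat t $ i $ j)) *v x) $ i = (\<Sum>j\<in>UNIV. if j = i then t i * x $ i else 0)" for i
      unfolding matrix_vector_mult_def vec_lambda_beta
      by (intro sum.cong refl) (auto simp: damp_mat_def diag_mat_def)
    then show ?thesis by (simp add: vec_eq_iff)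
  qed
  then have "0 \<le> x \<bullet> ((\<chi> i j. Im (damp_mat t $ i $ j)) *v x)" for x :: "real ^ 'n"
    using assms by (simp add: inner_vec_def mult.left_commute sum_nonneg)
  moreover have "transpose (damp_mat t) = damp_mat t"
    by (simp add: damp_mat_def diag_mat_def transpose_def vec_eq_iff)
  ultimately show ?thesis by (simp add: Sigma_ge0_def)
qed

definition F_inv :: "(real ^ 'n) l2 \<Rightarrow> (real ^ 'n) l2" where
  "F_inv F = F_op (T_op (int CARD('n)) (- mat 1) F)"

lemma uminus_mat_sq: "(- mat 1 :: real ^ 'n ^ 'n) ** (- mat 1) = mat 1"
proof -
  have "((- mat 1 :: real ^ 'n ^ 'n) ** (- mat 1)) *v x = mat 1 *v x" for x
    by (simp add: uminus_mat_mult_vec flip: matrix_vector_mul_assoc)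
  then show ?thesis by (intro matrix_eq[THEN iffD2] allI)
qed

lemma F_op_F_inv [simp]: "F_op (F_inv F) = (F :: (real ^ 'n) l2)"
  by (simp add: F_inv_def F_op_F_op T_op_T_op invertible_uminus_mat uminus_mat_sq T_op_id)

lemma norm_F_op: "norm (F_op F) = norm (F :: (real ^ 'n) l2)"
proof -
  have "norm (mult_op (\<lambda>x. c) G) = norm G" if "norm c = 1" for c and G :: "(real ^ 'n) l2"
  proof -
    have "(norm (mult_op (\<lambda>x. c) G))\<^sup>2 = (norm G)\<^sup>2"
      unfolding mult_op_def
      by (subst norm_abs_l2_sq) (simp_all add: sq_integrable_mult norm_mult that norm_l2_sq)
    then show ?thesis by simp
  qed
  then show ?thesis by (simp add: F_op_eq norm_F_phase)
qed

lemma bounded_linear_F_op: "bounded_linear (F_op :: (real ^ 'n) l2 \<Rightarrow> _)"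
  unfolding F_op_eq
  by (rule bounded_linear_compose[OF bounded_linear_mult_op bounded_linear_fourier_l2]) simp

lemma inj_F_op: "inj (F_op :: (real ^ 'n) l2 \<Rightarrow> _)"
proof (rule injI)
  fix F G :: "(real ^ 'n) l2" assume "F_op F = F_op G"
  then have "norm (F_op (F - G)) = 0"
    by (simp add: linear_diff[OF bounded_linear.linear[OF bounded_linear_F_op]])
  then show "F = G" by (simp add: norm_F_op)
qed

lemma F_inv_F_op [simp]: "F_inv (F_op F) = (F :: (real ^ 'n) l2)"
  by (rule injD[OF inj_F_op]) simp

lemma fourier_conjugation:
  fixes F :: "(real ^ 'n) l2"
  assumes m: "multiplier m"
  shows "inv_fourier_l2 (mult_op m (fourier_l2 F)) = F_inv (mult_op m (F_op F))"
proof (rule injD[OF inj_F_op])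
  show "F_op (inv_fourier_l2 (mult_op m (fourier_l2 F))) = F_op (F_inv (mult_op m (F_op F)))"
    unfolding F_op_F_inv by (simp add: F_op_eq mult_op_mult_op m mult.commute)
qed

text \<open>
  Multipliers and the Fourier transform respect tensor products, so the common form of the one-variable
  factors is inherited by the tensor product; the phase that normalises the Fourier transform cancels against
  that of its inverse.
\<close>

lemma Xi_op_eq:
  fixes a :: "'n::finite \<Rightarrow> atom"
  assumes a: "\<And>j. atom_ok (a j)"
  shows "Xi_op a = (\<lambda>F. p_op (damp_mat (\<lambda>j. atom_left (a j))) (F_inv (p_op (damp_mat (\<lambda>j. atom_mid (a j)))
    (F_op (p_op (damp_mat (\<lambda>j. atom_right (a j))) F)))))"
proof -
  note n = atom_params_nonneg[OF a]
  note S = damp_mat_Sigma[of "\<lambda>j. atom_left (a j)", OF n(1)] damp_mat_Sigma[of "\<lambda>j. atom_mid (a j)", OF n(2)]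
    damp_mat_Sigma[of "\<lambda>j. atom_right (a j)", OF n(3)]
  have ch: "chirp (damp_mat t) = (\<lambda>x. \<Prod>j\<in>UNIV. damp (t j) (x $ j))" for t :: "'n \<Rightarrow> real"
    by (rule ext) (rule chirp_damp_mat)
  let ?U = "\<lambda>F :: (real ^ 'n) l2. p_op (damp_mat (\<lambda>j. atom_left (a j))) (inv_fourier_l2 (p_op (damp_mat (\<lambda>j. atom_mid (a j)))
    (fourier_l2 (p_op (damp_mat (\<lambda>j. atom_right (a j))) F))))"
  have "tensor_op (\<lambda>j. atom_op (a j)) = ?U"
  proof (rule tensor_op_eq)
    show "bounded_linear ?U"
      by (intro bounded_linear_compose[OF p_op_props(1)[OF S(1)]] bounded_linear_compose[OF bounded_linear_inv_fourier_l2]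
         bounded_linear_compose[OF p_op_props(1)[OF S(2)]] bounded_linear_compose[OF bounded_linear_fourier_l2]
         p_op_props(1)[OF S(3)])
    fix f :: "'n \<Rightarrow> real l2"
    show "?U (tensor_fun f) = tensor_fun (\<lambda>j. atom_op (a j) (f j))"
      unfolding p_op_eq ch atom_op_eq[OF a] shear_form_def
      by (simp only: mult_op_tensor[of "\<lambda>j. damp (atom_left (a j))", OF multiplier_damp[OF n(1)]]
          mult_op_tensor[of "\<lambda>j. damp (atom_mid (a j))", OF multiplier_damp[OF n(2)]]
          mult_op_tensor[of "\<lambda>j. damp (atom_right (a j))", OF multiplier_damp[OF n(3)]]
          fourier_l2_tensor inv_fourier_l2_tensor)
  qed
  then show ?thesis
    unfolding Xi_op_def p_op_eq by (simp add: fourier_conjugation[OF multiplier_chirp[OF S(2)]])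
qed

section \<open>Symplectic block matrices\<close>

lemma block_nth [simp]:
  "block A B C D $ Inl i $ Inl j = A $ i $ j" "block A B C D $ Inl i $ Inr j = B $ i $ j"
  "block A B C D $ Inr i $ Inl j = C $ i $ j" "block A B C D $ Inr i $ Inr j = D $ i $ j"
  by (simp_all add: block_def)

lemma block_eqI:
  fixes S T :: "'a ^ ('n::finite + 'n) ^ ('n + 'n)"
  assumes "\<And>i j. S $ Inl i $ Inl j = T $ Inl i $ Inl j" "\<And>i j. S $ Inl i $ Inr j = T $ Inl i $ Inr j"
    "\<And>i j. S $ Inr i $ Inl j = T $ Inr i $ Inl j" "\<And>i j. S $ Inr i $ Inr j = T $ Inr i $ Inr j"
  shows "S = T"
proof -
  have "S $ a $ b = T $ a $ b" for a b
    using assms by (cases a; cases b) simp_all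
  then show ?thesis by (simp add: vec_eq_iff)
qed

lemma sum_UNIV_sum:
  fixes f :: "'n::finite + 'n \<Rightarrow> 'a::comm_monoid_add"
  shows "(\<Sum>k\<in>UNIV. f k) = (\<Sum>k\<in>UNIV. f (Inl k)) + (\<Sum>k\<in>UNIV. f (Inr k))"
  unfolding UNIV_Plus_UNIV[symmetric] by (subst sum.Plus) simp_all

lemma block_mult:
  fixes A :: "'a::semiring_1 ^ 'n ^ 'n"
  shows "block A B C D ** block A' B' C' D'
    = block (A ** A' + B ** C') (A ** B' + B ** D') (C ** A' + D ** C') (C ** B' + D ** D')"
  by (rule block_eqI) (simp_all add: matrix_matrix_mult_def sum_UNIV_sum)

lemma block_transpose: "transpose (block A B C D) = block (transpose A) (transpose C) (transpose B) (transpose D)"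
  by (rule block_eqI) (simp_all add: transpose_def)

lemma mat_zero_mult [simp]: "(0 :: 'a::semiring_1 ^ 'n ^ 'n) ** A = 0" "A ** (0 :: 'a ^ 'n ^ 'n) = 0"
  by (simp_all add: matrix_matrix_mult_def vec_eq_iff)

lemma mat_minus_mult [simp]:
  fixes A B :: "'a::ring_1 ^ 'n ^ 'n"
  shows "(- A) ** B = - (A ** B)" "A ** (- B) = - (A ** B)"
  by (simp_all add: matrix_matrix_mult_def vec_eq_iff sum_negf)

lemma transpose_simps [simp]:
  "transpose (0 :: 'a::ab_group_add ^ 'n ^ 'n) = 0" "transpose (- A :: 'a::ab_group_add ^ 'n ^ 'n) = - transpose A"
  by (simp_all add: transpose_def vec_eq_iff)

lemma Sp_mult:
  fixes S T :: "'a::comm_ring_1 ^ ('n::finite + 'n) ^ ('n + 'n)"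
  assumes "S \<in> Sp" "T \<in> Sp" shows "S ** T \<in> Sp"
proof -
  have "transpose (S ** T) ** J_mat ** (S ** T) = transpose T ** (transpose S ** J_mat ** S) ** T"
    by (simp add: matrix_transpose_mul matrix_mul_assoc)
  then show ?thesis using assms by (simp add: Sp_def)
qed

lemma J_mat_Sp: "(J_mat :: 'a::comm_ring_1 ^ ('n::finite + 'n) ^ ('n + 'n)) \<in> Sp"
  by (simp add: Sp_def J_mat_def block_transpose block_mult transpose_mat)

lemma V_mat_Sp: "transpose Q = Q \<Longrightarrow> (V_mat Q :: 'a::comm_ring_1 ^ ('n::finite + 'n) ^ ('n + 'n)) \<in> Sp"
  by (simp add: Sp_def J_mat_def V_mat_def block_transpose block_mult transpose_mat)

lemma D_mat_Sp:
  fixes E :: "'a::field ^ 'n ^ 'n"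
  assumes "invertible E" shows "D_mat E \<in> Sp"
proof -
  have 1: "transpose (matrix_inv E) ** transpose E = mat 1"
    using matrix_inv_right[OF assms] by (metis matrix_transpose_mul transpose_mat)
  have 2: "E ** matrix_inv E = mat 1" by (rule matrix_inv_right[OF assms])
  show ?thesis
    by (simp add: Sp_def J_mat_def D_mat_def block_transpose block_mult 1 2)
qed

lemma cmat_mult: "cmat (A ** B) = cmat A ** cmat (B :: real ^ 'n ^ 'n)"
  by (simp add: cmat_def matrix_matrix_mult_def vec_eq_iff)

lemma cmat_one: "cmat (mat 1) = mat 1"
  by (simp add: cmat_def mat_def vec_eq_iff)

lemma cmat_zero: "cmat 0 = 0"
  by (simp add: cmat_def vec_eq_iff)

lemma cmat_uminus: "cmat (- A) = - cmat A"
  by (simp add: cmat_def vec_eq_iff)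

lemma cmat_transpose: "cmat (transpose A) = transpose (cmat A)"
  by (simp add: cmat_def transpose_def vec_eq_iff)

lemma cmat_inj: "cmat A = cmat B \<Longrightarrow> A = B"
  by (simp add: cmat_def vec_eq_iff)

lemma cmat_block: "cmat (block A B C D) = block (cmat A) (cmat B) (cmat C) (cmat D)"
  by (rule block_eqI) (simp_all add: cmat_def)

lemma cmat_J: "cmat J_mat = J_mat"
  by (simp add: J_mat_def cmat_block cmat_zero cmat_one cmat_uminus)

lemma cmat_V: "cmat (V_mat Q) = V_mat (cmat Q)"
  by (simp add: V_mat_def cmat_block cmat_zero cmat_one)

lemma cmat_D: "cmat (D_mat E) = block (cmat (matrix_inv E)) 0 0 (transpose (cmat E))"
  by (simp add: D_mat_def cmat_block cmat_zero cmat_transpose)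

lemma cmat_Sp: "S \<in> Sp \<Longrightarrow> cmat S \<in> Sp"
  by (metis (mono_tags, lifting) Sp_def cmat_J cmat_mult cmat_transpose mem_Collect_eq)

lemma cdot_commute: "cdot z w = cdot w z"
  by (simp add: cdot_def mult.commute)

lemma cdot_add_left: "cdot (z + z') w = cdot z w + cdot z' w"
  by (simp add: cdot_def distrib_right sum.distrib)

lemma cdot_add_right: "cdot z (w + w') = cdot z w + cdot z w'"
  by (simp add: cdot_def distrib_left sum.distrib)

lemma cdot_diff_left: "cdot (z - z') w = cdot z w - cdot z' w"
  by (simp add: cdot_def left_diff_distrib sum_subtractf)

lemma cdot_diff_right: "cdot z (w - w') = cdot z w - cdot z w'"
  by (simp add: cdot_def right_diff_distrib sum_subtractf)

lemma cdot_scale_left: "cdot (c *s z) w = c * cdot z w"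
  by (simp add: cdot_def sum_distrib_left mult.assoc)

lemma cdot_scale_right: "cdot z (c *s w) = c * cdot z w"
  by (simp add: cdot_def sum_distrib_left mult_ac)

lemma cdot_transpose: "cdot (A *v z) w = cdot z (transpose A *v w)"
proof -
  have "cdot (A *v z) w = (\<Sum>i\<in>UNIV. \<Sum>j\<in>UNIV. A $ i $ j * z $ j * w $ i)" by (rule cdot_matrix)
  also have "\<dots> = (\<Sum>j\<in>UNIV. \<Sum>i\<in>UNIV. A $ i $ j * z $ j * w $ i)" by (rule sum.swap)
  also have "\<dots> = cdot z (transpose A *v w)"
    by (simp add: cdot_def matrix_vector_mult_def transpose_def sum_distrib_left mult_ac)
  finally show ?thesis .
qed

lemma vcnj_mult: "vcnj (cmat A *v z) = cmat A *v vcnj z"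
  by (simp add: vcnj_def cmat_def matrix_vector_mult_def vec_eq_iff)

lemma symp_form_Sp:
  assumes "S \<in> Sp" shows "symp_form (S *v z) (S *v w) = symp_form z w"
proof -
  have "symp_form (S *v z) (S *v w) = cdot ((transpose S ** J_mat ** S) *v z) w"
    unfolding symp_form_def by (subst cdot_commute, subst cdot_transpose)
      (simp add: cdot_commute matrix_vector_mul_assoc matrix_mul_assoc)
  then show ?thesis using assms by (simp add: Sp_def symp_form_def)
qed

lemma cmat_Sp_plus: "S \<in> Sp \<Longrightarrow> cmat S \<in> Sp_plus"
  by (simp add: Sp_plus_def cmat_Sp vcnj_mult symp_form_Sp)

lemma Sp_plus_mult:
  assumes S: "S \<in> Sp_plus" and T: "T \<in> Sp_plus" shows "S ** T \<in> Sp_plus"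
proof -
  have "inverse \<i> * (symp_form ((S ** T) *v z) (vcnj ((S ** T) *v z)) - symp_form z (vcnj z)) \<in> \<real>\<^sub>\<ge>\<^sub>0" for z
  proof -
    have "inverse \<i> * (symp_form (S *v (T *v z)) (vcnj (S *v (T *v z))) - symp_form (T *v z) (vcnj (T *v z)))
        + inverse \<i> * (symp_form (T *v z) (vcnj (T *v z)) - symp_form z (vcnj z)) \<in> \<real>\<^sub>\<ge>\<^sub>0"
      using S T unfolding Sp_plus_def by (intro nonneg_Reals_add_I) blast+
    then show ?thesis by (simp add: matrix_vector_mul_assoc algebra_simps)
  qed
  then show ?thesis using S T by (simp add: Sp_plus_def Sp_mult)
qed

lemma cdot_sum_split:
  fixes z w :: "complex ^ ('n::finite + 'n)"
  shows "cdot z w = cdot (\<chi> i. z $ Inl i) (\<chi> i. w $ Inl i) + cdot (\<chi> i. z $ Inr i) (\<chi> i. w $ Inr i)"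
  by (simp add: cdot_def sum_UNIV_sum)

lemma block_mult_vec:
  fixes z :: "complex ^ ('n::finite + 'n)"
  defines "x \<equiv> \<chi> i. z $ Inl i" and "y \<equiv> \<chi> i. z $ Inr i"
  shows "(\<chi> i. (block A B C D *v z) $ Inl i) = A *v x + B *v y"
    and "(\<chi> i. (block A B C D *v z) $ Inr i) = C *v x + D *v y"
  by (simp_all add: matrix_vector_mult_def vec_eq_iff sum_UNIV_sum x_def y_def)

lemma symp_form_split:
  fixes z w :: "complex ^ ('n::finite + 'n)"
  shows "symp_form z w = cdot (\<chi> i. z $ Inr i) (\<chi> i. w $ Inl i) - cdot (\<chi> i. z $ Inl i) (\<chi> i. w $ Inr i)"
proof -
  have "(- mat 1 :: complex ^ 'n ^ 'n) *v x = - x" for x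
  proof -
    have "(- mat 1 :: complex ^ 'n ^ 'n) *v x = - (mat 1 *v x)"
      unfolding matrix_vector_mult_def by (simp add: vec_eq_iff sum_negf)
    then show ?thesis by simp
  qed
  moreover have "cdot (- a) b = - cdot a b" for a b :: "complex ^ 'n"
    by (simp add: cdot_def sum_negf)
  ultimately show ?thesis
    unfolding symp_form_def J_mat_def cdot_sum_split block_mult_vec
    by simp
qed

text \<open>
  The matrix sends \<open>(x, y)\<close> to \<open>(x, Q x + y)\<close>, which changes the form by \<open>2 Im (Q x \<bullet> cnj x)\<close>.  The
  symmetry of \<open>Re Q\<close> removes the mixed terms, leaving twice the values of the quadratic form of \<open>Im Q\<close> at
  the real and at the imaginary part of \<open>x\<close>.
\<close>

lemma V_mat_Sp_plus:
  assumes Q: "Q \<in> Sigma_ge0"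
  shows "V_mat Q \<in> Sp_plus"
proof -
  have "inverse \<i> * (symp_form (V_mat Q *v z) (vcnj (V_mat Q *v z)) - symp_form z (vcnj z)) \<in> \<real>\<^sub>\<ge>\<^sub>0" for z
  proof -
    define x where "x = (\<chi> i. z $ Inl i)"
    define y where "y = (\<chi> i. z $ Inr i)"
    define Y where "Y = (\<chi> i j. Im (Q $ i $ j))"
    have v: "(\<chi> i. vcnj u $ Inl i) = vcnj (\<chi> i. u $ Inl i)" "(\<chi> i. vcnj u $ Inr i) = vcnj (\<chi> i. u $ Inr i)" for u :: "complex ^ ('a + 'a)"
      by (simp_all add: vcnj_def)
    have vadd: "vcnj (a + b) = vcnj a + vcnj b" for a b :: "complex ^ 'a"
      by (simp add: vcnj_def vec_eq_iff)
    have "symp_form (V_mat Q *v z) (vcnj (V_mat Q *v z)) - symp_form z (vcnj z)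
        = cdot (Q *v x) (vcnj x) - cdot x (vcnj (Q *v x))"
      unfolding symp_form_split v V_mat_def block_mult_vec x_def[symmetric] y_def[symmetric]
      by (simp add: vadd cdot_add_left cdot_add_right)
    also have "cdot x (vcnj (Q *v x)) = cnj (cdot (Q *v x) (vcnj x))"
      by (simp add: cdot_def vcnj_def mult.commute)
    also have "cdot (Q *v x) (vcnj x) - cnj (cdot (Q *v x) (vcnj x)) = 2 * \<i> * of_real (Im (cdot (Q *v x) (vcnj x)))"
      by (simp add: complex_eq_iff)
    also have "Im (cdot (Q *v x) (vcnj x)) = (\<chi> i. Re (x $ i)) \<bullet> (Y *v (\<chi> i. Re (x $ i))) + (\<chi> i. Im (x $ i)) \<bullet> (Y *v (\<chi> i. Im (x $ i)))"
    proof -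
      have sy: "Q $ i $ j = Q $ j $ i" for i j
        using Q by (metis (mono_tags, lifting) Sigma_ge0_def mem_Collect_eq transpose_def vec_lambda_beta)
      have "Im (cdot (Q *v x) (vcnj x)) = (\<Sum>i\<in>UNIV. \<Sum>j\<in>UNIV. Im (Q $ i $ j) * (Re (x $ j) * Re (x $ i) + Im (x $ j) * Im (x $ i))
          + (Re (Q $ i $ j) * (Im (x $ j) * Re (x $ i)) - Re (Q $ i $ j) * (Re (x $ j) * Im (x $ i))))"
        unfolding cdot_matrix by (simp add: vcnj_def algebra_simps)
      also have "\<dots> = (\<Sum>i\<in>UNIV. \<Sum>j\<in>UNIV. Im (Q $ i $ j) * (Re (x $ j) * Re (x $ i) + Im (x $ j) * Im (x $ i)))
          + ((\<Sum>i\<in>UNIV. \<Sum>j\<in>UNIV. Re (Q $ i $ j) * (Im (x $ j) * Re (x $ i))) - (\<Sum>i\<in>UNIV. \<Sum>j\<in>UNIV. Re (Q $ i $ j) * (Re (x $ j) * Im (x $ i))))"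
        by (simp only: sum.distrib sum_subtractf)
      also have "(\<Sum>i\<in>UNIV. \<Sum>j\<in>UNIV. Re (Q $ i $ j) * (Re (x $ j) * Im (x $ i))) = (\<Sum>i\<in>UNIV. \<Sum>j\<in>UNIV. Re (Q $ i $ j) * (Im (x $ j) * Re (x $ i)))"
        by (subst sum.swap) (intro sum.cong refl, subst sy, simp add: mult_ac)
      finally show ?thesis
        by (simp add: Y_def inner_vec_def matrix_vector_mult_def sum_distrib_left sum.distrib[symmetric] algebra_simps)
    qed
    also have "inverse \<i> * (2 * \<i> * of_real r) = of_real (2 * r)" for r
      by simp
    finally show ?thesis
      using Q by (simp add: Sigma_ge0_def Y_def del: of_real_add)
  qed
  moreover have "transpose Q = Q" using Q by (simp add: Sigma_ge0_def)
  ultimately show ?thesis by (simp add: Sp_plus_def V_mat_Sp)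
qed

section \<open>Generalised Gaussians and the Siegel half-space\<close>

definition im_mat :: "complex ^ 'n ^ 'n \<Rightarrow> real ^ 'n ^ 'n" where
  "im_mat Z = (\<chi> i j. Im (Z $ i $ j))"

text \<open>
  Symmetric matrices with positive definite imaginary part.  The uniform lower bound, equivalent by
  compactness, is what the integrability of the Gaussians uses.
\<close>

definition siegel :: "(complex ^ 'n ^ 'n) set" where
  "siegel = {Z. transpose Z = Z \<and> (\<exists>l>0. \<forall>x. l * (norm x)\<^sup>2 \<le> x \<bullet> (im_mat Z *v x))}"

definition cgauss :: "complex ^ 'n ^ 'n \<Rightarrow> complex ^ 'n \<Rightarrow> real ^ 'n \<Rightarrow> complex" where
  "cgauss Z w x = exp (\<i> * of_real pi * cdot (Z *v cvec x) (cvec x) + 2 * (\<i> * of_real pi * cdot w (cvec x)))"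

definition siegel_form :: "complex ^ 'n ^ 'n \<Rightarrow> real ^ 'n \<Rightarrow> real ^ 'n \<Rightarrow> complex" where
  "siegel_form Z x y = \<i> * of_real pi * cdot (Z *v cvec x) (cvec y)"

definition siegel_lin :: "complex ^ 'n \<Rightarrow> real ^ 'n \<Rightarrow> complex" where
  "siegel_lin w x = \<i> * of_real pi * cdot w (cvec x)"

lemma cgauss_eq: "cgauss Z w x = exp (siegel_form Z x x + 2 * siegel_lin w x)"
  by (simp add: cgauss_def siegel_form_def siegel_lin_def)

lemma cvec_simps: "cvec (x + y) = cvec x + cvec y" "cvec (r *\<^sub>R x) = of_real r *s cvec x"
  by (simp_all add: cvec_def vec_eq_iff)

lemma transpose_siegel: "Z \<in> siegel \<Longrightarrow> transpose Z = Z"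
  by (simp add: siegel_def)

lemma im_mat_add: "im_mat (Z + W) = im_mat Z + im_mat W"
  by (simp add: im_mat_def vec_eq_iff)

lemma siegel_add_Sigma: "Z \<in> siegel \<Longrightarrow> Q \<in> Sigma_ge0 \<Longrightarrow> Z + Q \<in> siegel"
proof -
  assume Z: "Z \<in> siegel" and Q: "Q \<in> Sigma_ge0"
  obtain l where l: "0 < l" "\<And>x. l * (norm x)\<^sup>2 \<le> x \<bullet> (im_mat Z *v x)" using Z by (auto simp: siegel_def)
  have "l * (norm x)\<^sup>2 \<le> x \<bullet> (im_mat (Z + Q) *v x)" for x
    using l(2)[of x] Q by (simp add: im_mat_add matrix_vector_mult_add_rdistrib inner_add_right Sigma_ge0_def
        im_mat_def[of Q] add_increasing2)
  moreover have "transpose (Z + Q) = Z + Q"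
    using transpose_siegel[OF Z] Q by (simp add: Sigma_ge0_def transpose_def vec_eq_iff)
  ultimately show ?thesis using l(1) by (auto simp: siegel_def)
qed

lemma siegel_imp_Sigma: "Z \<in> siegel \<Longrightarrow> Z \<in> Sigma_ge0"
  unfolding siegel_def Sigma_ge0_def im_mat_def by (auto intro: order_trans[rotated])

lemma Im_siegel_form: "Re (siegel_form Z x x) = - pi * (x \<bullet> (im_mat Z *v x))"
  by (simp add: siegel_form_def im_mat_def Im_cdot)

lemma bounded_linear_siegel_lin: "bounded_linear (siegel_lin w)"
  unfolding linear_conv_bounded_linear[symmetric]
  by (rule linearI) (simp_all add: siegel_lin_def cvec_simps cdot_add_right cdot_scale_right
      algebra_simps scaleR_conv_of_real[where 'a=complex])

lemma gauss_form_siegel: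
  assumes Z: "Z \<in> siegel"
  shows "gauss_form (siegel_form Z)"
proof -
  obtain l where l: "0 < l" "\<And>x. l * (norm x)\<^sup>2 \<le> x \<bullet> (im_mat Z *v x)" using Z by (auto simp: siegel_def)
  have sym: "siegel_form Z x y = siegel_form Z y x" for x y
    unfolding siegel_form_def by (subst cdot_transpose) (simp add: transpose_siegel[OF Z] cdot_commute)
  have lin: "linear (siegel_form Z x)" for x
    by (rule linearI) (simp_all add: siegel_form_def cvec_simps cdot_add_right cdot_scale_right algebra_simps scaleR_conv_of_real[where 'a=complex])
  have "bilinear (siegel_form Z)"
    unfolding bilinear_def
  proof (intro conjI allI lin)
    fix y
    have "(\<lambda>x. siegel_form Z x y) = siegel_form Z y" by (rule ext) (rule sym)
    then show "linear (\<lambda>x. siegel_form Z x y)" using lin[of y] by simp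
  qed
  then have "bounded_bilinear (siegel_form Z)" by (simp add: bilinear_conv_bounded_bilinear)
  moreover have "Re (siegel_form Z x x) \<le> - (pi * l) * (norm x)\<^sup>2" for x
    using l(2)[of x] by (simp add: Im_siegel_form mult.assoc)
  ultimately show ?thesis using sym l(1) unfolding gauss_form_def by (intro conjI exI[of _ "pi * l"]) auto
qed

lemma integrable_cgauss: "Z \<in> siegel \<Longrightarrow> integrable lborel (\<lambda>x. c * cgauss Z w x)"
  unfolding cgauss_eq
  by (intro integrable_mult_right integrable_gauss_form(2)[OF gauss_form_siegel bounded_linear_siegel_lin bounded_linear_siegel_lin])

lemma continuous_cgauss: "continuous_on UNIV (cgauss Z w)"
  unfolding cgauss_def cdot_matrix unfolding cdot_def cvec_def
  by (intro continuous_intros)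

lemma sq_integrable_cgauss:
  assumes "Z \<in> siegel" shows "sq_integrable (\<lambda>x. c * cgauss Z w x)"
proof -
  have Z2: "Z + Z \<in> siegel" by (rule siegel_add_Sigma[OF assms siegel_imp_Sigma[OF assms]])
  have "cgauss (Z + Z) (w + w) x = cgauss Z w x * cgauss Z w x" for x
    unfolding cgauss_def mult_exp_exp matrix_vector_mult_add_rdistrib cdot_add_left
    by (simp add: algebra_simps)
  then have "(norm (c * cgauss Z w x))\<^sup>2 = norm (c\<^sup>2 * cgauss (Z + Z) (w + w) x)" for x
    by (simp add: norm_mult power_mult_distrib norm_power) (simp add: power2_eq_square)
  moreover have "(\<lambda>x. c * cgauss Z w x) \<in> borel_measurable borel"
    using borel_measurable_continuous_onI[OF continuous_cgauss] by measurable
  ultimately show ?thesis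
    unfolding sq_integrable_def using integrable_norm[OF integrable_cgauss[OF Z2]] by simp
qed

lemma abs_l2_cgauss_nonzero:
  assumes "Z \<in> siegel" "c \<noteq> 0" shows "abs_l2 (\<lambda>x. c * cgauss Z w x) \<noteq> 0"
proof
  assume "abs_l2 (\<lambda>x. c * cgauss Z w x) = 0"
  then have "AE x in lborel. c * cgauss Z w x = 0"
    using abs_l2_eqD[OF sq_integrable_cgauss[OF assms(1)] sq_integrable_zero] abs_l2_zero by metis
  then have "AE x in (lborel :: (real ^ 'a) measure). False"
    by eventually_elim (use assms(2) in \<open>simp add: cgauss_def\<close>)
  then have "UNIV \<in> null_sets (lborel :: (real ^ 'a) measure)"
    by (subst AE_iff_null_sets) auto
  then show False by (simp add: null_sets_def emeasure_lborel_UNIV)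
qed

text \<open>
  The derivative in \<open>t\<close> vanishes identically.
\<close>

lemma quadratic_exp_constant:
  fixes p q a b :: complex
  assumes a: "a \<noteq> 0" and eq: "\<And>t::real. a * exp (of_real t ^ 2 * p + of_real t * q) = b"
  shows "p = 0 \<and> q = 0"
proof -
  have "((\<lambda>z. a * exp (z ^ 2 * p + z * q)) has_field_derivative a * (exp (of_real t ^ 2 * p + of_real t * q) * (2 * of_real t * p + q))) (at (of_real t))" for t :: real
    by (auto intro!: derivative_eq_intros)
  from has_vector_derivative_real_field[OF this]
  have "((\<lambda>t::real. b) has_vector_derivative a * (exp (of_real t ^ 2 * p + of_real t * q) * (2 * of_real t * p + q))) (at t)" for t :: real
    unfolding eq .
  then have "a * (exp (of_real t ^ 2 * p + of_real t * q) * (2 * of_real t * p + q)) = 0" for t :: real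
    by (rule vector_derivative_unique_at[OF _ has_vector_derivative_const])
  then have z: "2 * of_real t * p + q = 0" for t :: real using a by simp
  show ?thesis using z[of 0] z[of 1] by simp
qed

text \<open>
  Continuous functions that agree almost everywhere agree.  On every line through the origin the quotient
  is the exponential of a polynomial of degree two and constant, so its coefficients vanish; polarisation
  recovers the matrices.
\<close>

lemma cgauss_unique:
  assumes Z: "Z \<in> siegel" "Z' \<in> siegel" and c: "c \<noteq> 0" "c' \<noteq> 0"
    and eq: "abs_l2 (\<lambda>x. c * cgauss Z w x) = abs_l2 (\<lambda>x. c' * cgauss Z' w' x)"
  shows "Z = Z' \<and> w = w'"
proof -
  let ?f = "\<lambda>x. c * cgauss Z w x" and ?g = "\<lambda>x. c' * cgauss Z' w' x"
  have ae: "AE x in lborel. ?f x = ?g x"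
    by (rule abs_l2_eqD[OF sq_integrable_cgauss[OF Z(1)] sq_integrable_cgauss[OF Z(2)] eq])
  have all: "?f x = ?g x" for x
  proof -
    have "open {x. ?f x \<noteq> ?g x}"
      by (intro open_Collect_neq continuous_intros continuous_cgauss)
    moreover have "negligible {x. ?f x \<noteq> ?g x}"
    proof -
      have "{x. ?f x \<noteq> ?g x} \<in> sets borel" by (rule borel_open) fact
      then have "{x. ?f x \<noteq> ?g x} \<in> null_sets lborel"
        using ae by (simp add: AE_iff_null)
      then show ?thesis unfolding negligible_iff_null_sets by (rule null_sets_completionI)
    qed
    ultimately have "{x. ?f x \<noteq> ?g x} = {}" using open_not_negligible by blast
    then show ?thesis by blast
  qed
  define D where "D = Z - Z'"
  define d where "d = w - w'"
  have quad: "cdot (D *v cvec x) (cvec x) = 0 \<and> cdot d (cvec x) = 0" for x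
  proof -
    let ?p = "\<i> * of_real pi * cdot (D *v cvec x) (cvec x)" and ?q = "2 * (\<i> * of_real pi * cdot d (cvec x))"
    have "c * exp (of_real t ^ 2 * ?p + of_real t * ?q) = c'" for t :: real
    proof -
      have "cgauss Z w (t *\<^sub>R x) = exp (of_real t ^ 2 * ?p + of_real t * ?q) * cgauss Z' w' (t *\<^sub>R x)"
        unfolding cgauss_def mult_exp_exp D_def d_def
        by (simp add: cvec_simps cdot_scale_right cdot_scale_left vector_scalar_commute
            matrix_vector_mult_diff_rdistrib cdot_diff_left power2_eq_square algebra_simps)
      then show ?thesis using all[of "t *\<^sub>R x"] by (simp add: cgauss_def)
    qed
    from quadratic_exp_constant[OF c(1) this] show ?thesis by simp
  qed
  have ax: "cvec (axis i 1) = axis i 1" for i :: 'a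
    by (simp add: cvec_def axis_def vec_eq_iff)
  have cax: "cdot z (axis i 1) = z $ i" for z :: "complex ^ 'a" and i
    by (simp add: cdot_def axis_def if_distrib[of "\<lambda>a. _ * a"] cong: if_cong)
  have "d = 0" using quad[of "axis i 1" for i] by (simp add: ax cax vec_eq_iff)
  moreover have "D = 0"
  proof -
    have tD: "transpose D = D"
      using transpose_siegel[OF Z(1)] transpose_siegel[OF Z(2)] by (simp add: D_def transpose_def vec_eq_iff)
    have "D $ i $ j = 0" for i j
    proof -
      let ?x = "axis i 1 :: real ^ 'a" and ?y = "axis j 1 :: real ^ 'a"
      have "cdot (D *v cvec ?x) (cvec ?y) = cdot (D *v cvec ?y) (cvec ?x)"
        by (subst cdot_transpose) (simp add: tD cdot_commute)
      then have "2 * cdot (D *v cvec ?y) (cvec ?x) = 0"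
        using quad[of "?x + ?y"] quad[of ?x] quad[of ?y]
        by (simp add: cvec_simps matrix_vector_right_distrib cdot_add_left cdot_add_right)
      moreover have "cdot (D *v cvec ?y) (cvec ?x) = D $ i $ j"
        unfolding ax cax
        by (simp add: matrix_vector_mult_def axis_def if_distrib[of "\<lambda>a. _ * a"] cong: if_cong)
      ultimately show ?thesis by simp
    qed
    then show ?thesis by (simp add: vec_eq_iff)
  qed
  ultimately show ?thesis by (simp add: D_def d_def)
qed

section \<open>The matrix of an operator\<close>

text \<open>
  The graph of the projection: an operator is related to the symplectic matrix by which it acts on
  the parameters of generalised Gaussians.  Keeping track of the linear parameter \<open>w\<close>, and not
  only of the quadratic parameter \<open>Z\<close>, fixes the sign of the matrix.
\<close>

definition acts_by :: "((real ^ 'n) l2 \<Rightarrow> (real ^ 'n) l2) \<Rightarrow> complex ^ ('n::finite + 'n) ^ ('n + 'n) \<Rightarrow> bool" where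
  "acts_by T S \<longleftrightarrow> (\<exists>A B C D. S = block A B C D \<and>
     (\<forall>Z\<in>siegel. \<forall>w c. c \<noteq> 0 \<longrightarrow> (\<exists>Z'\<in>siegel. \<exists>w' c'. c' \<noteq> 0 \<and>
        T (abs_l2 (\<lambda>x. c * cgauss Z w x)) = abs_l2 (\<lambda>x. c' * cgauss Z' w' x) \<and>
        C + D ** Z = Z' ** (A + B ** Z) \<and> transpose (A + B ** Z) *v w' = w)))"

lemma acts_byI:
  fixes A :: "complex ^ 'n ^ 'n"
  assumes "\<And>Z w c. Z \<in> siegel \<Longrightarrow> c \<noteq> 0 \<Longrightarrow> \<exists>Z'\<in>siegel. \<exists>w' c'. c' \<noteq> 0 \<and>
        T (abs_l2 (\<lambda>x. c * cgauss Z w x)) = abs_l2 (\<lambda>x. c' * cgauss Z' w' x) \<and>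
        C + D ** Z = Z' ** (A + B ** Z) \<and> transpose (A + B ** Z) *v w' = w"
  shows "acts_by T (block A B C D)"
  unfolding acts_by_def using assms by blast

lemma mat_add_mult: "(A + B) ** C = A ** C + B ** (C :: 'a::semiring_1 ^ 'n ^ 'n)"
  by (simp add: matrix_matrix_mult_def vec_eq_iff distrib_right sum.distrib)

text \<open>
  The fractional linear action composes as matrices do, because \<open>A + B Z\<close> is a cocycle: for the product it
  is the product of \<open>A + B Z\<^sub>1\<close> and \<open>A\<^sub>1 + B\<^sub>1 Z\<close>, where \<open>Z\<^sub>1\<close> is the image of \<open>Z\<close>.
\<close>

lemma acts_by_comp:
  assumes T: "acts_by T S" and U: "acts_by U R"
  shows "acts_by (T \<circ> U) (S ** R)"
proof -
  obtain A B C D where S: "S = block A B C D"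
    and T': "\<And>Z w c. Z \<in> siegel \<Longrightarrow> c \<noteq> 0 \<Longrightarrow> \<exists>Z'\<in>siegel. \<exists>w' c'. c' \<noteq> 0 \<and>
        T (abs_l2 (\<lambda>x. c * cgauss Z w x)) = abs_l2 (\<lambda>x. c' * cgauss Z' w' x) \<and>
        C + D ** Z = Z' ** (A + B ** Z) \<and> transpose (A + B ** Z) *v w' = w"
    using T unfolding acts_by_def by blast
  obtain A1 B1 C1 D1 where R: "R = block A1 B1 C1 D1"
    and U': "\<And>Z w c. Z \<in> siegel \<Longrightarrow> c \<noteq> 0 \<Longrightarrow> \<exists>Z'\<in>siegel. \<exists>w' c'. c' \<noteq> 0 \<and>
        U (abs_l2 (\<lambda>x. c * cgauss Z w x)) = abs_l2 (\<lambda>x. c' * cgauss Z' w' x) \<and>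
        C1 + D1 ** Z = Z' ** (A1 + B1 ** Z) \<and> transpose (A1 + B1 ** Z) *v w' = w"
    using U unfolding acts_by_def by blast
  show ?thesis
    unfolding S R block_mult
  proof (rule acts_byI)
    fix Z :: "complex ^ 'a ^ 'a" and w c assume Z: "Z \<in> siegel" and c: "c \<noteq> (0::complex)"
    define M1 where "M1 = A1 + B1 ** Z"
    obtain Z1 w1 c1 where 1: "Z1 \<in> siegel" "c1 \<noteq> 0"
      "U (abs_l2 (\<lambda>x. c * cgauss Z w x)) = abs_l2 (\<lambda>x. c1 * cgauss Z1 w1 x)"
      "C1 + D1 ** Z = Z1 ** M1" "transpose M1 *v w1 = w"
      using U'[OF Z c, of w] unfolding M1_def by blast
    define M2 where "M2 = A + B ** Z1"
    obtain Z2 w2 c2 where 2: "Z2 \<in> siegel" "c2 \<noteq> 0"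
      "T (abs_l2 (\<lambda>x. c1 * cgauss Z1 w1 x)) = abs_l2 (\<lambda>x. c2 * cgauss Z2 w2 x)"
      "C + D ** Z1 = Z2 ** M2" "transpose M2 *v w2 = w1"
      using T'[OF 1(1,2), of w1] unfolding M2_def by blast
    have M: "A ** A1 + B ** C1 + (A ** B1 + B ** D1) ** Z = M2 ** M1"
    proof -
      have "A ** A1 + B ** C1 + (A ** B1 + B ** D1) ** Z = A ** M1 + B ** (C1 + D1 ** Z)"
        by (simp add: M1_def matrix_add_ldistrib mat_add_mult matrix_mul_assoc algebra_simps)
      then show ?thesis unfolding 1(4) by (simp add: M2_def mat_add_mult matrix_mul_assoc)
    qed
    have N: "C ** A1 + D ** C1 + (C ** B1 + D ** D1) ** Z = Z2 ** (M2 ** M1)"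
    proof -
      have "C ** A1 + D ** C1 + (C ** B1 + D ** D1) ** Z = C ** M1 + D ** (C1 + D1 ** Z)"
        by (simp add: M1_def matrix_add_ldistrib mat_add_mult matrix_mul_assoc algebra_simps)
      also have "\<dots> = (C + D ** Z1) ** M1" unfolding 1(4) by (simp add: mat_add_mult matrix_mul_assoc)
      finally show ?thesis unfolding 2(4) by (simp add: matrix_mul_assoc)
    qed
    show "\<exists>Z'\<in>siegel. \<exists>w' c'. c' \<noteq> 0 \<and>
        (T \<circ> U) (abs_l2 (\<lambda>x. c * cgauss Z w x)) = abs_l2 (\<lambda>x. c' * cgauss Z' w' x) \<and>
        C ** A1 + D ** C1 + (C ** B1 + D ** D1) ** Z = Z' ** (A ** A1 + B ** C1 + (A ** B1 + B ** D1) ** Z) \<and>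
        transpose (A ** A1 + B ** C1 + (A ** B1 + B ** D1) ** Z) *v w' = w"
      unfolding M N
      using 1 2 by (intro bexI[of _ Z2] exI[of _ w2] exI[of _ c2])
        (simp_all add: matrix_transpose_mul flip: matrix_vector_mul_assoc)
  qed
qed

lemma siegel_scalar: "0 < t \<Longrightarrow> (\<chi> i j. if i = j then \<i> * of_real t else 0) \<in> (siegel :: (complex ^ 'n ^ 'n) set)"
proof -
  assume t: "0 < t"
  let ?Z = "(\<chi> i j. if i = j then \<i> * of_real t else 0) :: complex ^ 'n ^ 'n"
  have "im_mat ?Z *v x = t *\<^sub>R x" for x
  proof -
    have "(im_mat ?Z *v x) $ i = (\<Sum>j\<in>UNIV. if j = i then t * x $ i else 0)" for i
      unfolding matrix_vector_mult_def im_mat_def vec_lambda_beta by (intro sum.cong refl) auto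
    then show ?thesis by (simp add: vec_eq_iff)
  qed
  then have "t * (norm x)\<^sup>2 \<le> x \<bullet> (im_mat ?Z *v x)" for x by (simp add: power2_norm_eq_inner)
  moreover have "transpose ?Z = ?Z" by (simp add: transpose_def vec_eq_iff)
  ultimately show "?Z \<in> siegel" using t by (auto simp: siegel_def)
qed

lemma mult_scalar_mat: "B ** (\<chi> i j. if i = j then z else 0) = (\<chi> i j. B $ i $ j * z)"
  for B :: "complex ^ 'n ^ 'n"
  by (simp add: matrix_matrix_mult_def vec_eq_iff if_distrib[of "\<lambda>a. _ * a"] cong: if_cong)

text \<open>
  Two multiples of the identity suffice as test points.
\<close>

lemma affine_on_siegel_unique:
  fixes A B A' B' :: "complex ^ 'n ^ 'n"
  assumes "\<And>Z. Z \<in> siegel \<Longrightarrow> A + B ** Z = A' + B' ** Z"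
  shows "A = A' \<and> B = B'"
proof -
  have "A $ i $ j = A' $ i $ j \<and> B $ i $ j = B' $ i $ j" for i j
  proof -
    have e: "A $ i $ j + B $ i $ j * (\<i> * of_real t) = A' $ i $ j + B' $ i $ j * (\<i> * of_real t)" if "0 < t" for t
      using arg_cong[OF assms[OF siegel_scalar[OF that]], of "\<lambda>M. M $ i $ j"] by (simp add: mult_scalar_mat)
    have "B $ i $ j * \<i> = (A $ i $ j + B $ i $ j * (\<i> * of_real 2)) - (A $ i $ j + B $ i $ j * (\<i> * of_real 1))"
      by (simp add: algebra_simps)
    also have "\<dots> = (A' $ i $ j + B' $ i $ j * (\<i> * of_real 2)) - (A' $ i $ j + B' $ i $ j * (\<i> * of_real 1))"
      by (subst (1 2) e) simp_all
    also have "\<dots> = B' $ i $ j * \<i>" by (simp add: algebra_simps)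
    finally have "B $ i $ j = B' $ i $ j" by simp
    then show ?thesis using e[of 1] by simp
  qed
  then show ?thesis by (simp add: vec_eq_iff)
qed

text \<open>
  Surjectivity in \<open>w\<close> makes \<open>A + B Z\<close> invertible, so \<open>w'\<close> ranges over all vectors and determines
  \<open>A + B Z\<close>; then \<open>Z'\<close> determines \<open>C + D Z\<close>.
\<close>

lemma acts_by_unique:
  assumes S: "acts_by T S" and R: "acts_by T R"
  shows "S = R"
proof -
  obtain A B C D where S: "S = block A B C D"
    and T': "\<And>Z w c. Z \<in> siegel \<Longrightarrow> c \<noteq> 0 \<Longrightarrow> \<exists>Z'\<in>siegel. \<exists>w' c'. c' \<noteq> 0 \<and>
        T (abs_l2 (\<lambda>x. c * cgauss Z w x)) = abs_l2 (\<lambda>x. c' * cgauss Z' w' x) \<and>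
        C + D ** Z = Z' ** (A + B ** Z) \<and> transpose (A + B ** Z) *v w' = w"
    using S unfolding acts_by_def by blast
  obtain A1 B1 C1 D1 where R: "R = block A1 B1 C1 D1"
    and U': "\<And>Z w c. Z \<in> siegel \<Longrightarrow> c \<noteq> 0 \<Longrightarrow> \<exists>Z'\<in>siegel. \<exists>w' c'. c' \<noteq> 0 \<and>
        T (abs_l2 (\<lambda>x. c * cgauss Z w x)) = abs_l2 (\<lambda>x. c' * cgauss Z' w' x) \<and>
        C1 + D1 ** Z = Z' ** (A1 + B1 ** Z) \<and> transpose (A1 + B1 ** Z) *v w' = w"
    using R unfolding acts_by_def by blast
  have both: "A + B ** Z = A1 + B1 ** Z \<and> C + D ** Z = C1 + D1 ** Z" if Z: "Z \<in> siegel" for Z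
  proof -
    let ?M = "A + B ** Z" and ?N = "A1 + B1 ** Z"
    have common: "\<exists>w' Z'. transpose ?M *v w' = w \<and> transpose ?N *v w' = w \<and>
        C + D ** Z = Z' ** ?M \<and> C1 + D1 ** Z = Z' ** ?N" for w
    proof -
      obtain Z1 w1 c1 where 1: "Z1 \<in> siegel" "c1 \<noteq> 0"
        "T (abs_l2 (\<lambda>x. 1 * cgauss Z w x)) = abs_l2 (\<lambda>x. c1 * cgauss Z1 w1 x)"
        "C + D ** Z = Z1 ** ?M" "transpose ?M *v w1 = w"
        using T'[OF Z one_neq_zero, of w] by blast
      obtain Z2 w2 c2 where 2: "Z2 \<in> siegel" "c2 \<noteq> 0"
        "T (abs_l2 (\<lambda>x. 1 * cgauss Z w x)) = abs_l2 (\<lambda>x. c2 * cgauss Z2 w2 x)"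
        "C1 + D1 ** Z = Z2 ** ?N" "transpose ?N *v w2 = w"
        using U'[OF Z one_neq_zero, of w] by blast
      have "Z1 = Z2 \<and> w1 = w2"
        by (rule cgauss_unique[OF 1(1) 2(1) 1(2) 2(2)]) (use 1(3) 2(3) in simp)
      then show ?thesis using 1 2 by blast
    qed
    have "surj ((*v) (transpose ?M))" using common by (metis surjI)
    then obtain N where "transpose ?M ** N = mat 1"
      using matrix_right_invertible_surjective by blast
    then have N: "N ** transpose ?M = mat 1" by (simp add: matrix_left_right_inverse)
    have "transpose ?M *v v = transpose ?N *v v" for v
    proof -
      obtain w' where w': "transpose ?M *v w' = transpose ?M *v v" "transpose ?N *v w' = transpose ?M *v v"
        using common by blast
      have "N *v (transpose ?M *v w') = N *v (transpose ?M *v v)" by (simp only: w'(1))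
      then have "w' = v" by (simp only: matrix_vector_mul_assoc N matrix_vector_mul_lid)
      then show ?thesis using w'(2) by (simp only:)
    qed
    then have "transpose ?M = transpose ?N" by (intro matrix_eq[THEN iffD2] allI)
    then have "?M = ?N" by (metis transpose_transpose)
    then show ?thesis using common by metis
  qed
  show ?thesis
    using affine_on_siegel_unique[of A B A1 B1] affine_on_siegel_unique[of C D C1 D1] both
    by (simp add: S R)
qed

lemma acts_by_p_op:
  assumes Q: "Q \<in> Sigma_ge0"
  shows "acts_by (p_op Q) (V_mat Q)"
  unfolding V_mat_def
proof (rule acts_byI)
  fix Z :: "complex ^ 'a ^ 'a" and w c assume Z: "Z \<in> siegel" and c: "c \<noteq> (0::complex)"
  have e: "chirp Q x * cgauss Z w x = cgauss (Z + Q) w x" for x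
    unfolding chirp_def cgauss_def matrix_vector_mult_add_rdistrib cdot_add_left
    by (simp add: mult_exp_exp algebra_simps)
  have "p_op Q (abs_l2 (\<lambda>x. c * cgauss Z w x)) = abs_l2 (\<lambda>x. c * cgauss (Z + Q) w x)"
    by (simp add: p_op_eq mult_op_abs multiplier_chirp[OF Q] sq_integrable_cgauss[OF Z] mult.left_commute[of _ c] e)
  then show "\<exists>Z'\<in>siegel. \<exists>w' c'. c' \<noteq> 0 \<and>
        p_op Q (abs_l2 (\<lambda>x. c * cgauss Z w x)) = abs_l2 (\<lambda>x. c' * cgauss Z' w' x) \<and>
        Q + mat 1 ** Z = Z' ** (mat 1 + 0 ** Z) \<and> transpose (mat 1 + 0 ** Z) *v w' = w"
    using siegel_add_Sigma[OF Z Q] c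
    by (intro bexI[of _ "Z + Q"] exI[of _ w] exI[of _ c]) (auto simp: transpose_mat add.commute)
qed

lemma cvec_mult: "cvec (E *v x) = cmat E *v cvec x"
  by (simp add: cvec_def cmat_def matrix_vector_mult_def vec_eq_iff)

lemma cdot_minus_left: "cdot (- z) w = - cdot z w"
  by (simp add: cdot_def sum_negf)

lemma cdot_transpose_right: "cdot z (A *v w) = cdot (transpose A *v z) w"
  using cdot_transpose[of A w z] by (simp only: cdot_commute)

lemma cdot_congruence: "cdot (Z *v (A *v a)) (A *v b) = cdot ((transpose A ** Z ** A) *v a) b"
  by (simp only: cdot_transpose_right matrix_vector_mul_assoc matrix_mul_assoc)

lemma im_mat_congruence:
  fixes E :: "real ^ 'n ^ 'n"
  shows "x \<bullet> (im_mat (transpose (cmat E) ** Z ** cmat E) *v x) = (E *v x) \<bullet> (im_mat Z *v (E *v x))"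
proof -
  have "cdot ((transpose (cmat E) ** Z ** cmat E) *v cvec x) (cvec x) = cdot (Z *v cvec (E *v x)) (cvec (E *v x))"
    by (simp only: cvec_mult cdot_congruence)
  then show ?thesis by (simp add: im_mat_def flip: Im_cdot)
qed

lemma siegel_congruence:
  fixes E :: "real ^ 'n ^ 'n"
  assumes E: "invertible E" and Z: "Z \<in> siegel"
  shows "transpose (cmat E) ** Z ** cmat E \<in> siegel"
proof -
  obtain l where l: "0 < l" "\<And>x. l * (norm x)\<^sup>2 \<le> x \<bullet> (im_mat Z *v x)" using Z by (auto simp: siegel_def)
  have "inj ((*v) E)"
    using E by (metis inj_on_inverseI matrix_inv_left matrix_vector_mul_assoc matrix_vector_mul_lid)
  then obtain b where b: "0 < b" "\<And>x. b * norm x \<le> norm (E *v x)"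
    using linear_inj_bounded_below_pos[of "(*v) E"] matrix_vector_mul_linear by blast
  have "(l * b\<^sup>2) * (norm x)\<^sup>2 \<le> x \<bullet> (im_mat (transpose (cmat E) ** Z ** cmat E) *v x)" for x
  proof -
    have "(l * b\<^sup>2) * (norm x)\<^sup>2 = l * (b * norm x)\<^sup>2" by (simp add: power_mult_distrib)
    also have "\<dots> \<le> l * (norm (E *v x))\<^sup>2"
      using b l(1) by (intro mult_left_mono power_mono) auto
    also have "\<dots> \<le> x \<bullet> (im_mat (transpose (cmat E) ** Z ** cmat E) *v x)"
      unfolding im_mat_congruence by (rule l(2))
    finally show ?thesis .
  qed
  moreover have "transpose (transpose (cmat E) ** Z ** cmat E) = transpose (cmat E) ** Z ** cmat E"
    by (simp add: matrix_transpose_mul transpose_siegel[OF Z] matrix_mul_assoc)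
  moreover have "0 < l * b\<^sup>2" using l(1) b(1) by simp
  ultimately show ?thesis by (auto simp: siegel_def)
qed

lemma acts_by_T_op:
  fixes E :: "real ^ 'n ^ 'n"
  assumes E: "invertible E"
  shows "acts_by (T_op m E) (cmat (D_mat E))"
  unfolding cmat_D
proof (rule acts_byI)
  fix Z :: "complex ^ 'n ^ 'n" and w c assume Z: "Z \<in> siegel" and c: "c \<noteq> (0::complex)"
  let ?Z' = "transpose (cmat E) ** Z ** cmat E" and ?w' = "transpose (cmat E) *v w"
  let ?c' = "\<i> powi m * of_real (sqrt \<bar>det E\<bar>) * c"
  have "cdot (Z *v (cmat E *v cvec x)) (cmat E *v cvec x) = cdot (?Z' *v cvec x) (cvec x)"
    "cdot w (cmat E *v cvec x) = cdot ?w' (cvec x)" for x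
    by (rule cdot_congruence, rule cdot_transpose_right)
  then have "cgauss Z w (E *v x) = cgauss ?Z' ?w' x" for x
    by (simp only: cgauss_def cvec_mult)
  then have 1: "T_op m E (abs_l2 (\<lambda>x. c * cgauss Z w x)) = abs_l2 (\<lambda>x. ?c' * cgauss ?Z' ?w' x)"
    by (simp add: T_op_abs[OF E sq_integrable_cgauss[OF Z]] mult.assoc)
  have 2: "?c' \<noteq> 0" using c E by (simp add: invertible_det_nz)
  have ci: "cmat E ** cmat (matrix_inv E) = mat 1"
    using matrix_inv_right[OF E] by (simp add: cmat_one flip: cmat_mult)
  have 3: "transpose (cmat E) ** Z = ?Z' ** cmat (matrix_inv E)"
    by (simp add: ci flip: matrix_mul_assoc)
  have 4: "transpose (cmat (matrix_inv E)) *v ?w' = w"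
    by (simp only: matrix_vector_mul_assoc matrix_transpose_mul[symmetric] ci transpose_mat matrix_vector_mul_lid)
  show "\<exists>Z'\<in>siegel. \<exists>w' c'. c' \<noteq> 0 \<and>
        T_op m E (abs_l2 (\<lambda>x. c * cgauss Z w x)) = abs_l2 (\<lambda>x. c' * cgauss Z' w' x) \<and>
        0 + transpose (cmat E) ** Z = Z' ** (cmat (matrix_inv E) + 0 ** Z) \<and>
        transpose (cmat (matrix_inv E) + 0 ** Z) *v w' = w"
    unfolding mat_zero_mult add_0 add_0_right
    using siegel_congruence[OF E Z] 1 2 3 4 by blast
qed

definition re_vec :: "complex ^ 'n \<Rightarrow> real ^ 'n" where "re_vec z = (\<chi> i. Re (z $ i))"
definition im_vec :: "complex ^ 'n \<Rightarrow> real ^ 'n" where "im_vec z = (\<chi> i. Im (z $ i))"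

lemma re_im_vec: "z = cvec (re_vec z) + \<i> *s cvec (im_vec z)"
  by (simp add: cvec_def re_vec_def im_vec_def vec_eq_iff complex_eq_iff)

lemma norm_re_im_vec: "(norm z)\<^sup>2 = (norm (re_vec z))\<^sup>2 + (norm (im_vec z))\<^sup>2"
proof -
  have "(norm z)\<^sup>2 = (\<Sum>i\<in>UNIV. (norm (z $ i))\<^sup>2)"
    by (simp add: norm_vec_def L2_set_def sum_nonneg)
  then show ?thesis
    by (simp add: norm_vec_def L2_set_def sum_nonneg cmod_power2 sum.distrib re_vec_def im_vec_def)
qed

lemma norm_cvec: "norm (cvec x) = norm x"
  by (simp add: norm_vec_def L2_set_def cvec_def)

text \<open>
  By the symmetry of \<open>Z\<close> the mixed terms in the real and imaginary parts of \<open>u\<close> cancel.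
\<close>

lemma Im_hermitian_siegel:
  assumes Z: "transpose Z = Z"
  shows "Im (cdot (Z *v u) (vcnj u)) = re_vec u \<bullet> (im_mat Z *v re_vec u) + im_vec u \<bullet> (im_mat Z *v im_vec u)"
proof -
  have s: "cdot (Z *v a) b = cdot (Z *v b) a" for a b
    by (subst cdot_transpose) (simp add: Z cdot_commute)
  define p q where "p = cvec (re_vec u)" and "q = cvec (im_vec u)"
  have u: "u = p + \<i> *s q" unfolding p_def q_def by (rule re_im_vec)
  have v: "vcnj u = p - \<i> *s q"
    by (simp add: p_def q_def vcnj_def cvec_def re_vec_def im_vec_def vec_eq_iff complex_eq_iff)
  have "cdot (Z *v u) (vcnj u) = cdot (Z *v p) p + cdot (Z *v q) q"
    unfolding v unfolding u
    by (simp add: matrix_vector_right_distrib vector_scalar_commute cdot_add_left cdot_diff_right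
        cdot_scale_left cdot_scale_right s[of q p] algebra_simps)
  then show ?thesis by (simp add: p_def q_def Im_cdot im_mat_def)
qed

text \<open>
  The Hermitian form \<open>Im (Z u \<bullet> cnj u)\<close> is positive definite.
\<close>

lemma siegel_invertible:
  assumes Z: "Z \<in> siegel" shows "invertible Z"
proof -
  obtain l where l: "0 < l" "\<And>x. l * (norm x)\<^sup>2 \<le> x \<bullet> (im_mat Z *v x)" using Z by (auto simp: siegel_def)
  have "u = 0" if "Z *v u = 0" for u
  proof -
    have "l * (norm u)\<^sup>2 \<le> Im (cdot (Z *v u) (vcnj u))"
      unfolding Im_hermitian_siegel[OF transpose_siegel[OF Z]] norm_re_im_vec[of u]
      using l(2)[of "re_vec u"] l(2)[of "im_vec u"] by (simp add: distrib_left)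
    also have "\<dots> = 0" by (simp add: that cdot_def)
    finally show "u = 0" using l(1) by (simp add: mult_le_0_iff)
  qed
  then have "\<exists>B. B ** Z = mat 1" by (simp add: matrix_left_invertible_ker)
  then show ?thesis by (metis invertible_def matrix_left_right_inverse)
qed

text \<open>
  With \<open>u = inverse Z x\<close> the form of \<open>- inverse Z\<close> at \<open>x\<close> has the imaginary part \<open>Im (Z u \<bullet> cnj u)\<close>, which is
  bounded below by a multiple of \<open>|u|\<^sup>2\<close> and hence of \<open>|x|\<^sup>2\<close>.
\<close>

lemma siegel_minus_inverse:
  assumes Z: "Z \<in> siegel" shows "- matrix_inv Z \<in> siegel"
proof -
  obtain l where l: "0 < l" "\<And>x. l * (norm x)\<^sup>2 \<le> x \<bullet> (im_mat Z *v x)" using Z by (auto simp: siegel_def)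
  note inv = matrix_inv_right[OF siegel_invertible[OF Z]] matrix_inv_left[OF siegel_invertible[OF Z]]
  have tr: "transpose (matrix_inv Z) = matrix_inv Z"
  proof -
    have "transpose (matrix_inv Z) ** Z = mat 1"
      using inv(1) by (metis matrix_transpose_mul transpose_mat transpose_siegel[OF Z])
    then have "transpose (matrix_inv Z) ** (Z ** matrix_inv Z) = matrix_inv Z"
      by (simp add: matrix_mul_assoc)
    then show ?thesis by (simp add: inv)
  qed
  have "bounded_linear ((*v) Z)"
    unfolding linear_conv_bounded_linear[symmetric]
  proof (rule linearI)
    show "Z *v (a + b) = Z *v a + Z *v b" for a b by (rule matrix_vector_right_distrib)
    show "Z *v (r *\<^sub>R a) = r *\<^sub>R (Z *v a)" for r a
      by (simp add: matrix_vector_mult_def vec_eq_iff scaleR_sum_right)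
  qed
  then obtain K where K: "0 < K" "\<And>u. norm (Z *v u) \<le> norm u * K"
    using bounded_linear.pos_bounded by blast
  have "(l / K\<^sup>2) * (norm x)\<^sup>2 \<le> x \<bullet> (im_mat (- matrix_inv Z) *v x)" for x
  proof -
    define u where "u = matrix_inv Z *v cvec x"
    have Zu: "Z *v u = cvec x" by (simp add: u_def matrix_vector_mul_assoc inv)
    have "norm x \<le> norm u * K" using K(2)[of u] by (simp add: Zu norm_cvec)
    then have "(norm x)\<^sup>2 \<le> (norm u * K)\<^sup>2" by (intro power_mono) auto
    then have "(l / K\<^sup>2) * (norm x)\<^sup>2 \<le> (l / K\<^sup>2) * (norm u * K)\<^sup>2"
      using l(1) by (intro mult_left_mono) auto
    also have "\<dots> = l * (norm u)\<^sup>2" using K(1) by (simp add: power_mult_distrib)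
    also have "\<dots> \<le> Im (cdot (Z *v u) (vcnj u))"
      unfolding Im_hermitian_siegel[OF transpose_siegel[OF Z]] norm_re_im_vec[of u]
      using l(2)[of "re_vec u"] l(2)[of "im_vec u"] by (simp add: distrib_left)
    also have "cdot (Z *v u) (vcnj u) = cnj (cdot u (cvec x))"
      unfolding Zu by (simp add: cdot_def vcnj_def cvec_def mult.commute)
    also have "Im (cnj (cdot u (cvec x))) = Im (cdot ((- matrix_inv Z) *v cvec x) (cvec x))"
    proof -
      have "(- matrix_inv Z) *v cvec x = - u"
        unfolding u_def matrix_vector_mult_def by (simp add: vec_eq_iff sum_negf)
      then show ?thesis by (simp add: cdot_minus_left)
    qed
    finally show ?thesis by (simp add: Im_cdot im_mat_def)
  qed
  moreover have "0 < l / K\<^sup>2" using l(1) K(1) by simp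
  moreover have "transpose (- matrix_inv Z) = - matrix_inv Z" by (simp add: tr)
  ultimately show ?thesis by (auto simp: siegel_def)
qed

text \<open>
  Write the linear term as \<open>Z a\<close> with \<open>a = inverse Z (w - \<xi>)\<close>, a complex vector, and complete the square.
\<close>

lemma fourier_cgauss:
  fixes Z :: "complex ^ 'n ^ 'n"
  assumes Z: "Z \<in> siegel"
  shows "fourier_integral (\<lambda>x. c * cgauss Z w x) \<xi>
    = c * gauss_int (siegel_form Z) (\<lambda>x. 0) * exp (- (\<i> * of_real pi * cdot w (matrix_inv Z *v w)))
      * cgauss (- matrix_inv Z) (matrix_inv Z *v w) \<xi>"
proof -
  note inv = matrix_inv_right[OF siegel_invertible[OF Z]]
  define v where "v = w - cvec \<xi>"
  define a where "a = matrix_inv Z *v v"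
  have Za: "Z *v a = v" by (simp add: a_def matrix_vector_mul_assoc inv)
  have s: "cdot (Z *v p) q = cdot (Z *v q) p" for p q
    by (subst cdot_transpose) (simp add: transpose_siegel[OF Z] cdot_commute)
  have a_split: "a = cvec (re_vec a) + \<i> *s cvec (im_vec a)" by (rule re_im_vec)
  have lin: "siegel_lin v x = 1 * siegel_form Z x (re_vec a) + \<i> * siegel_form Z x (im_vec a)" for x
  proof -
    have "siegel_lin v x = \<i> * of_real pi * cdot (Z *v cvec x) a"
      unfolding siegel_lin_def Za[symmetric] by (simp add: s)
    also have "cdot (Z *v cvec x) a = cdot (Z *v cvec x) (cvec (re_vec a)) + \<i> * cdot (Z *v cvec x) (cvec (im_vec a))"
      by (subst a_split) (simp add: cdot_add_right cdot_scale_right)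
    finally show ?thesis by (simp add: siegel_form_def algebra_simps)
  qed
  have "fourier_integral (\<lambda>x. c * cgauss Z w x) \<xi> = c * gauss_int (siegel_form Z) (siegel_lin v)"
  proof -
    have cr: "cdot (cvec \<xi>) (cvec x) = of_real (\<xi> \<bullet> x)" for x
      by (simp add: cdot_def cvec_def inner_vec_def)
    have "cgauss Z w x * exp (- (2 * of_real pi * \<i> * of_real (\<xi> \<bullet> x))) = exp (siegel_form Z x x + 2 * siegel_lin v x)" for x
      unfolding cgauss_eq v_def siegel_lin_def cdot_diff_left cr mult.assoc mult_exp_exp
      by (simp add: algebra_simps)
    then show ?thesis by (simp add: fourier_integral_def gauss_int_def mult.assoc)
  qed
  also have "siegel_lin v = (\<lambda>x. 1 * siegel_form Z x (re_vec a) + \<i> * siegel_form Z x (im_vec a))"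
    by (rule ext) (rule lin)
  also have "gauss_int (siegel_form Z) \<dots> = exp (- (1\<^sup>2 * siegel_form Z (re_vec a) (re_vec a)
     + \<i>\<^sup>2 * siegel_form Z (im_vec a) (im_vec a) + 2 * 1 * \<i> * siegel_form Z (im_vec a) (re_vec a)))
     * gauss_int (siegel_form Z) (\<lambda>x. 0)"
    by (rule gauss_int_complex_point[OF gauss_form_siegel[OF Z]])
  also have "1\<^sup>2 * siegel_form Z (re_vec a) (re_vec a) + \<i>\<^sup>2 * siegel_form Z (im_vec a) (im_vec a)
      + 2 * 1 * \<i> * siegel_form Z (im_vec a) (re_vec a) = \<i> * of_real pi * cdot (Z *v a) a"
  proof -
    have "cdot (Z *v a) a = cdot (Z *v cvec (re_vec a)) (cvec (re_vec a))
       + \<i>\<^sup>2 * cdot (Z *v cvec (im_vec a)) (cvec (im_vec a)) + 2 * \<i> * cdot (Z *v cvec (im_vec a)) (cvec (re_vec a))"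
      by (subst (1 2) a_split)
        (simp add: matrix_vector_right_distrib vector_scalar_commute cdot_add_left cdot_add_right
          cdot_scale_left cdot_scale_right s[of "cvec (re_vec a)" "cvec (im_vec a)"] algebra_simps)
    then show ?thesis unfolding siegel_form_def by (simp only:) (simp add: algebra_simps)
  qed
  also have "exp (- (\<i> * of_real pi * cdot (Z *v a) a)) = exp (- (\<i> * of_real pi * cdot w (matrix_inv Z *v w)))
      * cgauss (- matrix_inv Z) (matrix_inv Z *v w) \<xi>"
  proof -
    have ti: "transpose (matrix_inv Z) = matrix_inv Z"
      using transpose_siegel[OF siegel_minus_inverse[OF Z]] by simp
    have neg: "(- matrix_inv Z) *v y = - (matrix_inv Z *v y)" for y
      unfolding matrix_vector_mult_def by (simp add: vec_eq_iff sum_negf)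
    have "cdot (Z *v a) a = cdot w (matrix_inv Z *v w) - 2 * cdot (matrix_inv Z *v w) (cvec \<xi>)
       + cdot (matrix_inv Z *v cvec \<xi>) (cvec \<xi>)"
    proof -
      have "cdot w (matrix_inv Z *v cvec \<xi>) = cdot (matrix_inv Z *v w) (cvec \<xi>)"
        by (simp add: cdot_transpose ti)
      moreover have "cdot (cvec \<xi>) (matrix_inv Z *v w) = cdot (matrix_inv Z *v w) (cvec \<xi>)" by (rule cdot_commute)
      moreover have "cdot (cvec \<xi>) (matrix_inv Z *v cvec \<xi>) = cdot (matrix_inv Z *v cvec \<xi>) (cvec \<xi>)" by (rule cdot_commute)
      ultimately show ?thesis
        unfolding Za unfolding a_def v_def
        by (simp add: matrix_vector_mult_diff_distrib cdot_diff_left cdot_diff_right)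
    qed
    then show ?thesis
      unfolding cgauss_def neg cdot_minus_left mult_exp_exp by (simp only:) (simp add: algebra_simps)
  qed
  finally show ?thesis by (simp add: mult_ac)
qed

text \<open>
  The Fourier transform takes \<open>(Z, w)\<close> to \<open>(- inverse Z, inverse Z w)\<close>.  The constant that it produces need
  not be evaluated: it is nonzero because the transform is injective.
\<close>

lemma acts_by_F_op: "acts_by (F_op :: (real ^ 'n) l2 \<Rightarrow> _) J_mat"
  unfolding J_mat_def
proof (rule acts_byI)
  fix Z :: "complex ^ 'n ^ 'n" and w c assume Z: "Z \<in> siegel" and c: "c \<noteq> (0::complex)"
  let ?Z' = "- matrix_inv Z" and ?w' = "matrix_inv Z *v w"
  let ?c' = "F_phase CARD('n) * (c * gauss_int (siegel_form Z) (\<lambda>x. 0) * exp (- (\<i> * of_real pi * cdot w (matrix_inv Z *v w))))"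
  have F: "F_op (abs_l2 (\<lambda>x. c * cgauss Z w x)) = abs_l2 (\<lambda>x. ?c' * cgauss ?Z' ?w' x)"
  proof -
    note i = integrable_cgauss[OF Z] sq_integrable_cgauss[OF Z]
    have "F_op (abs_l2 (\<lambda>x. c * cgauss Z w x))
        = abs_l2 (\<lambda>x. F_phase CARD('n) * fourier_integral (\<lambda>x. c * cgauss Z w x) x)"
      unfolding F_op_eq fourier_l2_abs[OF i] by (rule mult_op_abs[OF multiplier_const sq_integrable_fourier[OF i]])
    then show ?thesis by (simp only: fourier_cgauss[OF Z] mult.assoc)
  qed
  have "?c' \<noteq> 0"
  proof
    assume z: "?c' = 0"
    have "F_op (abs_l2 (\<lambda>x. c * cgauss Z w x)) = 0" by (simp only: F z mult_zero_left abs_l2_zero)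
    then have "norm (abs_l2 (\<lambda>x. c * cgauss Z w x)) = 0" by (metis norm_F_op norm_zero)
    then show False using abs_l2_cgauss_nonzero[OF Z c] by simp
  qed
  moreover have "- mat 1 = ?Z' ** Z"
    by (simp add: matrix_inv_left[OF siegel_invertible[OF Z]])
  moreover have "transpose Z *v ?w' = w"
    by (simp add: transpose_siegel[OF Z] matrix_vector_mul_assoc matrix_inv_right[OF siegel_invertible[OF Z]])
  ultimately show "\<exists>Z'\<in>siegel. \<exists>w' c'. c' \<noteq> 0 \<and>
        F_op (abs_l2 (\<lambda>x. c * cgauss Z w x)) = abs_l2 (\<lambda>x. c' * cgauss Z' w' x) \<and>
        - mat 1 + 0 ** Z = Z' ** (0 + mat 1 ** Z) \<and> transpose (0 + mat 1 ** Z) *v w' = w"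
    unfolding mat_zero_mult add_0 add_0_right matrix_mul_lid
    using siegel_minus_inverse[OF Z] F by blast
qed

section \<open>The real metaplectic group\<close>

text \<open>
  Induction over a group generated by a set would need the projection of an inverse; if the generators
  have their inverses among the products of generators, induction over the semigroup is enough.
\<close>

lemma generated_group_eq_semigroup:
  assumes inv: "\<And>T. T \<in> G \<Longrightarrow> bij T \<and> inv T \<in> generated_semigroup G"
    and one: "id \<in> generated_semigroup G"
  shows "generated_group G = generated_semigroup G"
proof
  have semi: "bij T \<and> inv T \<in> generated_semigroup G" if "T \<in> generated_semigroup G" for T
    using that
  proof induction
    case (base T)
    then show ?case by (rule inv)
  next
    case (comp T U)
    have "bij (T \<circ> U)" using comp.IH by (intro bij_comp) blast+
    moreover have "inv (T \<circ> U) = inv U \<circ> inv T" using comp.IH by (intro o_inv_distrib) blast+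
    moreover have "inv U \<circ> inv T \<in> generated_semigroup G"
      using comp.IH by (intro generated_semigroup.comp) blast+
    ultimately show ?case by (simp only:)
  qed
  show "generated_group G \<subseteq> generated_semigroup G"
  proof
    fix T assume "T \<in> generated_group G"
    then show "T \<in> generated_semigroup G"
    proof induction
      case one
      show ?case by (rule assms(2))
    next
      case (base T)
      then show ?case by (rule generated_semigroup.base)
    next
      case (inverse T)
      then show ?case using semi by blast
    next
      case (comp T U)
      show ?case by (rule generated_semigroup.comp[OF comp.IH])
    qed
  qed
  show "generated_semigroup G \<subseteq> generated_group G"
  proof
    fix T assume "T \<in> generated_semigroup G"
    then show "T \<in> generated_group G"
    proof induction
      case (base T)
      then show ?case by (rule generated_group.base)
    next
      case (comp T U)
      show ?case by (rule generated_group.comp[OF comp.IH])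
    qed
  qed
qed

definition Mp_gens :: "((real ^ 'n) l2 \<Rightarrow> (real ^ 'n) l2) set" where
  "Mp_gens = {F_op} \<union> {p_op (cmat Q) |Q. transpose Q = Q} \<union> {T_op m E |m E. T_admissible m E}"

lemma real_Sigma: "transpose Q = Q \<Longrightarrow> cmat Q \<in> Sigma_ge0"
proof -
  assume "transpose Q = Q"
  then have "transpose (cmat Q) = cmat Q" by (simp flip: cmat_transpose)
  moreover have "(\<chi> i j. Im (cmat Q $ i $ j)) = 0" by (simp add: cmat_def vec_eq_iff)
  ultimately show ?thesis by (simp add: Sigma_ge0_def)
qed

lemma T_admissible_invertible: "T_admissible m E \<Longrightarrow> invertible E"
  by (simp add: T_admissible_def)

lemma exp_int_pi: "exp (\<i> * of_real (of_int m * pi)) = (if even m then 1 else - 1)"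
proof -
  have c: "cis (2 * pi * of_int k) = 1" for k by (rule cis_multiple_2pi) simp
  have "cis (of_int m * pi) = (if even m then 1 else - 1)"
  proof (cases "even m")
    case True
    then obtain k where "m = 2 * k" by blast
    then show ?thesis using c[of k] by (simp add: mult_ac)
  next
    case False
    then obtain k where "m = 2 * k + 1" by (elim oddE)
    then have "cis (of_int m * pi) = cis (2 * pi * of_int k) * cis pi"
      unfolding cis_mult by (simp add: algebra_simps)
    then show ?thesis using False c[of k] by simp
  qed
  then show ?thesis by (simp add: cis_conv_exp)
qed

lemma T_admissible_iff:
  fixes E :: "real ^ 'n ^ 'n"
  shows "T_admissible m E \<longleftrightarrow> det E \<noteq> 0 \<and> (even m \<longleftrightarrow> 0 < det E)"
proof -
  have "of_real (det E) = of_real \<bar>det E\<bar> * (if even m then 1 else - 1 :: complex)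
      \<longleftrightarrow> det E = \<bar>det E\<bar> * (if even m then 1 else - 1)"
    by (auto simp flip: of_real_mult of_real_minus)
  then show ?thesis
    unfolding T_admissible_def is_Arg_def exp_int_pi invertible_det_nz by auto
qed

lemma T_admissible_inverse:
  fixes E :: "real ^ 'n ^ 'n"
  assumes "T_admissible m E" shows "T_admissible (- m) (matrix_inv E)"
proof -
  have d: "det E * det (matrix_inv E) = 1"
    using matrix_inv_right[OF T_admissible_invertible[OF assms]] by (metis det_I det_mul)
  then have "det (matrix_inv E) \<noteq> 0" "0 < det E \<longleftrightarrow> 0 < det (matrix_inv E)"
    by (auto simp: zero_less_mult_iff dest: arg_cong[of _ 1 "\<lambda>x. 0 < x"])
  then show ?thesis using assms by (simp add: T_admissible_iff)
qed

lemma T_op_inverse: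
  fixes E :: "real ^ 'n ^ 'n"
  assumes "invertible E"
  shows "T_op (- m) (matrix_inv E) (T_op m E F) = F" "T_op m E (T_op (- m) (matrix_inv E) F) = F"
proof -
  have "invertible (matrix_inv E)"
    using matrix_inv_both[OF assms] by (auto simp: invertible_def)
  then show "T_op (- m) (matrix_inv E) (T_op m E F) = F" "T_op m E (T_op (- m) (matrix_inv E) F) = F"
    by (simp_all add: T_op_T_op assms matrix_inv_both T_op_id)
qed

lemma T_admissible_id: "T_admissible 0 (mat 1 :: real ^ 'n ^ 'n)"
  by (simp add: T_admissible_iff)

lemma T_admissible_uminus: "T_admissible (int CARD('n)) (- mat 1 :: real ^ 'n ^ 'n)"
  by (auto simp: T_admissible_iff det_uminus_mat minus_one_power_iff)

lemma Mp_eq_semigroup: "(Mp :: ((real ^ 'n) l2 \<Rightarrow> (real ^ 'n) l2) set) = generated_semigroup Mp_gens"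
  unfolding Mp_def Mp_gens_def[symmetric]
proof (rule generated_group_eq_semigroup)
  have T: "T_op m E \<in> generated_semigroup Mp_gens" if "T_admissible m E" for m and E :: "real ^ 'n ^ 'n"
    by (rule generated_semigroup.base) (use that in \<open>auto simp: Mp_gens_def\<close>)
  show "id \<in> generated_semigroup (Mp_gens :: ((real ^ 'n) l2 \<Rightarrow> (real ^ 'n) l2) set)"
    using T[OF T_admissible_id] by (simp add: T_op_id)
  have inverse: "bij T \<and> inv T = U" if "\<And>F. U (T F) = F" "\<And>F. T (U F) = F" for T U :: "(real ^ 'n) l2 \<Rightarrow> (real ^ 'n) l2"
  proof -
    have "U \<circ> T = id" "T \<circ> U = id" using that by auto
    then show ?thesis using o_bij inv_unique_comp by blast
  qed
  fix T :: "(real ^ 'n) l2 \<Rightarrow> (real ^ 'n) l2" assume "T \<in> Mp_gens"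
  then consider "T = F_op" | Q where "transpose Q = Q" "T = p_op (cmat Q)" | m E where "T_admissible m E" "T = T_op m E"
    by (auto simp: Mp_gens_def)
  then show "bij T \<and> inv T \<in> generated_semigroup Mp_gens"
  proof cases
    case 1
    have "F_inv = F_op \<circ> T_op (int CARD('n)) (- mat 1 :: real ^ 'n ^ 'n)" by (simp add: fun_eq_iff F_inv_def)
    moreover have "F_op \<in> generated_semigroup (Mp_gens :: ((real ^ 'n) l2 \<Rightarrow> (real ^ 'n) l2) set)"
      by (rule generated_semigroup.base) (simp add: Mp_gens_def)
    ultimately have "F_inv \<in> generated_semigroup (Mp_gens :: ((real ^ 'n) l2 \<Rightarrow> (real ^ 'n) l2) set)"
      using generated_semigroup.comp T[OF T_admissible_uminus] by metis
    then show ?thesis using inverse[of F_inv F_op] 1 by simp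
  next
    case (2 Q)
    have s: "transpose (- Q) = - Q" using 2 by simp
    have z: "cmat Q + cmat (- Q) = 0" "cmat (- Q) + cmat Q = 0" by (simp_all add: cmat_uminus)
    have "p_op (cmat (- Q)) \<in> generated_semigroup Mp_gens"
      by (rule generated_semigroup.base) (use s in \<open>auto simp: Mp_gens_def\<close>)
    then show ?thesis
      using inverse[of "p_op (cmat (- Q))" "p_op (cmat Q)"] 2
      by (simp add: p_op_p_op real_Sigma s z p_op_zero)
  next
    case (3 m E)
    then show ?thesis
      using inverse[of "T_op (- m) (matrix_inv E)" "T_op m E"] T[OF T_admissible_inverse]
      by (simp add: T_op_inverse T_admissible_invertible)
  qed
qed

lemma acts_by_Mp:
  assumes "T \<in> Mp" shows "\<exists>S\<in>Sp. acts_by T (cmat S)"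
  using assms unfolding Mp_eq_semigroup
proof induction
  case (base T)
  then consider "T = F_op" | Q where "transpose Q = Q" "T = p_op (cmat Q)" | m E where "T_admissible m E" "T = T_op m E"
    by (auto simp: Mp_gens_def)
  then show ?case
  proof cases
    case 1
    then show ?thesis using acts_by_F_op J_mat_Sp by (metis cmat_J)
  next
    case (2 Q)
    then show ?thesis using acts_by_p_op[OF real_Sigma[OF 2(1)]] V_mat_Sp by (metis cmat_V)
  next
    case (3 m E)
    then show ?thesis using acts_by_T_op D_mat_Sp T_admissible_invertible by metis
  qed
next
  case (comp T U)
  then show ?case using acts_by_comp Sp_mult by (metis cmat_mult)
qed

lemma Mp_comp: "T \<in> Mp \<Longrightarrow> U \<in> Mp \<Longrightarrow> T \<circ> U \<in> Mp"
  unfolding Mp_def by (rule generated_group.comp)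

lemma Mp_gens_in:
  "F_op \<in> Mp" "transpose Q = Q \<Longrightarrow> p_op (cmat Q) \<in> Mp" "T_admissible m E \<Longrightarrow> T_op m E \<in> Mp"
  unfolding Mp_def by (auto intro!: generated_group.base)

text \<open>
  Choosing for every operator a matrix by which it acts gives a function with all the required properties,
  since the matrix is unique.  Conversely every such function sends an operator to a matrix by which it acts,
  by induction over products of generators; so there is only one.
\<close>

lemma pi_Mp_acts_by:
  assumes "(T :: (real ^ 'n) l2 \<Rightarrow> (real ^ 'n) l2) \<in> Mp"
  shows "acts_by T (cmat (pi_Mp T))"
proof -
  define p0 where "p0 = (\<lambda>T \<in> (Mp :: ((real ^ 'n) l2 \<Rightarrow> (real ^ 'n) l2) set). SOME S. S \<in> Sp \<and> acts_by T (cmat S))"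
  have p0: "p0 T \<in> Sp" "acts_by T (cmat (p0 T))" if "T \<in> Mp" for T
    using someI_ex[OF acts_by_Mp[OF that, unfolded Bex_def]] that by (simp_all add: p0_def)
  have uniq: "p0 T = S" if "T \<in> Mp" "acts_by T (cmat S)" for T S
    by (rule cmat_inj) (rule acts_by_unique[OF p0(2)[OF that(1)] that(2)])
  have "pi_Mp = p0"
    unfolding pi_Mp_def
  proof (rule the_equality)
    have "p0 (T \<circ> U) = p0 T ** p0 U" if "T \<in> Mp" "U \<in> Mp" for T U
      by (rule uniq[OF Mp_comp[OF that]]) (simp add: cmat_mult acts_by_comp p0 that)
    moreover have "p0 F_op = J_mat" by (rule uniq[OF Mp_gens_in(1)]) (simp add: cmat_J acts_by_F_op)
    moreover have "p0 (p_op (cmat Q)) = V_mat Q" if "transpose Q = Q" for Q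
      by (rule uniq[OF Mp_gens_in(2)[OF that]]) (simp add: cmat_V acts_by_p_op real_Sigma that)
    moreover have "p0 (T_op m E) = D_mat E" if "T_admissible m E" for m E
      by (rule uniq[OF Mp_gens_in(3)[OF that]]) (rule acts_by_T_op[OF T_admissible_invertible[OF that]])
    moreover have "p0 \<in> Mp \<rightarrow>\<^sub>E Sp" using p0(1) by (auto simp: p0_def PiE_def extensional_def)
    ultimately show "p0 \<in> Mp \<rightarrow>\<^sub>E Sp \<and> (\<forall>T\<in>Mp. \<forall>U\<in>Mp. p0 (T \<circ> U) = p0 T ** p0 U) \<and> p0 F_op = J_mat \<and>
      (\<forall>Q. transpose Q = Q \<longrightarrow> p0 (p_op (cmat Q)) = V_mat Q) \<and>
      (\<forall>m E. T_admissible m E \<longrightarrow> p0 (T_op m E) = D_mat E)"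
      by blast
    fix p :: "((real ^ 'n) l2 \<Rightarrow> (real ^ 'n) l2) \<Rightarrow> real ^ ('n + 'n) ^ ('n + 'n)"
    assume p: "p \<in> Mp \<rightarrow>\<^sub>E Sp \<and> (\<forall>T\<in>Mp. \<forall>U\<in>Mp. p (T \<circ> U) = p T ** p U) \<and> p F_op = J_mat \<and>
      (\<forall>Q. transpose Q = Q \<longrightarrow> p (p_op (cmat Q)) = V_mat Q) \<and>
      (\<forall>m E. T_admissible m E \<longrightarrow> p (T_op m E) = D_mat E)"
    have "acts_by T (cmat (p T))" if "T \<in> generated_semigroup Mp_gens" for T
      using that
    proof induction
      case (base T)
      then show ?case
        using p acts_by_F_op acts_by_p_op[OF real_Sigma] acts_by_T_op[OF T_admissible_invertible]
        by (auto simp: Mp_gens_def cmat_J cmat_V)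
    next
      case (comp T U)
      have "p (T \<circ> U) = p T ** p U" using p comp.hyps unfolding Mp_eq_semigroup by blast
      then show ?case by (simp only: cmat_mult) (rule acts_by_comp[OF comp.IH])
    qed
    then have "p T = p0 T" if "T \<in> Mp" for T
      using uniq[OF that, of "p T"] that by (simp add: Mp_eq_semigroup)
    then show "p = p0"
      using p by (intro extensionalityI[of _ Mp]) (auto simp: p0_def PiE_def)
  qed
  then show ?thesis using p0(2)[OF assms] by simp
qed

section \<open>The metaplectic semigroup\<close>

lemma diag_block_mult:
  "block (diag_mat a) (diag_mat b) (diag_mat c) (diag_mat d) ** block (diag_mat a') (diag_mat b') (diag_mat c') (diag_mat d')
    = block (diag_mat (\<lambda>j. a j * a' j + b j * c' j)) (diag_mat (\<lambda>j. a j * b' j + b j * d' j))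
       (diag_mat (\<lambda>j. c j * a' j + d j * c' j)) (diag_mat (\<lambda>j. c j * b' j + d j * d' (j :: 'n::finite) :: complex))"
proof -
  have m: "diag_mat f ** diag_mat g = diag_mat (\<lambda>j. f j * g j)" for f g :: "'n \<Rightarrow> complex"
  proof -
    have "(diag_mat f ** diag_mat g) $ i $ k = (\<Sum>j\<in>UNIV. if j = i then f i * (if i = k then g i else 0) else 0)" for i k
      unfolding matrix_matrix_mult_def vec_lambda_beta by (intro sum.cong refl) (auto simp: diag_mat_def)
    then show ?thesis by (simp add: vec_eq_iff diag_mat_def)
  qed
  have a: "diag_mat f + diag_mat g = diag_mat (\<lambda>j. f j + g j)" for f g :: "'n \<Rightarrow> complex"
    by (simp add: vec_eq_iff diag_mat_def)
  show ?thesis by (simp only: block_mult m a)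
qed

lemma diag_mat_const: "(mat 1 :: complex ^ 'n ^ 'n) = diag_mat (\<lambda>j. 1)" "(0 :: complex ^ 'n ^ 'n) = diag_mat (\<lambda>j. 0)"
  "- diag_mat f = diag_mat (\<lambda>j. - f j :: complex)"
  by (simp_all add: vec_eq_iff mat_def diag_mat_def)

text \<open>
  The entries of the product of the three shears.  For rotations these are the half-angle identities
  \<open>cosh \<theta> = 1 + sinh \<theta> tanh (\<theta> / 2)\<close> and \<open>sinh \<theta> = 2 tanh (\<theta> / 2) + sinh \<theta> (tanh (\<theta> / 2))\<^sup>2\<close>.
\<close>

lemma atom_mat_factors:
  assumes "atom_ok a"
  shows "atom_mat a $ 1 $ 1 = 1 + of_real (atom_mid a * atom_right a)"
    "atom_mat a $ 1 $ 2 = - \<i> * of_real (atom_mid a)"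
    "atom_mat a $ 2 $ 1 = \<i> * of_real (atom_left a + atom_right a + atom_left a * atom_mid a * atom_right a)"
    "atom_mat a $ 2 $ 2 = 1 + of_real (atom_left a * atom_mid a)"
proof -
  have "cosh \<theta> = 1 + sinh \<theta> * rot_shear \<theta> \<and> sinh \<theta> = rot_shear \<theta> + rot_shear \<theta> + rot_shear \<theta> * sinh \<theta> * rot_shear \<theta>" for \<theta> :: real
  proof (cases "\<theta> = 0")
    case False
    then have s: "sinh \<theta> \<noteq> 0" by simp
    have "(cosh \<theta>)\<^sup>2 = (sinh \<theta>)\<^sup>2 + 1" by (rule cosh_square_eq)
    then have q: "sinh \<theta> * sinh \<theta> = (cosh \<theta> - 1) + (cosh \<theta> - 1) + (cosh \<theta> - 1) * (cosh \<theta> - 1)"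
      by (simp add: power2_eq_square algebra_simps)
    have sr: "sinh \<theta> * rot_shear \<theta> = cosh \<theta> - 1" using s by (simp add: rot_shear_def)
    have "sinh \<theta> * (rot_shear \<theta> + rot_shear \<theta> + rot_shear \<theta> * sinh \<theta> * rot_shear \<theta>)
        = sinh \<theta> * rot_shear \<theta> + sinh \<theta> * rot_shear \<theta> + (sinh \<theta> * rot_shear \<theta>) * (sinh \<theta> * rot_shear \<theta>)"
      by (simp add: algebra_simps)
    also have "\<dots> = sinh \<theta> * sinh \<theta>" unfolding sr q ..
    finally show ?thesis using s sr by simp
  qed (simp add: rot_shear_def)
  then have r: "1 + sinh \<theta> * rot_shear \<theta> = cosh \<theta>" "1 + rot_shear \<theta> * sinh \<theta> = cosh \<theta>"
     "rot_shear \<theta> + rot_shear \<theta> + rot_shear \<theta> * sinh \<theta> * rot_shear \<theta> = sinh \<theta>" for \<theta> :: real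
    by (metis mult.commute)+
  have c: "complex_of_real (cosh \<theta>) = 1 + of_real (sinh \<theta> * rot_shear \<theta>)"
      "complex_of_real (cosh \<theta>) = 1 + of_real (rot_shear \<theta> * sinh \<theta>)" for \<theta> :: real
    by (metis r(1) of_real_1 of_real_add, metis r(2) of_real_1 of_real_add)
  show "atom_mat a $ 1 $ 1 = 1 + of_real (atom_mid a * atom_right a)"
    by (cases a) (simp_all only: atom_mat.simps atom_mid.simps atom_right.simps vector_2 c(1), simp_all)
  show "atom_mat a $ 1 $ 2 = - \<i> * of_real (atom_mid a)"
    by (cases a) simp_all
  show "atom_mat a $ 2 $ 1 = \<i> * of_real (atom_left a + atom_right a + atom_left a * atom_mid a * atom_right a)"
    by (cases a) (simp_all only: atom_mat.simps atom_left.simps atom_mid.simps atom_right.simps vector_2 r(3), simp_all)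
  show "atom_mat a $ 2 $ 2 = 1 + of_real (atom_left a * atom_mid a)"
    by (cases a) (simp_all only: atom_mat.simps atom_left.simps atom_mid.simps vector_2 c(2), simp_all)
qed

lemma Xi_mat_factors:
  fixes a :: "'n::finite \<Rightarrow> atom"
  assumes "\<And>j. atom_ok (a j)"
  shows "Xi_mat a = V_mat (damp_mat (\<lambda>j. atom_left (a j))) ** ((J_mat ** cmat (D_mat (- mat 1))) **
     (V_mat (damp_mat (\<lambda>j. atom_mid (a j))) ** (J_mat ** V_mat (damp_mat (\<lambda>j. atom_right (a j))))))"
proof -
  have "matrix_inv (- mat 1 :: real ^ 'n ^ 'n) = - mat 1"
    using matrix_inv_right[OF invertible_uminus_mat] by (metis add.inverse_inverse mat_minus_mult(1) matrix_mul_lid)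
  then have D: "cmat (D_mat (- mat 1 :: real ^ 'n ^ 'n)) = block (- mat 1) 0 0 (- mat 1)"
    by (simp add: cmat_D cmat_uminus cmat_one transpose_mat)
  show ?thesis
    unfolding Xi_mat_def V_mat_def J_mat_def D damp_mat_def diag_mat_const diag_block_mult atom_mat_factors[OF assms]
    by (intro arg_cong4[where f=block] arg_cong[where f=diag_mat] ext; simp add: algebra_simps)
qed

lemma acts_by_Xi_op:
  fixes a :: "'n::finite \<Rightarrow> atom"
  assumes a: "\<And>j. atom_ok (a j)"
  shows "acts_by (Xi_op a) (Xi_mat a)" "Xi_mat a \<in> Sp_plus"
proof -
  note n = atom_params_nonneg[OF a]
  note S = damp_mat_Sigma[of "\<lambda>j. atom_left (a j)", OF n(1)] damp_mat_Sigma[of "\<lambda>j. atom_mid (a j)", OF n(2)]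
    damp_mat_Sigma[of "\<lambda>j. atom_right (a j)", OF n(3)]
  have "Xi_op a = p_op (damp_mat (\<lambda>j. atom_left (a j))) \<circ> ((F_op \<circ> T_op (int CARD('n)) (- mat 1)) \<circ>
      (p_op (damp_mat (\<lambda>j. atom_mid (a j))) \<circ> (F_op \<circ> p_op (damp_mat (\<lambda>j. atom_right (a j))))))"
    by (simp add: Xi_op_eq[OF a] fun_eq_iff F_inv_def)
  then show "acts_by (Xi_op a) (Xi_mat a)"
    unfolding Xi_mat_factors[OF a]
    by (simp only:) (intro acts_by_comp acts_by_p_op acts_by_F_op acts_by_T_op S invertible_uminus_mat)
  have "J_mat \<in> (Sp_plus :: (complex ^ ('n + 'n) ^ ('n + 'n)) set)"
    using cmat_Sp_plus[OF J_mat_Sp] by (simp add: cmat_J)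
  then show "Xi_mat a \<in> Sp_plus"
    unfolding Xi_mat_factors[OF a]
    by (intro Sp_plus_mult V_mat_Sp_plus S cmat_Sp_plus D_mat_Sp invertible_uminus_mat)
qed

lemma Mp_plus_comp: "T \<in> Mp_plus \<Longrightarrow> U \<in> Mp_plus \<Longrightarrow> T \<circ> U \<in> Mp_plus"
  unfolding Mp_plus_def by (rule generated_semigroup.comp)

lemma Mp_subset_Mp_plus: "T \<in> Mp \<Longrightarrow> T \<in> Mp_plus"
  unfolding Mp_plus_def by (auto intro: generated_semigroup.base)

lemma Xi_op_Mp_plus: "(\<And>j. atom_ok (a j)) \<Longrightarrow> Xi_op a \<in> Mp_plus"
  unfolding Mp_plus_def by (auto intro!: generated_semigroup.base)

lemma acts_by_Mp_plus:
  assumes "T \<in> Mp_plus" shows "\<exists>S\<in>Sp_plus. acts_by T S"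
  using assms unfolding Mp_plus_def
proof induction
  case (base T)
  then show ?case using acts_by_Mp[of T] cmat_Sp_plus acts_by_Xi_op by blast
next
  case (comp T U)
  then show ?case using acts_by_comp Sp_plus_mult by blast
qed

text \<open>
  As for the real group: the relation \<open>acts_by\<close> restricted to the semigroup is the graph of a homomorphism
  with the prescribed values, and every other such homomorphism is contained in it.
\<close>

lemma pi_Mp_plus_eqI:
  fixes T :: "(real ^ 'n) l2 \<Rightarrow> (real ^ 'n) l2"
  assumes T: "T \<in> Mp_plus" and S: "acts_by T S"
  shows "pi_Mp_plus T = S"
proof -
  define p0 where "p0 = (\<lambda>T \<in> (Mp_plus :: ((real ^ 'n) l2 \<Rightarrow> (real ^ 'n) l2) set). SOME S. S \<in> Sp_plus \<and> acts_by T S)"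
  have p0: "p0 T \<in> Sp_plus" "acts_by T (p0 T)" if "T \<in> Mp_plus" for T
    using someI_ex[OF acts_by_Mp_plus[OF that, unfolded Bex_def]] that by (simp_all add: p0_def)
  have uniq: "p0 T = S" if "T \<in> Mp_plus" "acts_by T S" for T S
    by (rule acts_by_unique[OF p0(2)[OF that(1)] that(2)])
  have "pi_Mp_plus = p0"
    unfolding pi_Mp_plus_def
  proof (rule the_equality)
    have "p0 (T \<circ> U) = p0 T ** p0 U" if "T \<in> Mp_plus" "U \<in> Mp_plus" for T U
      by (rule uniq[OF Mp_plus_comp[OF that]]) (simp add: acts_by_comp p0 that)
    moreover have "p0 T = cmat (pi_Mp T)" if "T \<in> Mp" for T
      by (rule uniq[OF Mp_subset_Mp_plus[OF that] pi_Mp_acts_by[OF that]])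
    moreover have "p0 (Xi_op a) = Xi_mat a" if "\<forall>j. atom_ok (a j)" for a
      by (rule uniq) (use that in \<open>auto intro: Xi_op_Mp_plus acts_by_Xi_op\<close>)
    moreover have "p0 \<in> Mp_plus \<rightarrow>\<^sub>E Sp_plus" using p0(1) by (auto simp: p0_def PiE_def extensional_def)
    ultimately show "p0 \<in> Mp_plus \<rightarrow>\<^sub>E Sp_plus \<and>
     (\<forall>T\<in>Mp_plus. \<forall>U\<in>Mp_plus. p0 (T \<circ> U) = p0 T ** p0 U) \<and>
     (\<forall>T\<in>Mp. p0 T = cmat (pi_Mp T)) \<and>
     (\<forall>a. (\<forall>j. atom_ok (a j)) \<longrightarrow> p0 (Xi_op a) = Xi_mat a)"
      by blast
    fix p :: "((real ^ 'n) l2 \<Rightarrow> (real ^ 'n) l2) \<Rightarrow> complex ^ ('n + 'n) ^ ('n + 'n)"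
    assume p: "p \<in> Mp_plus \<rightarrow>\<^sub>E Sp_plus \<and>
     (\<forall>T\<in>Mp_plus. \<forall>U\<in>Mp_plus. p (T \<circ> U) = p T ** p U) \<and>
     (\<forall>T\<in>Mp. p T = cmat (pi_Mp T)) \<and>
     (\<forall>a. (\<forall>j. atom_ok (a j)) \<longrightarrow> p (Xi_op a) = Xi_mat a)"
    have "acts_by T (p T)" if "T \<in> Mp_plus" for T
      using that unfolding Mp_plus_def
    proof induction
      case (base T)
      from base consider "T \<in> Mp" | a where "\<And>j. atom_ok (a j)" "T = Xi_op a" by blast
      then show ?case
      proof cases
        case 1
        then show ?thesis using p pi_Mp_acts_by by simp
      next
        case (2 a)
        then show ?thesis using p acts_by_Xi_op(1)[OF 2(1)] by simp
      qed
    next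
      case (comp T U)
      have "p (T \<circ> U) = p T ** p U" using p comp.hyps unfolding Mp_plus_def by blast
      then show ?case by (simp only:) (rule acts_by_comp[OF comp.IH])
    qed
    then have "p T = p0 T" if "T \<in> Mp_plus" for T
      using uniq[OF that, of "p T"] that by simp
    then show "p = p0"
      using p by (intro extensionalityI[of _ Mp_plus]) (auto simp: p0_def PiE_def)
  qed
  then show ?thesis using uniq[OF T S] by simp
qed

section \<open>Positive semidefinite multipliers\<close>

definition i_mat :: "real ^ 'n ^ 'n \<Rightarrow> complex ^ 'n ^ 'n" where
  "i_mat Y = (\<chi> i j. \<i> * of_real (Y $ i $ j))"

definition psd :: "(real ^ 'n ^ 'n) set" where
  "psd = {Y. transpose Y = Y \<and> (\<forall>x. 0 \<le> x \<bullet> (Y *v x))}"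

lemma i_mat_Sigma: "Y \<in> psd \<Longrightarrow> i_mat Y \<in> Sigma_ge0"
  by (simp add: psd_def Sigma_ge0_def i_mat_def transpose_def vec_eq_iff)

lemma i_mat_add: "i_mat (X + Y) = i_mat X + i_mat Y"
  by (simp add: i_mat_def vec_eq_iff distrib_left)

definition outer :: "real ^ 'n \<Rightarrow> real ^ 'n ^ 'n" where
  "outer v = (\<chi> i j. v $ i * v $ j)"

lemma outer_quadratic: "x \<bullet> (outer v *v x) = (v \<bullet> x)\<^sup>2"
  by (simp add: outer_def inner_vec_def matrix_vector_mult_def sum_distrib_left sum_distrib_right
      power2_eq_square sum_product mult_ac)

lemma outer_psd: "outer v \<in> psd"
  by (simp add: psd_def outer_quadratic) (simp add: outer_def transpose_def vec_eq_iff mult.commute)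

lemma chirp_outer: "chirp (i_mat (outer v)) x = of_real (exp (- pi * (v \<bullet> x)\<^sup>2))"
proof -
  have "cdot (i_mat (outer v) *v cvec x) (cvec x) = \<i> * of_real (x \<bullet> (outer v *v x))"
    unfolding cdot_matrix by (simp add: i_mat_def cvec_def inner_vec_def matrix_vector_mult_def sum_distrib_left mult_ac)
  moreover have "\<i> * of_real pi * (\<i> * of_real r) = of_real (- pi * r)" for r :: real
    by (simp add: complex_eq_iff)
  ultimately show ?thesis unfolding chirp_def by (simp only: outer_quadratic exp_of_real)
qed

text \<open>
  The multiplier of a rank one form is the atomic contraction in one coordinate, transported by a
  linear change of variables that makes the linear functional that coordinate.
\<close>

lemma p_op_outer_Mp_plus: "p_op (i_mat (outer (v :: real ^ 'n))) \<in> Mp_plus"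
proof (cases "v = 0")
  case True
  have "i_mat (outer v) = 0" by (simp add: True i_mat_def outer_def vec_eq_iff)
  then have "p_op (i_mat (outer v)) = T_op 0 (mat 1)" by (simp add: p_op_zero T_op_id)
  then show ?thesis using Mp_subset_Mp_plus[OF Mp_gens_in(3)[OF T_admissible_id]] by simp
next
  case False
  then obtain i where vi: "v $ i \<noteq> 0" by (auto simp: vec_eq_iff)
  \<comment> \<open>The identity with its row \<open>i\<close> replaced by \<open>v\<close>; expanding along the other rows, its determinant is \<open>v $ i\<close>.\<close>
  define E :: "real ^ 'n ^ 'n" where "E = (\<chi> k. if k = i then v else axis k 1)"
  have Ev: "(E *v x) $ i = v \<bullet> x" for x
    by (simp add: E_def matrix_vector_mult_def inner_vec_def)
  have inv: "invertible E"
  proof -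
    have "x = 0" if x: "E *v x = 0" for x
    proof -
      have k: "x $ k = 0" if "k \<noteq> i" for k
      proof -
        have "(E *v x) $ k = axis k 1 \<bullet> x"
          using that by (simp add: E_def matrix_vector_mult_def inner_vec_def)
        then show ?thesis using x by (simp add: inner_axis')
      qed
      have "0 = v \<bullet> x" using Ev[of x] x by simp
      also have "\<dots> = v $ i * x $ i"
        unfolding inner_vec_def using k by (subst sum.remove[of _ i]) auto
      finally have "x $ i = 0" using vi by simp
      then show ?thesis using k by (metis vec_eq_iff zero_index)
    qed
    then have "\<exists>B. B ** E = mat 1" by (simp add: matrix_left_invertible_ker)
    then show ?thesis by (metis invertible_def matrix_left_right_inverse)
  qed
  obtain m :: int where m: "T_admissible m E"
  proof (cases "0 < det E")
    case True
    then show ?thesis using that[of 0] by (simp add: T_admissible_iff)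
  next
    case False
    then show ?thesis using that[of 1] inv by (simp add: T_admissible_iff invertible_det_nz)
  qed
  \<comment> \<open>The rotation by the angle \<open>0\<close> is the identity, so this atomic contraction damps one coordinate only.\<close>
  define a where "a j = (if j = i then Gauss 1 else Rot 0)" for j :: 'n
  have a: "atom_ok (a j)" for j by (simp add: a_def)
  have aL: "atom_left (a j) = (if j = i then 1 else 0)" "atom_mid (a j) = 0" "atom_right (a j) = 0" for j
    by (simp_all add: a_def rot_shear_def)
  have z: "damp_mat (\<lambda>j. 0) = (0 :: complex ^ 'n ^ 'n)"
    by (simp add: damp_mat_def diag_mat_def vec_eq_iff)
  let ?L = "damp_mat (\<lambda>j. if j = i then 1 else 0)"
  have LS: "?L \<in> Sigma_ge0" by (rule damp_mat_Sigma) simp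
  have Xi: "Xi_op a = p_op ?L"
    by (simp add: Xi_op_eq[OF a] aL z p_op_zero fun_eq_iff)
  have L: "chirp ?L (E *v x) = chirp (i_mat (outer v)) x" for x
  proof -
    have "chirp ?L (E *v x) = (\<Prod>j\<in>UNIV. if j = i then damp 1 (v \<bullet> x) else 1)"
      unfolding chirp_damp_mat by (intro prod.cong refl) (auto simp: Ev damp_zero)
    then show ?thesis by (simp add: chirp_outer damp_def)
  qed
  have "p_op (i_mat (outer v)) = T_op m E \<circ> (Xi_op a \<circ> T_op (- m) (matrix_inv E))"
    by (simp add: fun_eq_iff Xi p_op_eq T_op_mult_op[OF inv multiplier_chirp[OF LS]] L T_op_inverse[OF inv])
  then show ?thesis
    using Mp_plus_comp[OF Mp_subset_Mp_plus[OF Mp_gens_in(3)[OF m]] Mp_plus_comp[OF Xi_op_Mp_plus[OF a]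
        Mp_subset_Mp_plus[OF Mp_gens_in(3)[OF T_admissible_inverse[OF m]]]]] by simp
qed

text \<open>
  Otherwise the form would take negative values at \<open>axis j 1 + t axis i 1\<close>, where it is affine in \<open>t\<close> with
  slope \<open>2 Y $ i $ j\<close>.
\<close>

lemma psd_entry_zero:
  assumes Y: "Y \<in> psd" and d: "Y $ i $ i = 0" shows "Y $ i $ j = 0"
proof (rule ccontr)
  assume nz: "Y $ i $ j \<noteq> 0"
  have sym: "Y $ j $ i = Y $ i $ j"
    using Y by (metis (mono_tags, lifting) psd_def mem_Collect_eq transpose_def vec_lambda_beta)
  have q: "(axis j 1 + t *\<^sub>R axis i 1) \<bullet> (Y *v (axis j 1 + t *\<^sub>R axis i 1)) = Y $ j $ j + 2 * t * Y $ i $ j" for t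
    by (simp add: matrix_vector_right_distrib matrix_vector_mult_scaleR inner_add_left inner_add_right inner_axis'
        matrix_vector_mult_basis column_def d sym)
  have "0 \<le> Y $ j $ j + 2 * (- (Y $ j $ j + 1) / (2 * Y $ i $ j)) * Y $ i $ j"
    unfolding q[symmetric] using Y by (simp add: psd_def)
  moreover have "2 * (- (Y $ j $ j + 1) / (2 * Y $ i $ j)) * Y $ i $ j = - (Y $ j $ j + 1)"
    using nz by simp
  ultimately show False by linarith
qed

text \<open>
  Completing the square in the coordinate \<open>i\<close>: \<open>(v \<bullet> x)\<^sup>2\<close> is the part of the quadratic form that involves
  \<open>x $ i\<close>, and the form of the difference at \<open>x\<close> is the minimum of the form of \<open>Y\<close> over the line through \<open>x\<close> in
  that coordinate direction, hence nonnegative.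
\<close>

lemma psd_reduce:
  fixes Y :: "real ^ 'n ^ 'n"
  assumes Y: "Y \<in> psd" and d: "Y $ i $ i \<noteq> 0"
  defines "v \<equiv> (1 / sqrt (Y $ i $ i)) *\<^sub>R (Y $ i)"
  shows "Y - outer v \<in> psd" "(Y - outer v) $ i $ i = 0" "Y $ j $ j = 0 \<Longrightarrow> (Y - outer v) $ j $ j = 0"
proof -
  have sym: "Y $ j $ k = Y $ k $ j" for j k
    using Y by (metis (mono_tags, lifting) psd_def mem_Collect_eq transpose_def vec_lambda_beta)
  have Yq: "0 \<le> x \<bullet> (Y *v x)" for x using Y by (simp add: psd_def)
  have "Y $ i $ i = axis i 1 \<bullet> (Y *v axis i 1)"
    by (simp add: inner_axis' matrix_vector_mult_basis column_def)
  then have pos: "0 < Y $ i $ i" using Yq[of "axis i 1"] d by simp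
  have vv: "v $ j * v $ k = Y $ i $ j * Y $ i $ k / Y $ i $ i" for j k
    using pos by (simp add: v_def)
  have "0 \<le> x \<bullet> ((Y - outer v) *v x)" for x
  proof -
    let ?y = "Y $ i \<bullet> x" and ?d = "Y $ i $ i"
    have Yx: "(Y *v x) $ i = ?y" by (simp add: matrix_vector_mult_def inner_vec_def)
    have xY: "x \<bullet> (Y *v axis i 1) = ?y"
      by (simp add: matrix_vector_mult_basis column_def inner_vec_def sym[of _ i] mult.commute)
    have "0 \<le> (x - (?y / ?d) *\<^sub>R axis i 1) \<bullet> (Y *v (x - (?y / ?d) *\<^sub>R axis i 1))" by (rule Yq)
    also have "\<dots> = x \<bullet> (Y *v x) - 2 * (?y / ?d) * ?y + (?y / ?d)\<^sup>2 * ?d"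
      by (simp add: matrix_vector_mult_diff_distrib matrix_vector_mult_scaleR inner_diff_left inner_diff_right
          inner_axis' Yx xY power2_eq_square algebra_simps)
        (simp add: matrix_vector_mult_basis column_def)
    also have "\<dots> = x \<bullet> (Y *v x) - ?y\<^sup>2 / ?d"
      using pos by (simp add: power2_eq_square field_simps)
    also have "?y\<^sup>2 / ?d = x \<bullet> (outer v *v x)"
      using pos by (simp add: outer_quadratic v_def power_divide)
    finally show ?thesis by (simp add: matrix_vector_mult_diff_rdistrib inner_diff_right)
  qed
  moreover have "transpose (Y - outer v) = Y - outer v"
    by (simp add: transpose_def vec_eq_iff outer_def sym mult.commute)
  ultimately show "Y - outer v \<in> psd" by (simp add: psd_def)
  show "(Y - outer v) $ i $ i = 0" using pos by (simp add: outer_def vv)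
  show "(Y - outer v) $ j $ j = 0" if "Y $ j $ j = 0"
    using psd_entry_zero[OF Y that, of i] by (simp add: outer_def vv that sym[of i j])
qed

text \<open>
  Each step splits off a rank one form and reduces the number of nonzero diagonal entries; a positive
  semidefinite matrix with zero diagonal is zero.
\<close>

lemma p_op_psd_Mp_plus:
  fixes Y :: "real ^ 'n ^ 'n"
  assumes "Y \<in> psd" shows "p_op (i_mat Y) \<in> Mp_plus"
  using assms
proof (induction "card {i. Y $ i $ i \<noteq> 0}" arbitrary: Y rule: less_induct)
  case less
  show ?case
  proof (cases "\<exists>i. Y $ i $ i \<noteq> 0")
    case False
    then have "Y = outer 0" using psd_entry_zero[OF less.prems] by (simp add: vec_eq_iff outer_def)
    then show ?thesis using p_op_outer_Mp_plus by simp
  next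
    case True
    then obtain i where i: "Y $ i $ i \<noteq> 0" by blast
    define v where "v = (1 / sqrt (Y $ i $ i)) *\<^sub>R (Y $ i)"
    note r = psd_reduce[OF less.prems i, folded v_def]
    have "{j. (Y - outer v) $ j $ j \<noteq> 0} \<subset> {j. Y $ j $ j \<noteq> 0}" using r(2,3) i by blast
    then have "card {j. (Y - outer v) $ j $ j \<noteq> 0} < card {j. Y $ j $ j \<noteq> 0}"
      by (intro psubset_card_mono) auto
    then have "p_op (i_mat (Y - outer v)) \<in> Mp_plus" using less.hyps r(1) by blast
    moreover have "p_op (i_mat Y) = p_op (i_mat (Y - outer v)) \<circ> p_op (i_mat (outer v))"
      by (simp add: fun_eq_iff p_op_p_op i_mat_Sigma r(1) outer_psd flip: i_mat_add)
    ultimately show ?thesis using Mp_plus_comp p_op_outer_Mp_plus by metis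
  qed
qed

lemma p_op_Mp_plus:
  assumes Q: "Q \<in> Sigma_ge0" shows "p_op Q \<in> Mp_plus"
proof -
  define X where "X = (\<chi> i j. Re (Q $ i $ j))"
  have sym: "Q $ i $ j = Q $ j $ i" for i j
    using Q by (metis (mono_tags, lifting) Sigma_ge0_def mem_Collect_eq transpose_def vec_lambda_beta)
  have X: "transpose X = X" by (simp add: X_def transpose_def vec_eq_iff sym)
  have Y: "im_mat Q \<in> psd"
    using Q by (simp add: psd_def Sigma_ge0_def im_mat_def transpose_def vec_eq_iff)
  have "Q = cmat X + i_mat (im_mat Q)"
    by (simp add: X_def cmat_def i_mat_def im_mat_def vec_eq_iff complex_eq_iff)
  then have "p_op Q = p_op (cmat X) \<circ> p_op (i_mat (im_mat Q))"
    by (simp add: fun_eq_iff p_op_p_op real_Sigma X i_mat_Sigma Y)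
  then show ?thesis
    using Mp_plus_comp[OF Mp_subset_Mp_plus[OF Mp_gens_in(2)[OF X]] p_op_psd_Mp_plus[OF Y]] by simp
qed

lemma generated_semigroup_closed:
  assumes "\<And>T. T \<in> G \<Longrightarrow> T \<in> generated_semigroup H"
  shows "generated_semigroup G \<subseteq> generated_semigroup H"
proof
  fix T assume "T \<in> generated_semigroup G"
  then show "T \<in> generated_semigroup H"
  proof induction
    case (base T)
    then show ?case by (rule assms)
  next
    case (comp T U)
    show ?case by (rule generated_semigroup.comp[OF comp.IH])
  qed
qed

theorem proposition4p2:
  shows "(Mp_plus :: ((real ^ 'n) l2 \<Rightarrow> (real ^ 'n) l2) set) =
      generated_semigroup
        ({F_op} \<union> {p_op Q |Q. Q \<in> Sigma_ge0} \<union> {T_op m E |m E. T_admissible m E}) \<and>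
    (\<forall>Q \<in> Sigma_ge0. bounded_linear (p_op (Q :: complex ^ 'n ^ 'n)) \<and>
      (\<forall>f. norm (p_op Q f) \<le> norm f)) \<and>
    (\<forall>m (E :: real ^ 'n ^ 'n). T_admissible m E \<longrightarrow>
      bounded_linear (T_op m E) \<and> (\<forall>f. norm (T_op m E f) \<le> norm f)) \<and>
    pi_Mp_plus (F_op :: (real ^ 'n) l2 \<Rightarrow> (real ^ 'n) l2) = J_mat \<and>
    (\<forall>Q \<in> Sigma_ge0. pi_Mp_plus (p_op (Q :: complex ^ 'n ^ 'n)) = V_mat Q) \<and>
    (\<forall>m (E :: real ^ 'n ^ 'n). T_admissible m E \<longrightarrow>
      pi_Mp_plus (T_op m E) = cmat (D_mat E))"
proof (intro conjI allI ballI impI)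
  let ?G = "{F_op} \<union> {p_op Q |Q. Q \<in> Sigma_ge0} \<union> {T_op m E |m E. T_admissible m E} :: ((real ^ 'n) l2 \<Rightarrow> (real ^ 'n) l2) set"
  have gens: "F_op \<in> generated_semigroup ?G" "\<And>Q. Q \<in> Sigma_ge0 \<Longrightarrow> p_op Q \<in> generated_semigroup ?G"
    "\<And>m E. T_admissible m E \<Longrightarrow> T_op m E \<in> generated_semigroup ?G"
    by (auto intro!: generated_semigroup.base)
  have "Mp \<subseteq> generated_semigroup ?G"
    unfolding Mp_eq_semigroup
    by (rule generated_semigroup_closed) (use gens real_Sigma in \<open>auto simp: Mp_gens_def\<close>)
  moreover have "Xi_op a \<in> generated_semigroup ?G" if a: "\<forall>j. atom_ok (a j)" for a :: "'n \<Rightarrow> atom"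
  proof -
    have a': "atom_ok (a j)" for j using a by blast
    have "Xi_op a = p_op (damp_mat (\<lambda>j. atom_left (a j))) \<circ> (F_op \<circ> (T_op (int CARD('n)) (- mat 1) \<circ>
      (p_op (damp_mat (\<lambda>j. atom_mid (a j))) \<circ> (F_op \<circ> p_op (damp_mat (\<lambda>j. atom_right (a j)))))))"
      by (simp add: Xi_op_eq[OF a'] fun_eq_iff F_inv_def)
    then show ?thesis
      by (simp only:) (intro generated_semigroup.comp gens damp_mat_Sigma atom_params_nonneg a' T_admissible_uminus)
  qed
  ultimately have "Mp_plus \<subseteq> generated_semigroup ?G"
    unfolding Mp_plus_def by (intro generated_semigroup_closed) auto
  moreover have "generated_semigroup ?G \<subseteq> Mp_plus"
  proof -
    have "T \<in> Mp_plus" if "T \<in> ?G" for T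
      using that Mp_subset_Mp_plus Mp_gens_in p_op_Mp_plus by auto
    then show ?thesis
      unfolding Mp_plus_def by (rule generated_semigroup_closed)
  qed
  ultimately show "Mp_plus = generated_semigroup ?G" by (rule subset_antisym)
next
  show "pi_Mp_plus (F_op :: (real ^ 'n) l2 \<Rightarrow> (real ^ 'n) l2) = J_mat"
    by (rule pi_Mp_plus_eqI[OF Mp_subset_Mp_plus[OF Mp_gens_in(1)] acts_by_F_op])
next
  fix Q :: "complex ^ 'n ^ 'n" assume Q: "Q \<in> Sigma_ge0"
  show "bounded_linear (p_op Q)" "norm (p_op Q f) \<le> norm f" for f
    by (rule p_op_props[OF Q])+
  show "pi_Mp_plus (p_op Q) = V_mat Q"
    by (rule pi_Mp_plus_eqI[OF p_op_Mp_plus[OF Q] acts_by_p_op[OF Q]])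
next
  fix m and E :: "real ^ 'n ^ 'n" assume E: "T_admissible m E"
  note i = T_admissible_invertible[OF E]
  show "bounded_linear (T_op m E)" by (rule bounded_linear_T_op[OF i])
  show "norm (T_op m E f) \<le> norm f" for f by (simp add: norm_T_op[OF i])
  show "pi_Mp_plus (T_op m E) = cmat (D_mat E)"
    by (rule pi_Mp_plus_eqI[OF Mp_subset_Mp_plus[OF Mp_gens_in(3)[OF E]] acts_by_T_op[OF i]])
qed

end
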